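(* Consider Algorithm 1 (Asynchronous Stochastic Gradient Descent with Tracking), described in the context, run on $\min_{\mathbf{x}\in\mathbb{R}^n}\mathbb{E}_\zeta[F(\mathbf{x},\zeta)]=\sum_{i=1}^m\mathbb{E}_\zeta[f_i(\mathbf{x},\zeta)]$, and let the problem, network, activation, delay and stochastic-gradient assumptions listed in the context hold. Assume that the step-size sequence $\{\gamma^k\}$ satisfies $$\sum_{k=1}^\infty\gamma^k=\infty,\qquad \sum_{k=1}^\infty(\gamma^k)^2<\infty,\qquad \gamma^0\le\min\left\{\frac{1}{1+\eta},\ \frac{1}{4(L+C^c_2+C^t_2)}\right\},$$ where $L,\eta,C_2^c,C_2^t$ are the constants described in the context. Then the merit function $M(\bar{\mathbf{z}}^k,\mathbf{h}^k,\mathbf{x}^k_\psi)=\mathbb{E}\left[E^k_t+E^k_c+E^k_z\right]$, with the gradient-tracking, consensus and gradient-norm errors $E_t^k,E_c^k,E_z^k$ defined in the context, is sublinearly convergent with the standard ergodic rate $$\sum_{l=0}^k\gamma^l M(\bar{\mathbf{z}}^l,\mathbf{h}^l,\mathbf{x}^l_\psi)\ \le\ \frac{C}{\sum_{l=0}^k\gamma^l}$$ for some constant $C>0$.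
   Context: **Problem.** Write $f_i(\mathbf{x})=\mathbb{E}_\zeta[f_i(\mathbf{x},\zeta)]$, $F(\mathbf{x},\zeta)=\sum_{i=1}^m f_i(\mathbf{x},\zeta)$ and $F(\mathbf{x})=\mathbb{E}_\zeta[F(\mathbf{x},\zeta)]$ on $\mathbb{R}^n$. For a.e. $\zeta$, each $f_i(\cdot,\zeta)$ is proper, closed and continuously differentiable with $L_i$-Lipschitz gradient, and $F(\cdot,\zeta)$ is bounded from below. No convexity is assumed. $L$ is a Lipschitz constant of $\nabla F$. **Network.** $\mathcal{G}=(\mathcal{V},\mathcal{E})$, $\mathcal{V}=\{1,\dots,m\}$, is a strongly connected digraph; $(i,j)\in\mathcal{E}$ means that $i$ can send to $j$. $\mathcal{N}^{in}_i=\{j:(j,i)\in\mathcal{E}\}$, $\mathcal{N}^{out}_i=\{j:(i,j)\in\mathcal{E}\}$. The weights $w_{ij}$, $a_{ij}$ used in the algorithm satisfy: there is $\bar m>0$ with $w_{ij}\ge\bar m$ and $a_{ij}\ge\bar m$ for every edge along which $j$ sends to $i$; the matrix $\mathbf{W}$ composed of the $w_{ij}$ is row-stochastic ($\mathbf{W}\mathbf{1}=\mathbf{1}$) and the matrix $\mathbf{A}$ composed of the $a_{ij}$ is column-stochastic ($\mathbf{A}^T\mathbf{1}=\mathbf{1}$) (entries not used by the algorithm are zero). **Asynchrony.** At each iteration $k$ an active agent $i^k\in\mathcal{V}$ and delays $d^k=(d_j^k)_j$ are chosen. There are positive integers $T,D$ such that $\bigcup_{t=k}^{k+T-1}\{i^t\}=\mathcal{V}$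 and $0\le d_j^k\le D$ for all $j\in\mathcal{N}^{in}_{i^k}$ and all $k$. **Algorithm 1** (step-sizes $\gamma^k\in(0,1]$). Initialization: $\mathbf{x}_i^0=\mathbf{0}$ and $\mathbf{z}_i^0=\tilde\nabla f_i(\mathbf{0},\zeta^{\rm init})$ (a sample gradient) for all $i$; mass counters $\rho_{ij}$ and buffers $\tilde\rho_{ij}$, and $\mathbf{v}_i^t$ for $t\le 0$, start at $\mathbf{0}$. At iteration $k$, with $i=i^k$: - $\tau^k_{ij}=\max\{\tau_{ij}^{k-1},k-d^k_j\}$ for $j\in\mathcal{N}^{in}_i$; - (S1) $\mathbf{v}_i^{k+1}=\mathbf{x}_i^k-\gamma^k\mathbf{z}_i^k$; - (S2) $\mathbf{x}_i^{k+1}=w_{ii}\mathbf{v}_i^{k+1}+\sum_{j\in\mathcal{N}^{in}_i}w_{ij}\mathbf{v}_j^{\tau^k_{ij}}$; - (S3.1) $\mathbf{z}_i^{k+1/2}=\mathbf{z}_i^k+\sum_{j\in\mathcal{N}^{in}_i}\big(\rho_{ij}^{\tau^k_{ij}}-\tilde\rho_{ij}^k\big)+\tilde\nabla f_i(\mathbf{x}_i^{k+1},\zeta^k)-\tilde\nabla f_i(\mathbf{x}_i^{k},\zeta^{j(i,k)})$, where $j(i,k)$ is the last iteration before $k$ at which agent $i$ was active (the initial sample is used if there is none); - (S3.2) $\mathbf{z}_i^{k+1}=a_{ii}\mathbf{z}_i^{k+1/2}$ and $\rho_{ji}^{k+1}=\rho_{ji}^k+a_{ji}\mathbf{z}_i^{k+1/2}$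 for $j\in\mathcal{N}^{out}_i$; - (S3.3) $\tilde\rho_{ij}^{k+1}=\rho_{ij}^{\tau^k_{ij}}$ for $j\in\mathcal{N}^{in}_i$; - (S4) all other variables keep their value when passing to index $k+1$. **Stochastic gradients.** $\mathbb{E}[\tilde\nabla f_{i^k}(\mathbf{x}^{k+1}_{i^k},\zeta^k)]=\nabla f_{i^k}(\mathbf{x}^{k+1}_{i^k})$ and $\mathbb{E}\big[\|\tilde\nabla f_{i^k}(\mathbf{x}^{k+1}_{i^k},\zeta^k)-\nabla f_{i^k}(\mathbf{x}^{k+1}_{i^k})\|^2\big]=\sigma^2$. **Exact-gradient vector.** $\bar{\mathbf{z}}_i^k$, representing the update that would be made if actual rather than stochastic gradients were computed, is $$\bar{\mathbf{z}}_i^k=\nabla f_i(\mathbf{x}_i^0)+\sum_{0\le t<k:\ i^t=i}\big(\nabla f_i(\mathbf{x}_i^{t+1})-\nabla f_i(\mathbf{x}_i^t)\big),$$ and $\bar{\mathbf{z}}^k$ stacks $\bar{\mathbf{z}}_1^k,\dots,\bar{\mathbf{z}}_m^k$. **Augmented tracking system and $\xi^k$.** For each $(j,i)\in\mathcal{E}$ introduce virtual nodes $(j,i)^0,\dots,(j,i)^D$. The augmented vector $\hat{\mathbf{z}}^k$ stacks the $\mathbf{z}_i^k$ and the virtual entries $\mathbf{z}^k_{(j,i)^d}$ (zero at $k=0$). With $i=i^k$: in the sum step agent $i$ absorbs $\mathbf{z}^k_{(j,i)^d}$ for all $j\in\mathcal{N}^{in}_i$ and $k-\tau^k_{ij}\le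 d\le D$, these entries are set to $\mathbf{0}$, and other virtual entries are unchanged (values at $k+\frac12$). In the push step $\mathbf{z}_i^{k+1}=a_{ii}\mathbf{z}_i^{k+1/2}$; $\mathbf{z}^{k+1}_{(i,j)^0}=a_{ji}\mathbf{z}_i^{k+1/2}$ for $j\in\mathcal{N}^{out}_i$; $\mathbf{z}^{k+1}_{(r,j)^0}=\mathbf{0}$ for $r\ne i$; $\mathbf{z}^{k+1}_{(r,j)^d}=\mathbf{z}^{k+1/2}_{(r,j)^{d-1}}$ for $1\le d\le D-1$; and $\mathbf{z}^{k+1}_{(r,j)^D}=\mathbf{z}^{k+1/2}_{(r,j)^D}+\mathbf{z}^{k+1/2}_{(r,j)^{D-1}}$. Thus $\hat{\mathbf{z}}^{k+1}=\hat{\mathbf{A}}^k\hat{\mathbf{z}}^k+\mathbf{p}^k$ with a mixing matrix $\hat{\mathbf{A}}^k$ (acting blockwise) and $\mathbf{p}^k$ the change due to the new stochastic gradients. With $\hat{\mathbf{A}}^{k:t}=\hat{\mathbf{A}}^k\cdots\hat{\mathbf{A}}^t$, $\{\xi^k\}$ is a sequence of stochastic vectors with $|\hat{\mathbf{A}}^{k:t}_{ij}-\xi^k_i|\le C_0\rho^{k-t}$ for all $k\ge t$ and all $i,j$, for some $C_0>0$, $\rho<1$ (such a sequence is known to exist); $\xi^{-1}$ is any stochastic vector. **Augmented consensus system and $\mathbf{x}_\psi^k$.** Let $\mathbf{x}^k,\mathbf{v}^k$ stack the agents' variables and $\mathbf{h}^k=[\mathbf{x}^k;\mathbf{v}^k;\mathbf{v}^{k-1};\dots;\mathbf{v}^{k-D}]$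 ($(D+2)m$ blocks in $\mathbb{R}^n$). Then $\mathbf{h}^{k+1}=(\hat{\mathbf{W}}^k\otimes\mathbf{I}_n)(\mathbf{h}^k+\delta^k)$, where $\delta^k$ has block $i^k$ equal to $-\gamma^k\mathbf{z}^k_{i^k}$ and other blocks zero, and $\hat{\mathbf{W}}^k$ has entries $(i^k,i^k)$: $w_{i^ki^k}$; $(i^k,\,j+(k-\tau^k_{i^kj}+1)m)$: $w_{i^kj}$ for $j\in\mathcal{N}^{in}_{i^k}$; $(r,r)$: $1$ for $r\in\{1,\dots,2m\}\setminus\{i^k,i^k+m\}$; $(i^k+m,i^k)$: $1$; $(r,r-m)$: $1$ for $2m<r\le(D+2)m$; $0$ otherwise. With $\hat{\mathbf{W}}^{k:t}=\hat{\mathbf{W}}^k\cdots\hat{\mathbf{W}}^t$, $\{\psi^t\}$ is a sequence of stochastic vectors with $|\hat{\mathbf{W}}^{k:t}-\mathbf{1}(\psi^t)^T|\le C_0\rho^{k-t}$ (known to exist), and $\mathbf{x}_\psi^k=((\psi^k)^T\otimes\mathbf{I}_n)\mathbf{h}^k$. **Error terms.** $$E_t^k=\big\|\bar{\mathbf{z}}^k_{i^k}-\xi^{k-1}_{i^k}(\mathbf{1}^T\otimes\mathbf{I}_n)\bar{\mathbf{z}}^k\big\|^2,\quad E_c^k=\big\|\mathbf{h}^k-\mathbf{1}\otimes\mathbf{x}_\psi^k\big\|^2,\quad E_z^k=\big\|\bar{\mathbf{z}}^k_{i^k}\big\|^2.$$ **Constants.** $\eta>0$ is a lower bound $\psi^k_i\ge\eta$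 for all $k$ and all $i\in\mathcal{V}$. $C_2^c$ and $C_2^t$ are constants, arising in the proof, for which (with some constants $C_1^c,C_1^t$) for all $k$ $$\sum_{l=0}^k\mathbb{E}[E_c^l]\le C_1^c+C_2^c\sum_{l=0}^k(\gamma^l)^2\big(\mathbb{E}[E_z^l]+m\sigma^2\big),\qquad \sum_{l=0}^k\mathbb{E}[E_t^l]\le C_1^t+C_2^t\sum_{l=0}^k(\gamma^l)^2\big(\mathbb{E}[E_z^l]+m\sigma^2\big).$$
   Formalization: The rate is stated for the γ-weighted average, (Σγ^l M^l)/(Σγ^l) ≤ C/Σγ^l, as the printed display would force M=0; "bounded from below" means by a bound integrable in ζ; initial sample gradients are assumed square integrable, as otherwise M is infinite. *)

theory Defs
  imports "HOL-Probability.Probability"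
begin

section \<open>Gradients and the problem\<close>

definition grad :: "(real ^ 'n \<Rightarrow> real) \<Rightarrow> real ^ 'n \<Rightarrow> real ^ 'n" where
  "grad f x = (THE g. GDERIV f x :> g)"

text \<open>
  Functions are real-valued on the whole space, so a continuously differentiable
  function is automatically proper and closed.
\<close>

definition C1_lipschitz_grad :: "real \<Rightarrow> (real ^ 'n \<Rightarrow> real) \<Rightarrow> bool" where
  "C1_lipschitz_grad L f \<longleftrightarrow>
     (\<forall>x. f differentiable (at x)) \<and> continuous_on UNIV (grad f) \<and> L-lipschitz_on UNIV (grad f)"

text \<open>\<open>f i x \<zeta>\<close> is the sample cost of agent \<open>i\<close>, and \<open>P\<close> is the law of \<open>\<zeta>\<close>.\<close>

definition mean_cost :: "'z measure \<Rightarrow> (nat \<Rightarrow> real ^ 'n \<Rightarrow> 'z \<Rightarrow> real) \<Rightarrow> nat \<Rightarrow> real ^ 'n \<Rightarrow> real" where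
  "mean_cost P f i x = (\<integral>\<zeta>. f i x \<zeta> \<partial>P)"

definition sample_total :: "nat \<Rightarrow> (nat \<Rightarrow> real ^ 'n \<Rightarrow> 'z \<Rightarrow> real) \<Rightarrow> real ^ 'n \<Rightarrow> 'z \<Rightarrow> real" where
  "sample_total m f x \<zeta> = (\<Sum>i=1..m. f i x \<zeta>)"

definition total_cost :: "'z measure \<Rightarrow> nat \<Rightarrow> (nat \<Rightarrow> real ^ 'n \<Rightarrow> 'z \<Rightarrow> real) \<Rightarrow> real ^ 'n \<Rightarrow> real" where
  "total_cost P m f x = (\<integral>\<zeta>. sample_total m f x \<zeta> \<partial>P)"

definition sample_grad :: "(nat \<Rightarrow> real ^ 'n \<Rightarrow> 'z \<Rightarrow> real) \<Rightarrow> nat \<Rightarrow> real ^ 'n \<Rightarrow> 'z \<Rightarrow> real ^ 'n" where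
  "sample_grad f i x \<zeta> = grad (\<lambda>y. f i y \<zeta>) x"

definition true_grad :: "'z measure \<Rightarrow> (nat \<Rightarrow> real ^ 'n \<Rightarrow> 'z \<Rightarrow> real) \<Rightarrow> nat \<Rightarrow> real ^ 'n \<Rightarrow> real ^ 'n" where
  "true_grad P f i = grad (mean_cost P f i)"

text \<open>
  The expectations defining the costs have to exist, and the sample gradients have to be
  jointly measurable for the iterates to be random variables.  The lower bound of the sampled
  total cost may depend on the sample but has to be integrable: a pointwise bound
  alone does not keep the expected total cost bounded below.
\<close>

definition valid_problem ::
    "'z measure \<Rightarrow> nat \<Rightarrow> (nat \<Rightarrow> real ^ 'n \<Rightarrow> 'z \<Rightarrow> real) \<Rightarrow> (nat \<Rightarrow> real) \<Rightarrow> bool" where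
  "valid_problem P m f Li \<longleftrightarrow>
     prob_space P \<and>
     (\<forall>i\<in>{1..m}. \<forall>x. integrable P (f i x)) \<and>
     (\<forall>i\<in>{1..m}. (\<lambda>(x, \<zeta>). sample_grad f i x \<zeta>) \<in> borel_measurable (borel \<Otimes>\<^sub>M P)) \<and>
     (AE \<zeta> in P. \<forall>i\<in>{1..m}. C1_lipschitz_grad (Li i) (\<lambda>x. f i x \<zeta>)) \<and>
     (\<exists>b. integrable P b \<and> (AE \<zeta> in P. \<forall>x. b \<zeta> \<le> sample_total m f x \<zeta>))"

section \<open>Network and asynchrony\<close>

text \<open>
  The agents are \<open>1, \<dots>, m\<close>; \<open>(i, j) \<in> edges\<close> means that \<open>i\<close> can send to \<open>j\<close>, whereas
  the weights \<open>row_wt N i j\<close> (entries \<open>w\<^sub>i\<^sub>j\<close>) and \<open>col_wt N i j\<close> (entries \<open>a\<^sub>i\<^sub>j\<close>) belong to the transmission from \<open>j\<close> to \<open>i\<close>.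
  The activation and delay sequences are arbitrary but fixed (not random).
\<close>

record async_network =
  agents :: nat
  edges :: "(nat \<times> nat) set"
  row_wt :: "nat \<Rightarrow> nat \<Rightarrow> real"
  col_wt :: "nat \<Rightarrow> nat \<Rightarrow> real"
  period :: nat
  max_delay :: nat
  active :: "nat \<Rightarrow> nat"
  delay :: "nat \<Rightarrow> nat \<Rightarrow> nat"

definition nodes :: "async_network \<Rightarrow> nat set" where
  "nodes N = {1..agents N}"

definition N_in :: "async_network \<Rightarrow> nat \<Rightarrow> nat set" where
  "N_in N i = {j. (j, i) \<in> edges N}"

definition N_out :: "async_network \<Rightarrow> nat \<Rightarrow> nat set" where
  "N_out N i = {j. (i, j) \<in> edges N}"

definition strongly_connected_digraph :: "nat set \<Rightarrow> (nat \<times> nat) set \<Rightarrow> bool" where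
  "strongly_connected_digraph V E \<longleftrightarrow>
     E \<subseteq> V \<times> V \<and> irrefl E \<and> (\<forall>u\<in>V. \<forall>v\<in>V. (u, v) \<in> E\<^sup>*)"

definition valid_weights :: "async_network \<Rightarrow> bool" where
  "valid_weights N \<longleftrightarrow>
     (\<exists>mbar>0. \<forall>(j, i)\<in>edges N. row_wt N i j \<ge> mbar \<and> col_wt N i j \<ge> mbar) \<and>
     (\<forall>i\<in>nodes N. \<forall>j\<in>nodes N. row_wt N i j \<ge> 0 \<and> col_wt N i j \<ge> 0) \<and>
     (\<forall>i\<in>nodes N. \<forall>j\<in>nodes N. i \<noteq> j \<and> (j, i) \<notin> edges N \<longrightarrow> row_wt N i j = 0 \<and> col_wt N i j = 0) \<and>
     (\<forall>i\<in>nodes N. (\<Sum>j\<in>nodes N. row_wt N i j) = 1) \<and>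
     (\<forall>j\<in>nodes N. (\<Sum>i\<in>nodes N. col_wt N i j) = 1)"

definition valid_asynchrony :: "async_network \<Rightarrow> bool" where
  "valid_asynchrony N \<longleftrightarrow>
     period N > 0 \<and> max_delay N > 0 \<and>
     (\<forall>k. active N k \<in> nodes N) \<and>
     (\<forall>k. (\<Union>t\<in>{k..k + period N - 1}. {active N t}) = nodes N) \<and>
     (\<forall>k. \<forall>j\<in>N_in N (active N k). delay N k j \<le> max_delay N)"

definition valid_network :: "async_network \<Rightarrow> bool" where
  "valid_network N \<longleftrightarrow>
     strongly_connected_digraph (nodes N) (edges N) \<and> valid_weights N \<and> valid_asynchrony N"

text \<open>
  \<open>tau N k i j\<close> is the time stamp after the update at iteration \<open>k\<close>; only those of the active
  agent change.  The initial stamp is \<open>-D\<close>, which does not restrict the first update.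
\<close>

definition tau_update :: "async_network \<Rightarrow> nat \<Rightarrow> (nat \<Rightarrow> nat \<Rightarrow> int) \<Rightarrow> nat \<Rightarrow> nat \<Rightarrow> int" where
  "tau_update N k \<tau> i j =
     (if i = active N k \<and> j \<in> N_in N i then max (\<tau> i j) (int k - int (delay N k j)) else \<tau> i j)"

primrec tau :: "async_network \<Rightarrow> nat \<Rightarrow> nat \<Rightarrow> nat \<Rightarrow> int" where
  "tau N 0 = tau_update N 0 (\<lambda>i j. - int (max_delay N))"
| "tau N (Suc k) = tau_update N (Suc k) (tau N k)"

section \<open>The algorithm\<close>

text \<open>
  \<open>mass T k i j\<close> and \<open>buf T k i j\<close> are the counter and the buffer for the edge from \<open>j\<close> to
  \<open>i\<close>; \<open>z_half T k\<close> is the intermediate variable of the agent active at iteration \<open>k\<close>.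
\<close>

record 'v trajectory =
  x_var :: "nat \<Rightarrow> nat \<Rightarrow> 'v"
  v_var :: "nat \<Rightarrow> nat \<Rightarrow> 'v"
  z_var :: "nat \<Rightarrow> nat \<Rightarrow> 'v"
  z_half :: "nat \<Rightarrow> 'v"
  mass :: "nat \<Rightarrow> nat \<Rightarrow> nat \<Rightarrow> 'v"
  buf :: "nat \<Rightarrow> nat \<Rightarrow> nat \<Rightarrow> 'v"

text \<open>The sample used by agent \<open>i\<close> at its last activation before iteration \<open>k\<close>.\<close>

definition last_sample :: "async_network \<Rightarrow> 'z \<Rightarrow> (nat \<Rightarrow> 'z) \<Rightarrow> nat \<Rightarrow> nat \<Rightarrow> 'z" where
  "last_sample N s_init s k i =
     (if \<exists>t<k. active N t = i then s (Max {t. t < k \<and> active N t = i}) else s_init)"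

text \<open>
  \<open>g i x \<zeta>\<close> is the sample gradient.  Time stamps \<open>\<tau>\<close> are integers; since \<open>nat\<close> maps
  negative integers to \<open>0\<close> and the variables vanish at time \<open>0\<close>, reading a variable
  at time \<open>nat \<tau>\<close> gives the value \<open>0\<close> whenever \<open>\<tau> \<le> 0\<close>.
\<close>

definition is_run ::
    "async_network \<Rightarrow> (nat \<Rightarrow> real ^ 'n \<Rightarrow> 'z \<Rightarrow> real ^ 'n) \<Rightarrow> (nat \<Rightarrow> real) \<Rightarrow>
     'z \<Rightarrow> (nat \<Rightarrow> 'z) \<Rightarrow> (real ^ 'n) trajectory \<Rightarrow> bool" where
  "is_run N g \<gamma> s_init s T \<longleftrightarrow>
     (\<forall>i\<in>nodes N. x_var T 0 i = 0 \<and> v_var T 0 i = 0 \<and> z_var T 0 i = g i 0 s_init) \<and>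
     (\<forall>(j, i)\<in>edges N. mass T 0 i j = 0 \<and> buf T 0 i j = 0) \<and>
     (\<forall>k. let i = active N k in
        v_var T (Suc k) i = x_var T k i - \<gamma> k *\<^sub>R z_var T k i \<and>
        x_var T (Suc k) i = row_wt N i i *\<^sub>R v_var T (Suc k) i
          + (\<Sum>j\<in>N_in N i. row_wt N i j *\<^sub>R v_var T (nat (tau N k i j)) j) \<and>
        z_half T k = z_var T k i
          + (\<Sum>j\<in>N_in N i. mass T (nat (tau N k i j)) i j - buf T k i j)
          + g i (x_var T (Suc k) i) (s k) - g i (x_var T k i) (last_sample N s_init s k i) \<and>
        z_var T (Suc k) i = col_wt N i i *\<^sub>R z_half T k \<and>
        (\<forall>j\<in>N_out N i. mass T (Suc k) j i = mass T k j i + col_wt N j i *\<^sub>R z_half T k) \<and>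
        (\<forall>j\<in>N_in N i. buf T (Suc k) i j = mass T (nat (tau N k i j)) i j) \<and>
        (\<forall>r\<in>nodes N - {i}. x_var T (Suc k) r = x_var T k r \<and> v_var T (Suc k) r = v_var T k r \<and> z_var T (Suc k) r = z_var T k r) \<and>
        (\<forall>(r, j)\<in>edges N. r \<noteq> i \<longrightarrow> mass T (Suc k) j r = mass T k j r) \<and>
        (\<forall>(j, r)\<in>edges N. r \<noteq> i \<longrightarrow> buf T (Suc k) r j = buf T k r j))"

section \<open>Samples and stochastic gradients\<close>

text \<open>The information available when the sample of iteration \<open>k\<close> is drawn.\<close>

definition history :: "'o measure \<Rightarrow> 'z measure \<Rightarrow> ('o \<Rightarrow> 'z) \<Rightarrow> (nat \<Rightarrow> 'o \<Rightarrow> 'z) \<Rightarrow> nat \<Rightarrow> 'o measure" where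
  "history M P \<zeta>_init \<zeta> k = sigma (space M)
     ({\<zeta>_init -` B \<inter> space M | B. B \<in> sets P} \<union> (\<Union>t<k. {\<zeta> t -` B \<inter> space M | B. B \<in> sets P}))"

definition samples_of :: "'o measure \<Rightarrow> 'z measure \<Rightarrow> ('o \<Rightarrow> 'z) \<Rightarrow> (nat \<Rightarrow> 'o \<Rightarrow> 'z) \<Rightarrow> bool" where
  "samples_of M P \<zeta>_init \<zeta> \<longleftrightarrow>
     \<zeta>_init \<in> measurable M P \<and> distr M P \<zeta>_init = P \<and>
     (\<forall>k. \<zeta> k \<in> measurable M P \<and> distr M P (\<zeta> k) = P)"

text \<open>
  The iterate at which the gradient is sampled is random, so unbiasedness is an
  identity between a conditional expectation given the history and a random vector, stated
  componentwise.  The variance identity uses the extended nonnegative integral, hence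
  includes finiteness.  The initial sample gradients are square integrable.
\<close>

definition stochastic_gradients ::
    "'o measure \<Rightarrow> 'z measure \<Rightarrow> async_network \<Rightarrow> (nat \<Rightarrow> real ^ 'n \<Rightarrow> 'z \<Rightarrow> real) \<Rightarrow>
     ('o \<Rightarrow> 'z) \<Rightarrow> (nat \<Rightarrow> 'o \<Rightarrow> 'z) \<Rightarrow> ('o \<Rightarrow> (real ^ 'n) trajectory) \<Rightarrow> real \<Rightarrow> bool" where
  "stochastic_gradients M P N f \<zeta>_init \<zeta> R \<sigma> \<longleftrightarrow>
     (\<forall>i\<in>nodes N. (\<integral>\<^sup>+\<omega>. ennreal ((norm (sample_grad f i 0 (\<zeta>_init \<omega>)))\<^sup>2) \<partial>M) < \<infinity>) \<and>
     (\<forall>k c. AE \<omega> in M.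
        real_cond_exp M (history M P \<zeta>_init \<zeta> k)
          (\<lambda>\<omega>. sample_grad f (active N k) (x_var (R \<omega>) (Suc k) (active N k)) (\<zeta> k \<omega>) $ c) \<omega>
        = true_grad P f (active N k) (x_var (R \<omega>) (Suc k) (active N k)) $ c) \<and>
     (\<forall>k. (\<integral>\<^sup>+\<omega>. ennreal ((norm
          (sample_grad f (active N k) (x_var (R \<omega>) (Suc k) (active N k)) (\<zeta> k \<omega>)
           - true_grad P f (active N k) (x_var (R \<omega>) (Suc k) (active N k))))\<^sup>2) \<partial>M) = ennreal (\<sigma>\<^sup>2))"

section \<open>Augmented systems\<close>

text \<open>\<open>mat_chain I B t l\<close> is the product \<open>B (t + l) \<cdots> B t\<close> of matrices indexed by \<open>I\<close>.\<close>

primrec mat_chain ::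
    "'i set \<Rightarrow> (nat \<Rightarrow> 'i \<Rightarrow> 'i \<Rightarrow> real) \<Rightarrow> nat \<Rightarrow> nat \<Rightarrow> 'i \<Rightarrow> 'i \<Rightarrow> real" where
  "mat_chain I B t 0 = B t"
| "mat_chain I B t (Suc l) = (\<lambda>p q. \<Sum>c\<in>I. B (t + Suc l) p c * mat_chain I B t l c q)"

definition stochastic_vector :: "'i set \<Rightarrow> ('i \<Rightarrow> real) \<Rightarrow> bool" where
  "stochastic_vector I u \<longleftrightarrow> (\<forall>p\<in>I. u p \<ge> 0) \<and> (\<Sum>p\<in>I. u p) = 1"

subsection \<open>Tracking\<close>

text \<open>\<open>Virtual j i d\<close> is the virtual node \<open>(j, i)\<^sup>d\<close> of the edge \<open>(j, i)\<close>.\<close>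

datatype aug_node = Agent nat | Virtual nat nat nat

definition aug_nodes :: "async_network \<Rightarrow> aug_node set" where
  "aug_nodes N = Agent ` nodes N \<union> {Virtual j i d | j i d. (j, i) \<in> edges N \<and> d \<le> max_delay N}"

definition absorbed :: "async_network \<Rightarrow> nat \<Rightarrow> aug_node set" where
  "absorbed N k = {Virtual j i d | j i d. i = active N k \<and> j \<in> N_in N i \<and>
                     int k - tau N k i j \<le> int d \<and> d \<le> max_delay N}"

definition sum_step :: "async_network \<Rightarrow> nat \<Rightarrow> (aug_node \<Rightarrow> real) \<Rightarrow> aug_node \<Rightarrow> real" where
  "sum_step N k u p =
     (if p = Agent (active N k) then u p + (\<Sum>q\<in>absorbed N k. u q)
      else if p \<in> absorbed N k then 0
      else u p)"

fun push_step :: "async_network \<Rightarrow> nat \<Rightarrow> (aug_node \<Rightarrow> real) \<Rightarrow> aug_node \<Rightarrow> real" where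
  "push_step N k u (Agent r) =
     (if r = active N k then col_wt N r r * u (Agent r) else u (Agent r))"
| "push_step N k u (Virtual r j d) =
     (if d = 0 then (if r = active N k then col_wt N j r * u (Agent r) else 0)
      else if d < max_delay N then u (Virtual r j (d - 1))
      else u (Virtual r j d) + u (Virtual r j (d - 1)))"

text \<open>
  The matrix of the linear map \<open>push_step \<circ> sum_step\<close>.  The new gradient information is added
  to the active agent between the two steps and only contributes to the perturbation.
\<close>

definition A_hat :: "async_network \<Rightarrow> nat \<Rightarrow> aug_node \<Rightarrow> aug_node \<Rightarrow> real" where
  "A_hat N k p q = push_step N k (sum_step N k (\<lambda>r. if r = q then 1 else 0)) p"

text \<open>\<open>\<xi>\<close> is indexed by integers because of the index \<open>-1\<close>.\<close>

definition tracking_sequence :: "async_network \<Rightarrow> real \<Rightarrow> real \<Rightarrow> (int \<Rightarrow> aug_node \<Rightarrow> real) \<Rightarrow> bool" where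
  "tracking_sequence N C\<^sub>0 \<rho> \<xi> \<longleftrightarrow>
     (\<forall>k\<ge>-1. stochastic_vector (aug_nodes N) (\<xi> k)) \<and>
     (\<forall>k t. t \<le> k \<longrightarrow> (\<forall>p\<in>aug_nodes N. \<forall>q\<in>aug_nodes N.
        \<bar>mat_chain (aug_nodes N) (A_hat N) t (k - t) p q - \<xi> (int k) p\<bar> \<le> C\<^sub>0 * \<rho> ^ (k - t)))"

subsection \<open>Consensus\<close>

definition blocks :: "async_network \<Rightarrow> nat set" where
  "blocks N = {1..(max_delay N + 2) * agents N}"

text \<open>
  Block \<open>s * m + i\<close> with \<open>1 \<le> i \<le> m\<close> is \<open>x i\<close> at time \<open>k\<close> for \<open>s = 0\<close> and \<open>v i\<close> at
  time \<open>k - (s - 1)\<close> for \<open>s \<ge> 1\<close>.  Truncated subtraction again implements \<open>v = 0\<close> at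
  times \<open>\<le> 0\<close>.
\<close>

definition h_vec :: "async_network \<Rightarrow> 'v trajectory \<Rightarrow> nat \<Rightarrow> nat \<Rightarrow> 'v" where
  "h_vec N T k r =
     (let s = (r - 1) div agents N; i = (r - 1) mod agents N + 1
      in if s = 0 then x_var T k i else v_var T (k - (s - 1)) i)"

definition W_hat :: "async_network \<Rightarrow> nat \<Rightarrow> nat \<Rightarrow> nat \<Rightarrow> real" where
  "W_hat N k r q =
     (let m = agents N; i = active N k in
      if r = i then
        (if q = i then row_wt N i i
         else \<Sum>j\<in>N_in N i. if int q = int j + (int k - tau N k i j + 1) * int m then row_wt N i j else 0)
      else if r = i + m then (if q = i then 1 else 0)
      else if r \<le> 2 * m then (if q = r then 1 else 0)
      else (if q = r - m then 1 else 0))"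

text \<open>Entrywise bound; the choice of the matrix norm is immaterial as \<open>C\<^sub>0\<close> is arbitrary.\<close>

definition consensus_sequence :: "async_network \<Rightarrow> real \<Rightarrow> real \<Rightarrow> (nat \<Rightarrow> nat \<Rightarrow> real) \<Rightarrow> bool" where
  "consensus_sequence N C\<^sub>0 \<rho> \<psi> \<longleftrightarrow>
     (\<forall>t. stochastic_vector (blocks N) (\<psi> t)) \<and>
     (\<forall>k t. t \<le> k \<longrightarrow> (\<forall>r\<in>blocks N. \<forall>q\<in>blocks N.
        \<bar>mat_chain (blocks N) (W_hat N) t (k - t) r q - \<psi> t q\<bar> \<le> C\<^sub>0 * \<rho> ^ (k - t)))"

definition x_psi :: "async_network \<Rightarrow> (nat \<Rightarrow> nat \<Rightarrow> real) \<Rightarrow> (real ^ 'n) trajectory \<Rightarrow> nat \<Rightarrow> real ^ 'n" where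
  "x_psi N \<psi> T k = (\<Sum>r\<in>blocks N. \<psi> k r *\<^sub>R h_vec N T k r)"

section \<open>Error terms and merit function\<close>

text \<open>\<open>G i\<close> is the exact gradient of the cost of agent \<open>i\<close>.\<close>

definition z_bar ::
    "async_network \<Rightarrow> (nat \<Rightarrow> real ^ 'n \<Rightarrow> real ^ 'n) \<Rightarrow> (real ^ 'n) trajectory \<Rightarrow> nat \<Rightarrow> nat \<Rightarrow> real ^ 'n" where
  "z_bar N G T k i =
     G i (x_var T 0 i) + (\<Sum>t | t < k \<and> active N t = i. G i (x_var T (Suc t) i) - G i (x_var T t i))"

definition E_t where
  "E_t N G \<xi> T k =
     (norm (z_bar N G T k (active N k)
        - \<xi> (int k - 1) (Agent (active N k)) *\<^sub>R (\<Sum>j\<in>nodes N. z_bar N G T k j)))\<^sup>2"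

text \<open>The squared norm of a stacked vector is the sum of the squared norms of its blocks.\<close>

definition E_c where
  "E_c N \<psi> T k = (\<Sum>r\<in>blocks N. (norm (h_vec N T k r - x_psi N \<psi> T k))\<^sup>2)"

definition E_z where
  "E_z N G T k = (norm (z_bar N G T k (active N k)))\<^sup>2"

definition merit ::
    "'o measure \<Rightarrow> async_network \<Rightarrow> (nat \<Rightarrow> real ^ 'n \<Rightarrow> real ^ 'n) \<Rightarrow> (int \<Rightarrow> aug_node \<Rightarrow> real) \<Rightarrow>
     (nat \<Rightarrow> nat \<Rightarrow> real) \<Rightarrow> ('o \<Rightarrow> (real ^ 'n) trajectory) \<Rightarrow> nat \<Rightarrow> real" where
  "merit M N G \<xi> \<psi> R k = (\<integral>\<omega>. E_t N G \<xi> (R \<omega>) k + E_c N \<psi> (R \<omega>) k + E_z N G (R \<omega>) k \<partial>M)"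

text \<open>
  The step-size weighted average whose decay is the ergodic rate.  The normalisation is
  essential: the unnormalised sums are nondecreasing, so a bound of order
  \<open>1 / (\<Sum>l\<le>k. \<gamma> l)\<close> on them would force every term to vanish, as shown below.
\<close>

definition ergodic_average :: "(nat \<Rightarrow> real) \<Rightarrow> (nat \<Rightarrow> real) \<Rightarrow> nat \<Rightarrow> real" where
  "ergodic_average \<gamma> u k = (\<Sum>l\<le>k. \<gamma> l * u l) / (\<Sum>l\<le>k. \<gamma> l)"

lemma unnormalised_rate_degenerate:
  assumes pos: "\<And>k. \<gamma> k > (0::real)" and div: "filterlim (\<lambda>k. \<Sum>l\<le>k. \<gamma> l) at_top sequentially"
    and nonneg: "\<And>k. u k \<ge> (0::real)"
    and rate: "\<And>k. (\<Sum>l\<le>k. \<gamma> l * u l) \<le> C / (\<Sum>l\<le>k. \<gamma> l)"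
  shows "u l = 0"
proof -
  have "(\<lambda>k. C / (\<Sum>l\<le>k. \<gamma> l)) \<longlonglongrightarrow> 0"
    by (rule tendsto_divide_0[OF tendsto_const filterlim_at_top_imp_at_infinity[OF div]])
  moreover have "\<forall>\<^sub>F k in sequentially. \<gamma> l * u l \<le> C / (\<Sum>l\<le>k. \<gamma> l)"
    unfolding eventually_sequentially
  proof (intro exI[of _ l] allI impI)
    fix k assume "l \<le> k"
    then have "\<gamma> l * u l \<le> (\<Sum>l\<le>k. \<gamma> l * u l)"
      by (intro member_le_sum) (auto intro!: mult_nonneg_nonneg less_imp_le[OF pos] nonneg)
    then show "\<gamma> l * u l \<le> C / (\<Sum>l\<le>k. \<gamma> l)" using rate[of k] by linarith
  qed
  ultimately have "\<gamma> l * u l \<le> 0"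
    using tendsto_lowerbound by fastforce
  then show ?thesis using pos[of l] nonneg[of l]
    by (metis linorder_not_le mult_pos_pos order_antisym_conv)
qed

end

theory Submission
  imports Defs
begin

text \<open>
  The rate only asks for \<open>\<Sum>k. \<gamma> k * merit k < \<infinity>\<close>.  Since \<open>\<psi> k\<close> is a left eigenvector of the consensus
  products, the weighted mean moves by \<open>- \<gamma> k * \<psi> k i *\<^sub>R z\<close>, \<open>i\<close> the active agent and \<open>z\<close> its tracking
  variable, and \<open>z\<close> splits into \<open>\<xi> i\<close> times the sum of the exact gradients, a tracking error that is a
  geometric convolution of the movements of the iterates, and a geometric convolution of past sample errors.
  A sample error is orthogonal to everything known when it is drawn, so it meets the current gradient only
  through the movement of the mean since then, which costs a further factor \<open>\<gamma>\<close>.  In the descent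
  inequality for the expected optimality gap \<open>\<Phi>\<close>, all error terms are bounded by \<open>(\<gamma> k)\<^sup>2 * \<Phi> k\<close> (smoothness
  bounds the squared gradient by \<open>\<Phi>\<close>) and by summable squares, so that a discrete Gronwall
  inequality closes the estimate because \<open>(\<gamma> k)\<^sup>2\<close> is summable.
\<close>

section \<open>Augmented network dynamics\<close>

text \<open>The error \<open>E_t\<close> is formed with \<open>z_bar\<close>, which telescopes to
  the exact gradient of an agent at its own iterate. Its assumed bound therefore says nothing about
  the direction z that the algorithm really follows, and the deviation of z from its \<xi>-share of
  the gradient sum has to be extracted from the augmented system. The sample errors contained in z
  have a second moment that does not decay, so estimating their pairing with the gradient by norms
  would cost a multiple of the divergent sum of \<gamma>; orthogonality replaces this by products
  \<open>\<gamma> k * \<gamma> s\<close> with geometric weights in k - s, which are summable. The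
  two matrix systems are used in opposite ways: the rows of the consensus products converge as the
  last factor recedes to infinity, which gives an exact invariance of \<psi>, whereas the tracking
  products only approach the moving target \<xi>, which gives a geometric estimate. The system
  identities and the convolution bounds hold on each sample path; only moments are averaged.\<close>

lemma mat_chain_Suc_right:
  assumes "finite I"
  shows "mat_chain I B t (Suc l) p q = (\<Sum>c\<in>I. mat_chain I B (Suc t) l p c * B t c q)"
proof (induction l arbitrary: p)
  case 0
  then show ?case by simp
next
  case (Suc l)
  have "mat_chain I B t (Suc (Suc l)) p q
      = (\<Sum>c\<in>I. B (t + Suc (Suc l)) p c * (\<Sum>d\<in>I. mat_chain I B (Suc t) l c d * B t d q))"
    using Suc.IH by simp
  also have "\<dots> = (\<Sum>d\<in>I. \<Sum>c\<in>I. B (t + Suc (Suc l)) p c * mat_chain I B (Suc t) l c d * B t d q)"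
    unfolding sum_distrib_left by (subst sum.swap) (simp add: mult.assoc)
  finally show ?case by (simp add: sum_distrib_right)
qed

text \<open>The product \<open>B (k - 1) \<cdots> B t\<close>, which is the identity for \<open>t = k\<close>.\<close>

definition chain_to :: "'i set \<Rightarrow> (nat \<Rightarrow> 'i \<Rightarrow> 'i \<Rightarrow> real) \<Rightarrow> nat \<Rightarrow> nat \<Rightarrow> 'i \<Rightarrow> 'i \<Rightarrow> real" where
  "chain_to I B k t p q = (if t < k then mat_chain I B t (k - 1 - t) p q else if p = q then 1 else 0)"

lemma chain_to_Suc:
  assumes "finite I" "t \<le> k" "q \<in> I"
  shows "chain_to I B (Suc k) t p q = (\<Sum>c\<in>I. B k p c * chain_to I B k t c q)"
proof (cases "t = k")
  case True
  then show ?thesis using assms by (simp add: chain_to_def if_distrib[of "\<lambda>x. _ * x"] sum.delta cong: if_cong)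
next
  case False
  with assms have "t < k" by simp
  then obtain l where "k = Suc (t + l)" using less_imp_Suc_add by blast
  then show ?thesis by (simp add: chain_to_def)
qed

text \<open>Discrete variation of constants. A perturbation enters before the matrix of its
  iteration acts, so \<open>e t\<close> is propagated exactly like an initial value planted at time
  t.\<close>

lemma perturbed_linear_recursion:
  fixes u e :: "nat \<Rightarrow> 'i \<Rightarrow> 'v::real_vector"
  assumes "finite I" and rec: "\<And>k p. p \<in> I \<Longrightarrow> u (Suc k) p = (\<Sum>q\<in>I. B k p q *\<^sub>R (u k q + e k q))"
    and "p \<in> I"
  shows "u k p = (\<Sum>q\<in>I. chain_to I B k 0 p q *\<^sub>R u 0 q)
               + (\<Sum>t<k. \<Sum>q\<in>I. chain_to I B k t p q *\<^sub>R e t q)"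
  using \<open>p \<in> I\<close>
proof (induction k arbitrary: p)
  case 0
  then show ?case using assms(1)
    by (simp add: chain_to_def if_distrib[of "\<lambda>x. x *\<^sub>R _"] sum.delta cong: if_cong)
next
  case (Suc k)
  have aux: "(\<Sum>c\<in>I. B k p c *\<^sub>R (\<Sum>q\<in>I. chain_to I B k t c q *\<^sub>R w q))
      = (\<Sum>q\<in>I. chain_to I B (Suc k) t p q *\<^sub>R w q)" if "t \<le> k" for t and w :: "'i \<Rightarrow> 'v"
    unfolding scaleR_right.sum
    by (subst sum.swap) (simp add: chain_to_Suc[OF assms(1) that] scaleR_sum_left)
  have "u (Suc k) p = (\<Sum>c\<in>I. B k p c *\<^sub>R (\<Sum>q\<in>I. chain_to I B k 0 c q *\<^sub>R u 0 q))
      + (\<Sum>c\<in>I. B k p c *\<^sub>R (\<Sum>t<k. \<Sum>q\<in>I. chain_to I B k t c q *\<^sub>R e t q)) + (\<Sum>c\<in>I. B k p c *\<^sub>R e k c)"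
    unfolding rec[OF Suc.prems] using Suc.IH by (simp add: scaleR_add_right sum.distrib)
  also have "(\<Sum>c\<in>I. B k p c *\<^sub>R (\<Sum>t<k. \<Sum>q\<in>I. chain_to I B k t c q *\<^sub>R e t q))
      = (\<Sum>t<k. \<Sum>c\<in>I. B k p c *\<^sub>R (\<Sum>q\<in>I. chain_to I B k t c q *\<^sub>R e t q))"
    by (subst sum.swap) (simp add: scaleR_right.sum)
  also have "\<dots> = (\<Sum>t<k. \<Sum>q\<in>I. chain_to I B (Suc k) t p q *\<^sub>R e t q)"
    using aux by simp
  also have "(\<Sum>c\<in>I. B k p c *\<^sub>R e k c) = (\<Sum>q\<in>I. chain_to I B (Suc k) k p q *\<^sub>R e k q)"
    by (simp add: chain_to_def)
  also have "(\<Sum>c\<in>I. B k p c *\<^sub>R (\<Sum>q\<in>I. chain_to I B k 0 c q *\<^sub>R u 0 q))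
     = (\<Sum>q\<in>I. chain_to I B (Suc k) 0 p q *\<^sub>R u 0 q)" using aux[of 0] by simp
  finally show ?case by (simp add: add.assoc)
qed

section \<open>Consequences of the network, weight and delay assumptions\<close>

locale network =
  fixes N :: async_network
  assumes valid: "valid_network N"
begin

abbreviation "m \<equiv> agents N"
abbreviation "D \<equiv> max_delay N"
abbreviation "act \<equiv> active N"

lemma active_node: "act k \<in> nodes N"
  using valid by (auto simp: valid_network_def valid_asynchrony_def)

lemma m_pos: "m > 0"
  using active_node[of 0] by (auto simp: nodes_def)

lemma D_pos: "D > 0"
  using valid by (auto simp: valid_network_def valid_asynchrony_def)

lemma edges_subset: "edges N \<subseteq> nodes N \<times> nodes N"
  using valid by (auto simp: valid_network_def strongly_connected_digraph_def)

lemma edge_neq: "(i, j) \<in> edges N \<Longrightarrow> i \<noteq> j"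
  using valid by (auto simp: valid_network_def strongly_connected_digraph_def irrefl_def)

lemma finite_nodes [simp]: "finite (nodes N)"
  by (simp add: nodes_def)

lemma finite_edges [simp]: "finite (edges N)"
  by (rule finite_subset[OF edges_subset]) simp

lemma N_in_subset: "N_in N i \<subseteq> nodes N"
  using edges_subset by (auto simp: N_in_def)

lemma finite_N_in [simp]: "finite (N_in N i)"
  by (rule finite_subset[OF N_in_subset]) simp

lemma finite_aug_nodes [simp]: "finite (aug_nodes N)"
proof -
  have "{Virtual j i d | j i d. (j, i) \<in> edges N \<and> d \<le> D}
      = (\<lambda>((j, i), d). Virtual j i d) ` (edges N \<times> {..D})" by force
  then show ?thesis by (simp add: aug_nodes_def)
qed

lemma active_in_window:
  assumes "i \<in> nodes N"
  shows "\<exists>t\<ge>k. t < k + period N \<and> act t = i"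
proof -
  have "i \<in> (\<Union>t\<in>{k..k + period N - 1}. {act t})" and "period N > 0"
    using valid assms by (auto simp: valid_network_def valid_asynchrony_def)
  then show ?thesis by force
qed

lemma row_wt_nonneg: "i \<in> nodes N \<Longrightarrow> j \<in> nodes N \<Longrightarrow> row_wt N i j \<ge> 0"
  using valid by (auto simp: valid_network_def valid_weights_def)

lemma row_wt_sum:
  assumes "i \<in> nodes N"
  shows "row_wt N i i + (\<Sum>j\<in>N_in N i. row_wt N i j) = 1"
proof -
  have i: "i \<notin> N_in N i" using edge_neq by (auto simp: N_in_def)
  have "(\<Sum>j\<in>nodes N. row_wt N i j) = (\<Sum>j\<in>insert i (N_in N i). row_wt N i j)"
  proof (rule sum.mono_neutral_right)
    show "insert i (N_in N i) \<subseteq> nodes N" using assms N_in_subset by auto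
    show "\<forall>j\<in>nodes N - insert i (N_in N i). row_wt N i j = 0"
      using valid assms by (auto simp: valid_network_def valid_weights_def N_in_def)
  qed simp
  moreover have "(\<Sum>j\<in>nodes N. row_wt N i j) = 1"
    using valid assms by (auto simp: valid_network_def valid_weights_def)
  ultimately show ?thesis using i by simp
qed

subsection \<open>Time stamps\<close>

text \<open>State k of the augmented system refers to the time stamps held before the update of
  iteration k, whereas \<open>tau N k\<close> is the updated stamp. The value -D before the first
  iteration is the one from which \<open>tau\<close> starts.\<close>

definition tau_prev :: "nat \<Rightarrow> nat \<Rightarrow> nat \<Rightarrow> int" where
  "tau_prev k = (if k = 0 then (\<lambda>i j. - int D) else tau N (k - 1))"

lemma tau_eq: "tau N k = tau_update N k (tau_prev k)"
  by (cases k) (auto simp: tau_prev_def)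

lemma tau_prev_0 [simp]: "tau_prev 0 i j = - int D" and tau_prev_Suc [simp]: "tau_prev (Suc k) = tau N k"
  by (auto simp: tau_prev_def)

lemma tau_le: "tau N k i j \<le> int k"
proof (induction k)
  case (Suc k)
  then show ?case by (auto simp: tau_update_def)
qed (auto simp: tau_update_def)

lemma tau_prev_le_tau: "tau_prev k i j \<le> tau N k i j"
  by (simp add: tau_eq tau_update_def)

text \<open>Claimed at the active agent only: a stamp advances when its agent acts, so that of an
  idle agent may become older than \<open>D\<close>. This is why the oldest virtual cell lumps all
  larger ages.\<close>

lemma tau_ge:
  assumes "j \<in> N_in N (act k)"
  shows "tau N k (act k) j \<ge> int k - int D"
proof -
  have "delay N k j \<le> D" using valid assms by (auto simp: valid_network_def valid_asynchrony_def)
  then show ?thesis using assms by (simp add: tau_eq tau_update_def)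
qed

lemma tau_inactive: "i \<noteq> act k \<Longrightarrow> tau N k i j = tau_prev k i j"
  by (simp add: tau_eq tau_update_def)

lemma absorbed_subset: "absorbed N k \<subseteq> aug_nodes N"
  by (auto simp: absorbed_def aug_nodes_def N_in_def)

text \<open>\<open>A_hat\<close> is defined through images of unit vectors. That these columns
  determine the map is its linearity, established for the sum step here and for the composition with
  the push step below.\<close>

lemma sum_step_matrix:
  assumes "p \<in> aug_nodes N"
  shows "sum_step N k u p = (\<Sum>q\<in>aug_nodes N. sum_step N k (\<lambda>r. if r = q then 1 else 0) p * u q)"
proof -
  have delta: "(\<Sum>q\<in>aug_nodes N. (if r = q then 1 else 0) * u q) = u r" if "r \<in> aug_nodes N" for r
    using that by (simp add: if_distrib[of "\<lambda>x. x * _"] cong: if_cong)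
  show ?thesis
  proof (cases "p = Agent (act k)")
    case True
    have "(\<Sum>q\<in>aug_nodes N. (\<Sum>r\<in>absorbed N k. if r = q then 1 else 0) * u q)
       = (\<Sum>r\<in>absorbed N k. \<Sum>q\<in>aug_nodes N. (if r = q then 1 else 0) * u q)"
      unfolding sum_distrib_right by (rule sum.swap)
    also have "\<dots> = (\<Sum>r\<in>absorbed N k. u r)" using absorbed_subset delta by (intro sum.cong) auto
    finally have "(\<Sum>q\<in>aug_nodes N. (\<Sum>r\<in>absorbed N k. if r = q then 1 else 0) * u q) = (\<Sum>r\<in>absorbed N k. u r)" .
    then show ?thesis unfolding sum_step_def using True delta[OF assms]
      by (simp only: refl if_True distrib_right sum.distrib)
  next
    case False
    show ?thesis
    proof (cases "p \<in> absorbed N k")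
      case True
      with False show ?thesis by (simp add: sum_step_def)
    next
      case out: False
      show ?thesis unfolding sum_step_def using False out delta[OF assms] by (simp only: if_False)
    qed
  qed
qed

lemma push_sum_step_matrix:
  assumes "p \<in> aug_nodes N"
  shows "push_step N k (sum_step N k u) p = (\<Sum>q\<in>aug_nodes N. A_hat N k p q * u q)"
proof (cases p)
  case (Agent r)
  have "push_step N k (sum_step N k u) (Agent r)
      = (if r = act k then col_wt N r r else 1) * sum_step N k u (Agent r)" by simp
  also have "\<dots> = (\<Sum>q\<in>aug_nodes N. (if r = act k then col_wt N r r else 1)
      * sum_step N k (\<lambda>r. if r = q then 1 else 0) (Agent r) * u q)"
    by (subst sum_step_matrix) (use assms Agent in \<open>simp_all add: sum_distrib_left mult.assoc\<close>)
  finally show ?thesis unfolding A_hat_def Agent by (auto intro!: sum.cong)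
next
  case (Virtual r j d)
  with assms have rj: "(r, j) \<in> edges N" "d \<le> D" by (auto simp: aug_nodes_def)
  then have nodes: "Agent r \<in> aug_nodes N" "Virtual r j (d - 1) \<in> aug_nodes N" "Virtual r j d \<in> aug_nodes N"
    using edges_subset by (auto simp: aug_nodes_def)
  \<comment> \<open>The new entry is a combination of at most three old ones (sender, preceding age,
    same age) with coefficients that do not depend on the vector, so linearity needs no further case
    distinction on d. For d = 0 the truncated d - 1 is harmless, its coefficient being 0.\<close>
  obtain a b c :: real where push: "\<And>w. push_step N k w (Virtual r j d)
      = a * w (Agent r) + b * w (Virtual r j (d - 1)) + c * w (Virtual r j d)"
  proof
    show "push_step N k w (Virtual r j d) = (if d = 0 \<and> r = act k then col_wt N j r else 0) * w (Agent r)
      + (if d = 0 then 0 else 1) * w (Virtual r j (d - 1))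
      + (if d = 0 \<or> d < D then 0 else 1) * w (Virtual r j d)" for w
      by simp
  qed
  note eqs = sum_step_matrix[OF nodes(1), of k u] sum_step_matrix[OF nodes(2), of k u] sum_step_matrix[OF nodes(3), of k u]
  have "push_step N k (sum_step N k u) (Virtual r j d)
     = (\<Sum>q\<in>aug_nodes N. a * (sum_step N k (\<lambda>r. if r = q then 1 else 0) (Agent r) * u q))
     + (\<Sum>q\<in>aug_nodes N. b * (sum_step N k (\<lambda>r. if r = q then 1 else 0) (Virtual r j (d - 1)) * u q))
     + (\<Sum>q\<in>aug_nodes N. c * (sum_step N k (\<lambda>r. if r = q then 1 else 0) (Virtual r j d) * u q))"
    by (subst push, subst eqs(1), subst eqs(2), subst eqs(3)) (simp only: sum_distrib_left)
  also have "\<dots> = (\<Sum>q\<in>aug_nodes N. A_hat N k (Virtual r j d) q * u q)"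
    unfolding sum.distrib[symmetric] A_hat_def push
    by (intro sum.cong refl) (simp only: distrib_right mult.assoc)
  finally show ?thesis by (simp only: Virtual)
qed

end

text \<open>A single sample path: everything in this locale is deterministic and is later
  instantiated at each outcome.\<close>

locale async_run = network N for N :: async_network +
  fixes g :: "nat \<Rightarrow> real ^ 'n \<Rightarrow> 'z \<Rightarrow> real ^ 'n" and \<gamma> :: "nat \<Rightarrow> real"
    and s_init :: 'z and s :: "nat \<Rightarrow> 'z" and T :: "(real ^ 'n) trajectory"
  assumes run: "is_run N g \<gamma> s_init s T"
begin

lemma init:
  "i \<in> nodes N \<Longrightarrow> x_var T 0 i = 0" "i \<in> nodes N \<Longrightarrow> v_var T 0 i = 0" "i \<in> nodes N \<Longrightarrow> z_var T 0 i = g i 0 s_init"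
  "(j, i) \<in> edges N \<Longrightarrow> mass T 0 i j = 0" "(j, i) \<in> edges N \<Longrightarrow> buf T 0 i j = 0"
  using run unfolding is_run_def by blast+

lemmas run_step = run[unfolded is_run_def Let_def, THEN conjunct2, THEN conjunct2, rule_format]

lemma step:
  "v_var T (Suc k) (act k) = x_var T k (act k) - \<gamma> k *\<^sub>R z_var T k (act k)"
  "x_var T (Suc k) (act k) = row_wt N (act k) (act k) *\<^sub>R v_var T (Suc k) (act k)
          + (\<Sum>j\<in>N_in N (act k). row_wt N (act k) j *\<^sub>R v_var T (nat (tau N k (act k) j)) j)"
  "z_half T k = z_var T k (act k)
          + (\<Sum>j\<in>N_in N (act k). mass T (nat (tau N k (act k) j)) (act k) j - buf T k (act k) j)
          + g (act k) (x_var T (Suc k) (act k)) (s k) - g (act k) (x_var T k (act k)) (last_sample N s_init s k (act k))"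
  "z_var T (Suc k) (act k) = col_wt N (act k) (act k) *\<^sub>R z_half T k"
  "\<And>j. j \<in> N_out N (act k) \<Longrightarrow> mass T (Suc k) j (act k) = mass T k j (act k) + col_wt N j (act k) *\<^sub>R z_half T k"
  "\<And>j. j \<in> N_in N (act k) \<Longrightarrow> buf T (Suc k) (act k) j = mass T (nat (tau N k (act k) j)) (act k) j"
  using run_step[of k] by blast+

lemma step_inactive:
  "r \<noteq> act k \<Longrightarrow> r \<in> nodes N \<Longrightarrow> x_var T (Suc k) r = x_var T k r"
  "r \<noteq> act k \<Longrightarrow> r \<in> nodes N \<Longrightarrow> v_var T (Suc k) r = v_var T k r"
  "r \<noteq> act k \<Longrightarrow> r \<in> nodes N \<Longrightarrow> z_var T (Suc k) r = z_var T k r"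
  "r \<noteq> act k \<Longrightarrow> (r, j) \<in> edges N \<Longrightarrow> mass T (Suc k) j r = mass T k j r"
  "r \<noteq> act k \<Longrightarrow> (j, r) \<in> edges N \<Longrightarrow> buf T (Suc k) r j = buf T k r j"
  using run_step[of k] by blast+

subsection \<open>Tracking\<close>

text \<open>The gradient most recently sampled by each agent. Carrying it as a state turns the
  correction in the tracking update into an increment between consecutive times.\<close>

primrec last_grad :: "nat \<Rightarrow> nat \<Rightarrow> real ^ 'n" where
  "last_grad 0 = (\<lambda>j. g j 0 s_init)"
| "last_grad (Suc k) = (\<lambda>j. if j = act k then g j (x_var T (Suc k) j) (s k) else last_grad k j)"

text \<open>Between two activations neither the iterate of an agent nor its latest sample changes.
  The gradient subtracted in the update, formally evaluated at the current iterate, is thus the one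
  stored at the last activation.\<close>

lemma last_grad_eq:
  assumes "i \<in> nodes N"
  shows "last_grad k i = g i (x_var T k i) (last_sample N s_init s k i)"
proof (induction k)
  case 0
  then show ?case using init(1)[OF assms] by (simp add: last_sample_def)
next
  case (Suc k)
  show ?case
  proof (cases "i = act k")
    case True
    have "Max {t. t < Suc k \<and> act t = i} = k"
      by (rule Max_eqI) (use True in auto)
    moreover have "\<exists>t<Suc k. act t = i" using True by auto
    ultimately show ?thesis using True by (simp add: last_sample_def)
  next
    case False
    have "(t < Suc k \<and> act t = i) = (t < k \<and> act t = i)" for t
      using False by (auto simp: less_Suc_eq)
    then have "last_sample N s_init s (Suc k) i = last_sample N s_init s k i"
      unfolding last_sample_def by (simp only:)
    then show ?thesis using False Suc.IH step_inactive(1)[of i k] assms by simp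
  qed
qed

lemma z_half_eq:
  "z_half T k = z_var T k (act k)
          + (\<Sum>j\<in>N_in N (act k). mass T (nat (tau N k (act k) j)) (act k) j - buf T k (act k) j)
          + (last_grad (Suc k) (act k) - last_grad k (act k))"
  unfolding step(3)[of k] last_grad_eq[OF active_node, of k k] by simp

text \<open>The buffer remembers the counter value read at the last activation, hence the value at
  the stamp used then. Initially the stamp -D is sent to 0 by \<open>nat\<close>, and both sides
  vanish.\<close>

lemma buf_eq:
  assumes "(j, i) \<in> edges N"
  shows "buf T k i j = mass T (nat (tau_prev k i j)) i j"
proof (induction k)
  case 0
  then show ?case using init(4,5)[OF assms] by simp
next
  case (Suc k)
  show ?case
  proof (cases "i = act k")
    case True
    then show ?thesis using step(6)[of j k] assms by (simp add: N_in_def)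
  next
    case False
    then show ?thesis using step_inactive(5)[of i k j] assms Suc.IH by (simp add: tau_inactive)
  qed
qed

text \<open>
  For \<open>\<tau>\<close> the time stamp of the last message from \<open>j\<close> used by \<open>i\<close>, the virtual nodes of the edge
  \<open>(j, i)\<close> hold the increments of the mass counter after time \<open>\<tau>\<close>, sorted by age \<open>d\<close>; the
  increments of age at least \<open>D\<close> are lumped together.
\<close>

definition pending :: "nat \<Rightarrow> int \<Rightarrow> nat \<Rightarrow> nat \<Rightarrow> nat \<Rightarrow> real ^ 'n" where
  "pending k \<tau> j i d = mass T (nat (max (int k - int d) \<tau>)) i j
     - (if d < D then mass T (nat (max (int k - int d - 1) \<tau>)) i j else mass T (nat \<tau>) i j)"

primrec aug :: "nat \<Rightarrow> aug_node \<Rightarrow> real ^ 'n" where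
  "aug k (Agent i) = z_var T k i"
| "aug k (Virtual j i d) = pending k (tau_prev k i j) j i d"

text \<open>Telescoping over ages. The cell of age \<open>D\<close> reaches down to the stamp
  itself, which closes the sum; the induction therefore runs downwards from
  \<open>D\<close>.\<close>

lemma sum_pending:
  assumes "d0 \<le> D"
  shows "(\<Sum>d=d0..D. pending k \<tau> j i d) = mass T (nat (max (int k - int d0) \<tau>)) i j - mass T (nat \<tau>) i j"
  using assms
proof (induction rule: inc_induct)
  case base
  then show ?case by (simp add: pending_def)
next
  case (step n)
  have eq: "int k - int (Suc n) = int k - int n - 1" by simp
  have "(\<Sum>d=n..D. pending k \<tau> j i d) = pending k \<tau> j i n + (\<Sum>d=Suc n..D. pending k \<tau> j i d)"
    by (rule sum.atLeast_Suc_atMost) (use step in simp)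
  then show ?case unfolding step.IH eq using step.hyps by (simp add: pending_def)
qed

text \<open>Absorption starts at age k - tau, which \<open>tau_ge\<close> keeps within 0..D.
  Telescoping leaves the counter at the new stamp minus the counter at the old stamp, and the latter
  is the buffer.\<close>

lemma sum_absorbed:
  "(\<Sum>q\<in>absorbed N k. aug k q)
     = (\<Sum>j\<in>N_in N (act k). mass T (nat (tau N k (act k) j)) (act k) j - buf T k (act k) j)"
proof -
  let ?i = "act k"
  have eq: "absorbed N k = (\<lambda>(j, d). Virtual j ?i d) ` (SIGMA j:N_in N ?i. {nat (int k - tau N k ?i j)..D})"
    unfolding absorbed_def by (auto simp: image_iff)
  have "(\<Sum>q\<in>absorbed N k. aug k q)
      = (\<Sum>(j, d)\<in>(SIGMA j:N_in N ?i. {nat (int k - tau N k ?i j)..D}). aug k (Virtual j ?i d))"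
    unfolding eq by (subst sum.reindex) (auto simp: inj_on_def case_prod_unfold)
  also have "\<dots> = (\<Sum>j\<in>N_in N ?i. \<Sum>d=nat (int k - tau N k ?i j)..D. aug k (Virtual j ?i d))"
    by (subst sum.Sigma) auto
  also have "\<dots> = (\<Sum>j\<in>N_in N ?i. mass T (nat (tau N k ?i j)) ?i j - buf T k ?i j)"
  proof (rule sum.cong)
    fix j assume j: "j \<in> N_in N ?i"
    have "nat (int k - tau N k ?i j) \<le> D" using tau_ge[OF j] by simp
    moreover have "int k - int (nat (int k - tau N k ?i j)) = tau N k ?i j"
      using tau_le[of k ?i j] by simp
    moreover have "max (tau N k ?i j) (tau_prev k ?i j) = tau N k ?i j"
      using tau_prev_le_tau[of k ?i j] by simp
    ultimately show "(\<Sum>d=nat (int k - tau N k ?i j)..D. aug k (Virtual j ?i d))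
        = mass T (nat (tau N k ?i j)) ?i j - buf T k ?i j"
      using j by (simp add: sum_pending buf_eq N_in_def)
  qed simp
  finally show ?thesis .
qed

text \<open>Emptying the absorbed cells amounts to exchanging the old stamp for the new one. At ages
  from k - tau on, both maxima become the new stamp and the difference vanishes; at smaller ages
  neither stamp is reached by the maxima.\<close>

lemma pending_after_sum_step:
  assumes "(j, i) \<in> edges N" "d \<le> D"
  shows "(if Virtual j i d \<in> absorbed N k then 0 else pending k (tau_prev k i j) j i d)
       = pending k (tau N k i j) j i d"
proof (cases "i = act k")
  case True
  with assms have j: "j \<in> N_in N (act k)" by (simp add: N_in_def)
  show ?thesis
  proof (cases "int k - tau N k i j \<le> int d")
    case le: True
    then have "Virtual j i d \<in> absorbed N k" using True j assms by (auto simp: absorbed_def)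
    with le show ?thesis by (simp add: pending_def max_def)
  next
    case False
    then have "Virtual j i d \<notin> absorbed N k" by (auto simp: absorbed_def)
    moreover have "d < D" using False tau_ge[OF j] True by simp
    moreover have "max (int k - int d) \<tau> = int k - int d" "max (int k - int d - 1) \<tau> = int k - int d - 1"
      if "\<tau> \<le> tau N k i j" for \<tau>
      using False that by auto
    ultimately show ?thesis using tau_prev_le_tau[of k i j] by (simp add: pending_def)
  qed
next
  case False
  then show ?thesis by (auto simp: absorbed_def tau_inactive)
qed

text \<open>The algorithm adds the gradient increment between the sum and the push step, here it is
  added before both. This is the same, because the sum step keeps the own entry of the active agent
  with coefficient one and sends it nowhere else.\<close>

lemma aug_Suc:
  assumes "p \<in> aug_nodes N"
  shows "aug (Suc k) p = (\<Sum>q\<in>aug_nodes N. A_hat N k p q *\<^sub>R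
     (aug k q + (if q = Agent (act k) then last_grad (Suc k) (act k) - last_grad k (act k) else 0)))"
proof (rule vec_eq_iff[THEN iffD2, rule_format])
  fix c
  \<comment> \<open>The two steps act on real vectors, so the identity between blocks is checked in
    each coordinate \<open>c\<close>.\<close>
  define u where "u = (\<lambda>q. (aug k q
    + (if q = Agent (act k) then last_grad (Suc k) (act k) - last_grad k (act k) else 0)) $ c)"
  have u_virtual: "u q = aug k q $ c" if "q \<in> absorbed N k" for q
    using that by (auto simp: u_def absorbed_def)
  have active: "sum_step N k u (Agent (act k)) = z_half T k $ c"
  proof -
    have "(\<Sum>q\<in>absorbed N k. u q) = (\<Sum>q\<in>absorbed N k. aug k q) $ c"
      using u_virtual by simp
    then show ?thesis
      unfolding sum_step_def z_half_eq sum_absorbed[symmetric] by (simp add: u_def del: last_grad.simps)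
  qed
  have inactive: "sum_step N k u (Agent r) = z_var T k r $ c" if "r \<noteq> act k" for r
    using that by (auto simp: sum_step_def absorbed_def u_def)
  have virtual: "sum_step N k u (Virtual j i d) = pending k (tau N k i j) j i d $ c"
    if "(j, i) \<in> edges N" "d \<le> D" for j i d
    unfolding pending_after_sum_step[OF that, of k, symmetric] by (simp add: sum_step_def u_def)
  have "aug (Suc k) p $ c = push_step N k (sum_step N k u) p"
  proof (cases p)
    case (Agent r)
    with assms have r: "r \<in> nodes N" by (auto simp: aug_nodes_def)
    show ?thesis
    proof (cases "r = act k")
      case True
      then show ?thesis using Agent active step(4)[of k] by simp
    next
      case False
      then show ?thesis using Agent inactive step_inactive(3)[of r k] r by simp
    qed
  next
    case (Virtual j i d)
    with assms have e: "(j, i) \<in> edges N" "d \<le> D" by (auto simp: aug_nodes_def)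
    have tau: "tau N k i j \<le> int k" by (rule tau_le)
    consider "d = 0" | "0 < d" "d < D" | "d = D" "d > 0" using e D_pos by linarith
    then show ?thesis
    proof cases
      case 1
      \<comment> \<open>The stamp is at most k, so the maxima in the youngest cell are k + 1 and k:
        it holds just the increment pushed in this iteration, which is nonzero only if the sender is
        active.\<close>
      have n: "nat (1 + int k) = Suc k" by simp
      have "aug (Suc k) p = mass T (Suc k) i j - mass T k i j"
        using Virtual 1 D_pos tau by (simp add: pending_def max_def n)
      also have "\<dots> = (if j = act k then col_wt N i j *\<^sub>R z_half T k else 0)"
        using step(5)[of i k] step_inactive(4)[of j k i] e by (auto simp: N_out_def)
      finally show ?thesis using Virtual 1 active by simp
    next
      case 2
      have shift: "int (Suc k) - int d = int k - int (d - 1)" using 2 by simp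
      show ?thesis using Virtual 2 virtual[of j i "d - 1"] e
        by (simp add: pending_def shift del: of_nat_Suc of_nat_diff)
    next
      case 3
      \<comment> \<open>The lower end of the cell of age D - 1 is the upper end of the cell of age
        D, so adding the two contents telescopes to the lumped cell at time k + 1.\<close>
      have shift: "max (int (Suc k) - int D) \<tau> = max (int k - int (D - Suc 0)) \<tau>"
        "max (int k - int (D - Suc 0) - 1) \<tau> = max (int k - int D) \<tau>" for \<tau>
        using 3 by (auto simp: of_nat_diff)
      show ?thesis using Virtual 3 virtual[of j i "D - Suc 0"] virtual[of j i D] e
        by (simp add: pending_def shift del: of_nat_Suc of_nat_diff)
    qed
  qed
  also have "\<dots> = (\<Sum>q\<in>aug_nodes N. A_hat N k p q * u q)" by (rule push_sum_step_matrix[OF assms])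
  finally show "aug (Suc k) p $ c = (\<Sum>q\<in>aug_nodes N. A_hat N k p q *\<^sub>R
     (aug k q + (if q = Agent (act k) then last_grad (Suc k) (act k) - last_grad k (act k) else 0))) $ c"
    by (simp add: u_def del: last_grad.simps)
qed

text \<open>Virtual cells start empty because the counters do, and perturbations enter only at
  active agents; hence only agent columns of the propagation matrices survive.\<close>

lemma z_var_eq:
  assumes "i \<in> nodes N"
  shows "z_var T k i
     = (\<Sum>q\<in>nodes N. chain_to (aug_nodes N) (A_hat N) k 0 (Agent i) (Agent q) *\<^sub>R last_grad 0 q)
     + (\<Sum>t<k. chain_to (aug_nodes N) (A_hat N) k t (Agent i) (Agent (act t))
          *\<^sub>R (last_grad (Suc t) (act t) - last_grad t (act t)))"
proof -
  let ?c = "chain_to (aug_nodes N) (A_hat N)"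
  let ?e = "\<lambda>t q. if q = Agent (act t) then last_grad (Suc t) (act t) - last_grad t (act t) else 0"
  have agents: "Agent j \<in> aug_nodes N" if "j \<in> nodes N" for j
    using that by (simp add: aug_nodes_def)
  have "aug k (Agent i) = (\<Sum>q\<in>aug_nodes N. ?c k 0 (Agent i) q *\<^sub>R aug 0 q)
      + (\<Sum>t<k. \<Sum>q\<in>aug_nodes N. ?c k t (Agent i) q *\<^sub>R ?e t q)"
    by (rule perturbed_linear_recursion) (use aug_Suc agents assms in auto)
  also have "(\<Sum>q\<in>aug_nodes N. ?c k 0 (Agent i) q *\<^sub>R aug 0 q)
      = (\<Sum>q\<in>Agent ` nodes N. ?c k 0 (Agent i) q *\<^sub>R aug 0 q)"
  proof (rule sum.mono_neutral_right)
    have "aug 0 (Virtual j r d) = 0" if "(j, r) \<in> edges N" for j r d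
      using init(4)[OF that] by (simp add: pending_def max_def)
    then show "\<forall>q\<in>aug_nodes N - Agent ` nodes N. ?c k 0 (Agent i) q *\<^sub>R aug 0 q = 0"
      by (auto simp: aug_nodes_def)
  qed (use agents in auto)
  also have "\<dots> = (\<Sum>q\<in>nodes N. ?c k 0 (Agent i) (Agent q) *\<^sub>R last_grad 0 q)"
    by (subst sum.reindex) (auto simp: inj_on_def init(3))
  also have "(\<Sum>t<k. \<Sum>q\<in>aug_nodes N. ?c k t (Agent i) q *\<^sub>R ?e t q)
     = (\<Sum>t<k. ?c k t (Agent i) (Agent (act t)) *\<^sub>R (last_grad (Suc t) (act t) - last_grad t (act t)))"
  proof (rule sum.cong[OF refl])
    fix t
    show "(\<Sum>q\<in>aug_nodes N. ?c k t (Agent i) q *\<^sub>R ?e t q)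
      = ?c k t (Agent i) (Agent (act t)) *\<^sub>R (last_grad (Suc t) (act t) - last_grad t (act t))"
      using agents[OF active_node, of t]
      by (simp add: if_distrib[of "\<lambda>x. _ *\<^sub>R x"] sum.delta cong: if_cong)
  qed
  finally show ?thesis by simp
qed

subsection \<open>Consensus\<close>

lemma h_vec_block:
  assumes "i \<in> nodes N"
  shows "h_vec N T k (b * m + i) = (if b = 0 then x_var T k i else v_var T (k - (b - 1)) i)"
proof -
  obtain i' where i: "i = Suc i'" "i' < m" using assms by (cases i) (auto simp: nodes_def)
  then show ?thesis by (simp add: h_vec_def)
qed

lemma h_vec_agent: "i \<in> nodes N \<Longrightarrow> h_vec N T k i = x_var T k i"
  and h_vec_v: "i \<in> nodes N \<Longrightarrow> h_vec N T k (i + m) = v_var T k i"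
  using h_vec_block[of i k 0] h_vec_block[of i k 1] by (simp_all add: add.commute)

end

context network begin

lemma blocks_cases:
  assumes "r \<in> blocks N"
  obtains b i where "r = b * m + i" "i \<in> nodes N" "b < D + 2"
proof
  have r: "1 \<le> r" "r \<le> (D + 2) * m" using assms by (auto simp: blocks_def)
  show "r = (r - 1) div m * m + ((r - 1) mod m + 1)"
    using r(1) div_mult_mod_eq[of "r - 1" m] by linarith
  have "(r - 1) mod m < m" using m_pos by simp
  then show "(r - 1) mod m + 1 \<in> nodes N" by (simp add: nodes_def)
  show "(r - 1) div m < D + 2" using r by (intro less_mult_imp_div_less) linarith
qed

lemma block_mem:
  assumes "i \<in> nodes N" "b < D + 2"
  shows "b * m + i \<in> blocks N"
proof -
  have "b * m + i \<le> b * m + m" using assms by (simp add: nodes_def)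
  also have "\<dots> = (b + 1) * m" by simp
  also have "\<dots> \<le> (D + 2) * m" using assms by (intro mult_le_mono1) simp
  finally show ?thesis using assms by (simp add: blocks_def nodes_def)
qed

lemma node_in_blocks: "i \<in> nodes N \<Longrightarrow> i \<in> blocks N"
  using block_mem[of i 0] by simp

lemma finite_blocks [simp]: "finite (blocks N)"
  by (simp add: blocks_def)

end

context async_run begin

text \<open>Adding the perturbation to block \<open>act k\<close> turns x into the new v of that
  agent. One application of \<open>W_hat\<close> then mixes this v with the delayed ones, records it
  as the current v, and moves every older v by one block.\<close>

lemma h_vec_Suc:
  assumes "r \<in> blocks N"
  shows "h_vec N T (Suc k) r = (\<Sum>q\<in>blocks N. W_hat N k r q *\<^sub>R
    (h_vec N T k q + (if q = act k then - \<gamma> k *\<^sub>R z_var T k (act k) else 0)))"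
proof -
  let ?i = "act k"
  let ?u = "\<lambda>q. h_vec N T k q + (if q = ?i then - \<gamma> k *\<^sub>R z_var T k ?i else 0)"
  have i: "?i \<in> nodes N" "?i \<in> blocks N" by (simp_all add: active_node node_in_blocks)
  have pick: "(\<Sum>q\<in>blocks N. (if q = r' then c else 0) *\<^sub>R ?u q) = c *\<^sub>R ?u r'"
    if "r' \<in> blocks N" for r' and c :: real
    using that by (simp add: if_distrib[of "\<lambda>x. x *\<^sub>R _"] sum.delta cong: if_cong)
  have u_i: "?u ?i = v_var T (Suc k) ?i" using i by (simp add: h_vec_agent step(1))
  obtain b j where r: "r = b * m + j" and j: "j \<in> nodes N" and b: "b < D + 2"
    using blocks_cases[OF assms] .
  have jm: "1 \<le> j" "j \<le> m" and im: "1 \<le> ?i" "?i \<le> m" using j i by (auto simp: nodes_def)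
  consider "r = ?i" | "r = ?i + m" | "r \<noteq> ?i" "r \<noteq> ?i + m" "b = 0" | "r \<noteq> ?i" "r \<noteq> ?i + m" "b = 1"
    | "r \<noteq> ?i" "r \<noteq> ?i + m" "b \<ge> 2" by linarith
  then show ?thesis
  proof cases
    case 1
    \<comment> \<open>Position of the delayed v of neighbour j. Since 0 <= k - tau <= D, the block
      index lies between 1 and D + 1; for a negative stamp the truncated time in
      \<open>h_vec\<close> and \<open>nat\<close> both give 0.\<close>
    define col where "col = (\<lambda>j. nat (int k - tau N k ?i j + 1) * m + j)"
    have col: "col j \<in> blocks N" "col j \<noteq> ?i" "?u (col j) = v_var T (nat (tau N k ?i j)) j"
      "int (col j) = int j + (int k - tau N k ?i j + 1) * int m" if "j \<in> N_in N ?i" for j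
    proof -
      have jn: "j \<in> nodes N" using that N_in_subset by blast
      have le: "tau N k ?i j \<le> int k" "int k - int D \<le> tau N k ?i j" using tau_le tau_ge[OF that] by auto
      then show "col j \<in> blocks N" unfolding col_def by (intro block_mem jn) linarith
      have "1 \<le> nat (int k - tau N k ?i j + 1)" using le by linarith
      from mult_le_mono1[OF this, of m] have "m < col j"
        using jn unfolding col_def nodes_def mult_1 atLeastAtMost_iff by linarith
      then show ne: "col j \<noteq> ?i" using im by linarith
      have "k - (nat (int k - tau N k ?i j + 1) - 1) = nat (tau N k ?i j)" using le by linarith
      moreover have "nat (int k - tau N k ?i j + 1) \<noteq> 0" using le by linarith
      ultimately show "?u (col j) = v_var T (nat (tau N k ?i j)) j"
        using ne h_vec_block[OF jn, of k "nat (int k - tau N k ?i j + 1)"] by (simp add: col_def)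
      show "int (col j) = int j + (int k - tau N k ?i j + 1) * int m"
        using le by (simp add: col_def)
    qed
    have W: "W_hat N k r q = (if q = ?i then row_wt N ?i ?i else 0)
        + (\<Sum>j\<in>N_in N ?i. if q = col j then row_wt N ?i j else 0)" for q
    proof (cases "q = ?i")
      case True
      have "(\<Sum>j\<in>N_in N ?i. if q = col j then row_wt N ?i j else 0) = 0"
      proof (intro sum.neutral ballI)
        fix j assume "j \<in> N_in N ?i"
        then show "(if q = col j then row_wt N ?i j else 0) = 0" using col(2)[of j] True by metis
      qed
      then show ?thesis using 1 True by (simp add: W_hat_def Let_def)
    next
      case False
      have "(int q = int j + (int k - tau N k ?i j + 1) * int m) = (q = col j)" if "j \<in> N_in N ?i" for j
        unfolding col(4)[OF that, symmetric] by simp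
      then show ?thesis using 1 False by (simp add: W_hat_def Let_def cong: sum.cong)
    qed
    have "(\<Sum>q\<in>blocks N. W_hat N k r q *\<^sub>R ?u q) = row_wt N ?i ?i *\<^sub>R ?u ?i
       + (\<Sum>j\<in>N_in N ?i. \<Sum>q\<in>blocks N. (if q = col j then row_wt N ?i j else 0) *\<^sub>R ?u q)"
      unfolding W scaleR_add_left sum.distrib pick[OF i(2)] scaleR_sum_left
      by (subst sum.swap) simp
    also have "(\<Sum>j\<in>N_in N ?i. \<Sum>q\<in>blocks N. (if q = col j then row_wt N ?i j else 0) *\<^sub>R ?u q)
      = (\<Sum>j\<in>N_in N ?i. row_wt N ?i j *\<^sub>R v_var T (nat (tau N k ?i j)) j)"
    proof (intro sum.cong refl)
      fix j assume j: "j \<in> N_in N ?i"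
      show "(\<Sum>q\<in>blocks N. (if q = col j then row_wt N ?i j else 0) *\<^sub>R ?u q)
        = row_wt N ?i j *\<^sub>R v_var T (nat (tau N k ?i j)) j"
        unfolding pick[OF col(1)[OF j]] col(3)[OF j] ..
    qed
    also have "row_wt N ?i ?i *\<^sub>R ?u ?i + \<dots> = h_vec N T (Suc k) r"
      unfolding u_i unfolding 1 h_vec_agent[OF i(1)] step(2)[of k] ..
    finally show ?thesis by simp
  next
    case 2
    have "W_hat N k r q = (if q = ?i then 1 else 0)" for q
      using 2 m_pos by (simp add: W_hat_def Let_def)
    then have "(\<Sum>q\<in>blocks N. W_hat N k r q *\<^sub>R ?u q) = ?u ?i" using pick[OF i(2), of 1] by simp
    then show ?thesis using 2 i u_i h_vec_v by simp
  next
    case 3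
    have rj: "r = j" "j \<noteq> ?i" using 3 r by auto
    have "W_hat N k r q = (if q = r then 1 else 0)" for q
      using 3 rj jm by (simp add: W_hat_def Let_def)
    then have "(\<Sum>q\<in>blocks N. W_hat N k r q *\<^sub>R ?u q) = ?u r" using pick[OF assms, of 1] by simp
    then show ?thesis using rj j by (simp add: h_vec_agent step_inactive(1))
  next
    case 4
    have rj: "r = j + m" "j \<noteq> ?i" using 4 r by auto
    have "W_hat N k r q = (if q = r then 1 else 0)" for q
      using 4 rj jm by (simp add: W_hat_def Let_def)
    then have "(\<Sum>q\<in>blocks N. W_hat N k r q *\<^sub>R ?u q) = ?u r" using pick[OF assms, of 1] by simp
    then show ?thesis using 4 rj j by (simp add: h_vec_v step_inactive(2))
  next
    case 5
    \<comment> \<open>Block b at time k + 1 and block b - 1 at time k hold v at the same absolute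
      time, so the row is a pure shift.\<close>
    obtain b' where b': "b = Suc (Suc b')" using 5 by (metis add_2_eq_Suc le_Suc_ex)
    have big: "r > 2 * m" using r b' jm by simp
    have rm: "r - m = Suc b' * m + j" using r b' by simp
    have "W_hat N k r q = (if q = r - m then 1 else 0)" for q
      using 5 big by (simp add: W_hat_def Let_def)
    moreover have mem: "r - m \<in> blocks N" unfolding rm using b b' by (intro block_mem j) simp
    ultimately have "(\<Sum>q\<in>blocks N. W_hat N k r q *\<^sub>R ?u q) = ?u (r - m)" using pick[of "r - m" 1] by simp
    also have "\<dots> = h_vec N T k (Suc b' * m + j)" using big im rm by auto
    also have "\<dots> = h_vec N T (Suc k) r"
      unfolding r b' h_vec_block[OF j] by simp
    finally show ?thesis by simp
  qed
qed

end

context network begin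

text \<open>Fix t and let the last factor recede: each row of the product starting at t tends to
  \<psi> t. Splitting off the earliest factor leaves products starting at t + 1, whose rows tend to
  \<psi> (t + 1). Uniqueness of limits gives an exact identity out of an approximate
  hypothesis.\<close>

lemma consensus_weights_invariant:
  assumes "consensus_sequence N C\<^sub>0 \<rho> \<psi>" "\<bar>\<rho>\<bar> < 1" "q \<in> blocks N"
  shows "\<psi> t q = (\<Sum>c\<in>blocks N. \<psi> (Suc t) c * W_hat N t c q)"
proof -
  let ?M = "mat_chain (blocks N) (W_hat N)"
  have lim: "(\<lambda>l. ?M t l r q) \<longlonglongrightarrow> \<psi> t q" if r: "r \<in> blocks N" "q \<in> blocks N" for t r q
  proof (rule LIM_zero_cancel, rule Lim_null_comparison)
    have "\<bar>?M t (t + l - t) r q - \<psi> t q\<bar> \<le> C\<^sub>0 * \<rho> ^ (t + l - t)" for l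
      using assms(1) r unfolding consensus_sequence_def by (metis le_add1)
    then show "\<forall>\<^sub>F l in sequentially. norm (?M t l r q - \<psi> t q) \<le> C\<^sub>0 * \<rho> ^ l" by simp
    show "(\<lambda>l. C\<^sub>0 * \<rho> ^ l) \<longlonglongrightarrow> 0"
      using tendsto_mult_right_zero[OF LIMSEQ_power_zero[of \<rho>], of C\<^sub>0] assms(2) by simp
  qed
  obtain r where r: "r \<in> blocks N" using assms(3) by blast
  have "(\<lambda>l. ?M t (Suc l) r q) \<longlonglongrightarrow> (\<Sum>c\<in>blocks N. \<psi> (Suc t) c * W_hat N t c q)"
    unfolding mat_chain_Suc_right[OF finite_blocks] by (intro tendsto_intros lim r)
  moreover have "(\<lambda>l. ?M t (Suc l) r q) \<longlonglongrightarrow> \<psi> t q"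
    using lim[OF r assms(3)] by (rule LIMSEQ_Suc)
  ultimately show ?thesis using LIMSEQ_unique by blast
qed

end

context async_run begin

lemma x_psi_Suc:
  assumes "consensus_sequence N C\<^sub>0 \<rho> \<psi>" "\<bar>\<rho>\<bar> < 1"
  shows "x_psi N \<psi> T (Suc k) = x_psi N \<psi> T k - (\<gamma> k * \<psi> k (act k)) *\<^sub>R z_var T k (act k)"
proof -
  let ?u = "\<lambda>q. h_vec N T k q + (if q = act k then - \<gamma> k *\<^sub>R z_var T k (act k) else 0)"
  have "x_psi N \<psi> T (Suc k)
      = (\<Sum>r\<in>blocks N. \<Sum>q\<in>blocks N. (\<psi> (Suc k) r * W_hat N k r q) *\<^sub>R ?u q)"
    unfolding x_psi_def by (intro sum.cong refl) (simp only: h_vec_Suc scaleR_right.sum scaleR_scaleR)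
  also have "\<dots> = (\<Sum>q\<in>blocks N. \<psi> k q *\<^sub>R ?u q)"
    unfolding consensus_weights_invariant[OF assms] scaleR_sum_left
    by (subst sum.swap, intro sum.cong refl) (simp add: consensus_weights_invariant[OF assms] scaleR_sum_left)
  also have "\<dots> = x_psi N \<psi> T k - (\<gamma> k * \<psi> k (act k)) *\<^sub>R z_var T k (act k)"
    using node_in_blocks[OF active_node, of k]
    by (simp add: x_psi_def scaleR_add_right sum.distrib if_distrib[of "\<lambda>x. _ *\<^sub>R x"] sum.delta
        mult.commute cong: if_cong)
  finally show ?thesis .
qed

lemma norm_h_vec_diff_le:
  assumes "r \<in> blocks N"
  shows "norm (h_vec N T k r - x_psi N \<psi> T k) \<le> sqrt (E_c N \<psi> T k)"
proof (rule real_le_rsqrt)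
  show "(norm (h_vec N T k r - x_psi N \<psi> T k))\<^sup>2 \<le> E_c N \<psi> T k"
    unfolding E_c_def using assms by (intro member_le_sum) auto
qed

text \<open>The old x and all delayed v that are read are blocks of the same \<open>h_vec\<close>,
  hence within the square root of \<open>E_c\<close> of the weighted mean. By row-stochasticity the
  new x is a convex combination of such blocks up to the gradient step; passing through the mean
  costs the factor 2.\<close>

lemma norm_x_diff_le:
  "norm (x_var T (Suc k) (act k) - x_var T k (act k))
     \<le> 2 * sqrt (E_c N \<psi> T k) + \<bar>\<gamma> k\<bar> * norm (z_var T k (act k))"
proof -
  let ?i = "act k" and ?p = "x_psi N \<psi> T k"
  let ?e = "sqrt (E_c N \<psi> T k)"
  have i: "?i \<in> nodes N" by (rule active_node)
  have v: "norm (v_var T (nat (tau N k ?i j)) j - ?p) \<le> ?e" if j: "j \<in> N_in N ?i" for j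
  proof -
    have jn: "j \<in> nodes N" using j N_in_subset by blast
    let ?b = "nat (int k - tau N k ?i j + 1)"
    have le: "tau N k ?i j \<le> int k" "int k - int D \<le> tau N k ?i j" using tau_le tau_ge[OF j] by auto
    then have "?b * m + j \<in> blocks N" by (intro block_mem jn) linarith
    moreover have "k - (?b - 1) = nat (tau N k ?i j)" "?b \<noteq> 0" using le by linarith+
    ultimately show ?thesis using norm_h_vec_diff_le[of "?b * m + j" k \<psi>] h_vec_block[OF jn, of k ?b] by simp
  qed
  have x: "norm (x_var T k ?i - ?p) \<le> ?e"
    using norm_h_vec_diff_le[OF node_in_blocks[OF i], of k \<psi>] by (simp add: h_vec_agent i)
  have e: "0 \<le> ?e" by (simp add: E_c_def sum_nonneg)
  have w: "row_wt N ?i j \<ge> 0" if "j \<in> N_in N ?i" for j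
    using row_wt_nonneg[OF i, of j] that N_in_subset by blast
  have wi: "row_wt N ?i ?i \<ge> 0" by (rule row_wt_nonneg[OF i i])
  have wi1: "row_wt N ?i ?i \<le> 1"
    using row_wt_sum[OF i] sum_nonneg[of "N_in N ?i" "row_wt N ?i"] w by force
  have one: "?p = row_wt N ?i ?i *\<^sub>R ?p + (\<Sum>j\<in>N_in N ?i. row_wt N ?i j *\<^sub>R ?p)"
    unfolding scaleR_sum_left[symmetric] scaleR_add_left[symmetric] row_wt_sum[OF i] by simp
  have eq: "x_var T (Suc k) ?i - ?p = row_wt N ?i ?i *\<^sub>R (x_var T k ?i - ?p)
      + (\<Sum>j\<in>N_in N ?i. row_wt N ?i j *\<^sub>R (v_var T (nat (tau N k ?i j)) j - ?p))
      - (row_wt N ?i ?i * \<gamma> k) *\<^sub>R z_var T k ?i"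
    by (subst (1) one) (simp add: step(2) step(1) scaleR_diff_right sum_subtractf algebra_simps)
  have "norm (x_var T (Suc k) ?i - ?p) \<le> norm (row_wt N ?i ?i *\<^sub>R (x_var T k ?i - ?p))
      + norm (\<Sum>j\<in>N_in N ?i. row_wt N ?i j *\<^sub>R (v_var T (nat (tau N k ?i j)) j - ?p))
      + norm ((row_wt N ?i ?i * \<gamma> k) *\<^sub>R z_var T k ?i)"
    unfolding eq by (meson norm_triangle_ineq norm_triangle_ineq4 add_right_mono order_trans)
  also have "norm (\<Sum>j\<in>N_in N ?i. row_wt N ?i j *\<^sub>R (v_var T (nat (tau N k ?i j)) j - ?p))
      \<le> (\<Sum>j\<in>N_in N ?i. row_wt N ?i j * ?e)"
    by (rule sum_norm_le) (use w v in \<open>auto intro!: mult_left_mono\<close>)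
  also have "norm (row_wt N ?i ?i *\<^sub>R (x_var T k ?i - ?p)) \<le> row_wt N ?i ?i * ?e"
    using wi x by (auto intro!: mult_left_mono)
  also have "norm ((row_wt N ?i ?i * \<gamma> k) *\<^sub>R z_var T k ?i) \<le> \<bar>\<gamma> k\<bar> * norm (z_var T k ?i)"
    using wi wi1 by (auto simp: abs_mult intro!: mult_right_mono mult_left_le_one_le)
  also have "row_wt N ?i ?i * ?e + (\<Sum>j\<in>N_in N ?i. row_wt N ?i j * ?e) = ?e"
    unfolding sum_distrib_right[symmetric] distrib_right[symmetric] row_wt_sum[OF i] by simp
  finally have "norm (x_var T (Suc k) ?i - ?p) \<le> ?e + \<bar>\<gamma> k\<bar> * norm (z_var T k ?i)" by simp
  then show ?thesis
    using x norm_triangle_ineq4[of "x_var T (Suc k) ?i - ?p" "x_var T k ?i - ?p"] by simp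
qed

end

section \<open>Sequences\<close>

lemma discrete_gronwall:
  fixes \<Phi> w :: "nat \<Rightarrow> real"
  assumes "\<And>n. \<Phi> n \<le> C + (\<Sum>s<n. w s * \<Phi> s)" and w: "\<And>n. 0 \<le> w n" and "summable w" and "0 \<le> C"
  shows "\<Phi> n \<le> C * exp (suminf w)"
proof -
  \<comment> \<open>The induction concerns the majorant rather than \<Phi>, because the majorant
    grows by at most the factor 1 + w n in each step.\<close>
  have S: "C + (\<Sum>s<n. w s * \<Phi> s) \<le> C * exp (\<Sum>s<n. w s)" for n
  proof (induction n)
    case (Suc n)
    have "C + (\<Sum>s<Suc n. w s * \<Phi> s) \<le> (1 + w n) * (C + (\<Sum>s<n. w s * \<Phi> s))"
      using mult_left_mono[OF assms(1)[of n] w[of n]] by (simp add: algebra_simps)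
    also have "\<dots> \<le> exp (w n) * (C * exp (\<Sum>s<n. w s))"
    proof (cases "C + (\<Sum>s<n. w s * \<Phi> s) \<ge> 0")
      case True
      show ?thesis by (rule mult_mono) (use Suc True exp_ge_add_one_self[of "w n"] in auto)
    next
      \<comment> \<open>\<Phi> carries no sign here, so the majorant may be negative and
        multiplication by the exponential bound would not be monotone; the claim is then
        trivial.\<close>
      case False
      then have "(1 + w n) * (C + (\<Sum>s<n. w s * \<Phi> s)) \<le> 0" using w[of n] by (intro mult_nonneg_nonpos) auto
      also have "0 \<le> exp (w n) * (C * exp (\<Sum>s<n. w s))" using assms(4) by simp
      finally show ?thesis .
    qed
    also have "\<dots> = C * exp (\<Sum>s<Suc n. w s)" by (simp add: exp_add)
    finally show ?case .
  qed simp
  have "\<Phi> n \<le> C * exp (\<Sum>s<n. w s)" using assms(1)[of n] S[of n] by linarith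
  also have "\<dots> \<le> C * exp (suminf w)"
    using sum_le_suminf[OF assms(3), of "{..<n}"] w assms(4) by (intro mult_left_mono) auto
  finally show ?thesis .
qed

lemma sum_powers_le:
  fixes r :: real
  assumes "0 < r" "r < 1" "finite A"
  shows "(\<Sum>j\<in>A. r ^ j) \<le> 1 / (1 - r)"
  using sum_le_suminf[OF summable_geometric, of r A] assms by (simp add: suminf_geometric)

lemma sum_geometric_le:
  fixes r :: real
  assumes "0 < r" "r < 1"
  shows "(\<Sum>k\<in>{s<..n}. r ^ (k - s)) \<le> 1 / (1 - r)" and "(\<Sum>t\<le>k. r ^ (k - t)) \<le> 1 / (1 - r)"
proof -
  have "(\<Sum>k\<in>{s<..n}. r ^ (k - s)) = (\<Sum>j\<in>(\<lambda>k. k - s) ` {s<..n}. r ^ j)"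
    by (subst sum.reindex) (auto simp: inj_on_def)
  also have "\<dots> \<le> 1 / (1 - r)" by (rule sum_powers_le[OF assms]) simp
  finally show "(\<Sum>k\<in>{s<..n}. r ^ (k - s)) \<le> 1 / (1 - r)" .
  have "(\<Sum>t\<le>k. r ^ (k - t)) = (\<Sum>j\<in>(\<lambda>t. k - t) ` {..k}. r ^ j)"
    by (subst sum.reindex) (auto simp: inj_on_def)
  also have "\<dots> \<le> 1 / (1 - r)" by (rule sum_powers_le[OF assms]) simp
  finally show "(\<Sum>t\<le>k. r ^ (k - t)) \<le> 1 / (1 - r)" .
qed

lemma sum_triangle_swap:
  fixes f :: "nat \<Rightarrow> nat \<Rightarrow> real"
  shows "(\<Sum>k\<le>n. \<Sum>s<k. f k s) = (\<Sum>s\<le>n. \<Sum>k\<in>{s<..n}. f k s)"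
proof -
  have "(\<Sum>k\<le>n. \<Sum>s<k. f k s) = (\<Sum>k\<le>n. \<Sum>s | s \<in> {..n} \<and> s < k. f k s)"
    by (intro sum.cong refl) auto
  also have "\<dots> = (\<Sum>s\<le>n. \<Sum>k | k \<in> {..n} \<and> s < k. f k s)"
    by (rule sum.swap_restrict) auto
  also have "\<dots> = (\<Sum>s\<le>n. \<Sum>k\<in>{s<..n}. f k s)"
    by (intro sum.cong refl) auto
  finally show ?thesis .
qed

text \<open>Such a tail is what remains of the later coefficients when a geometric double sum over s
  < k is reordered by s. Exchanging the two sums bounds its total by the geometric series times the
  total of \<open>a\<close>.\<close>

lemma summable_discounted_tail:
  fixes a :: "nat \<Rightarrow> real" and r :: real
  assumes r: "0 < r" "r < 1" and a: "\<And>k. 0 \<le> a k" "summable a"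
  shows "summable (\<lambda>j. r ^ j * a (s + j))" and "summable (\<lambda>s. \<Sum>j. r ^ j * a (s + j))"
proof -
  have inner: "summable (\<lambda>j. r ^ j * a (s + j))" for s
  proof (rule summable_comparison_test[OF exI[of _ 0]])
    show "summable (\<lambda>j. a (s + j))" using a(2) by (simp add: add.commute summable_iff_shift)
    show "\<forall>j\<ge>0. norm (r ^ j * a (s + j)) \<le> a (s + j)"
      using r a(1) by (auto simp: abs_mult power_le_one intro!: mult_left_le_one_le)
  qed
  then show "summable (\<lambda>j. r ^ j * a (s + j))" .
  have shifted: "(\<Sum>s<n. a (s + j)) \<le> suminf a" for n j
  proof -
    have "(\<Sum>s<n. a (s + j)) = (\<Sum>s\<in>(\<lambda>s. s + j) ` {..<n}. a s)" by (subst sum.reindex) auto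
    also have "\<dots> \<le> suminf a" by (rule sum_le_suminf[OF a(2)]) (use a(1) in auto)
    finally show ?thesis .
  qed
  show "summable (\<lambda>s. \<Sum>j. r ^ j * a (s + j))"
  proof (rule summableI_nonneg_bounded)
    show "0 \<le> (\<Sum>j. r ^ j * a (s + j))" for s
      by (rule suminf_nonneg[OF inner]) (use r a(1) in auto)
    show "(\<Sum>s<n. \<Sum>j. r ^ j * a (s + j)) \<le> (\<Sum>j. r ^ j * suminf a)" for n
    proof -
      have "(\<Sum>s<n. \<Sum>j. r ^ j * a (s + j)) = (\<Sum>j. \<Sum>s<n. r ^ j * a (s + j))"
        by (rule suminf_sum[symmetric]) (rule inner)
      also have "\<dots> \<le> (\<Sum>j. r ^ j * suminf a)"
      proof (rule suminf_le)
        show "(\<Sum>s<n. r ^ j * a (s + j)) \<le> r ^ j * suminf a" for j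
          unfolding sum_distrib_left[symmetric] using r shifted by (intro mult_left_mono) auto
        show "summable (\<lambda>j. \<Sum>s<n. r ^ j * a (s + j))" by (rule summable_sum) (rule inner)
        show "summable (\<lambda>j. r ^ j * suminf a)" using r by (intro summable_mult2 summable_geometric) auto
      qed
      finally show ?thesis .
    qed
  qed
qed

lemma discounted_tail_sum_le:
  fixes a :: "nat \<Rightarrow> real" and r :: real
  assumes r: "0 < r" "r < 1" and a: "\<And>k. 0 \<le> a k" "summable a"
  shows "(\<Sum>k\<in>{s<..n}. r ^ (k - s) * a k) \<le> (\<Sum>j. r ^ j * a (s + j))"
proof -
  have "(\<Sum>k\<in>{s<..n}. r ^ (k - s) * a k) = (\<Sum>j\<in>(\<lambda>k. k - s) ` {s<..n}. r ^ j * a (s + j))"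
    by (subst sum.reindex) (auto simp: inj_on_def intro!: sum.cong)
  also have "\<dots> \<le> (\<Sum>j. r ^ j * a (s + j))"
    by (rule sum_le_suminf[OF summable_discounted_tail(1)[OF assms]]) (use r a(1) in auto)
  finally show ?thesis .
qed

text \<open>From some index on \<open>A * \<gamma> k\<close> is below 1/2 and the weighted sum is
  absorbed by half of the left-hand side; the finitely many earlier terms form a constant.\<close>

lemma absorb_vanishing_weights:
  fixes u b \<gamma> :: "nat \<Rightarrow> real"
  assumes u: "\<And>k. 0 \<le> u k" and "\<gamma> \<longlonglongrightarrow> 0" and A: "0 \<le> A"
    and le: "\<And>n. (\<Sum>k\<le>n. u k) \<le> A + A * (\<Sum>k\<le>n. \<gamma> k * u k) + b n" and \<gamma>: "\<And>k. 0 \<le> \<gamma> k"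
  shows "\<exists>B\<ge>0. \<forall>n. (\<Sum>k\<le>n. u k) \<le> B + 2 * b n"
proof -
  have "(\<lambda>k. A * \<gamma> k) \<longlonglongrightarrow> 0" using tendsto_mult_right_zero[OF assms(2)] .
  then have "\<forall>\<^sub>F k in sequentially. A * \<gamma> k < 1/2" by (rule order_tendstoD) simp
  then obtain k0 where k0: "\<And>k. k \<ge> k0 \<Longrightarrow> A * \<gamma> k < 1/2" unfolding eventually_sequentially by blast
  define X where "X = (\<Sum>k<k0. A * \<gamma> k * u k)"
  define B where "B = A + X"
  have nn: "0 \<le> A * \<gamma> k * u k" for k using A \<gamma> u by simp
  have "(\<Sum>k\<le>n. u k) \<le> 2 * B + 2 * b n" for n
  proof -
    have "A * (\<Sum>k\<le>n. \<gamma> k * u k) \<le> (\<Sum>k\<le>n. u k / 2 + (if k < k0 then A * \<gamma> k * u k else 0))"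
      unfolding sum_distrib_left
    proof (rule sum_mono)
      fix k
      show "A * (\<gamma> k * u k) \<le> u k / 2 + (if k < k0 then A * \<gamma> k * u k else 0)"
      proof (cases "k < k0")
        case False
        then have "A * \<gamma> k * u k \<le> 1/2 * u k" using k0[of k] u[of k] by (intro mult_right_mono) auto
        then show ?thesis using False by (simp add: mult.assoc)
      qed (use u[of k] in \<open>simp add: mult.assoc\<close>)
    qed
    also have "\<dots> = (\<Sum>k\<le>n. u k) / 2 + (\<Sum>k\<le>n. if k < k0 then A * \<gamma> k * u k else 0)"
      by (simp add: sum.distrib sum_divide_distrib)
    also have "(\<Sum>k\<le>n. if k < k0 then A * \<gamma> k * u k else 0) = (\<Sum>k\<in>{..n} \<inter> {..<k0}. A * \<gamma> k * u k)"
      by (subst sum.inter_restrict) (auto intro!: sum.cong)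
    also have "\<dots> \<le> (\<Sum>k<k0. A * \<gamma> k * u k)"
      by (rule sum_mono2) (use nn in auto)
    finally have "A * (\<Sum>k\<le>n. \<gamma> k * u k) \<le> (\<Sum>k\<le>n. u k) / 2 + X" by (simp add: X_def)
    with le[of n] have "(\<Sum>k\<le>n. u k) \<le> A + ((\<Sum>k\<le>n. u k) / 2 + X) + b n" by simp
    then show ?thesis unfolding B_def by (simp add: field_simps)
  qed
  moreover have "0 \<le> 2 * B" unfolding B_def X_def using A nn by (simp add: sum_nonneg)
  ultimately show ?thesis by blast
qed

text \<open>
  \<open>\<Phi>\<close> is the expected optimality gap, \<open>G\<close> the expected squared gradient at the weighted mean, \<open>Z\<close> the
  expected squared direction and \<open>\<tau>\<close> the tracking error proper.  All errors are weighted by \<open>\<gamma>\<^sup>2\<close>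
  against \<open>\<Phi>\<close> (through \<open>G \<le> K \<Phi>\<close>) rather than against \<open>\<gamma> \<xi> G\<close>, so that no lower bound
  on \<open>\<xi>\<close> is required.
\<close>

lemma weighted_errors_bounded:
  fixes \<gamma> \<xi> \<Phi> G Z ec et ez \<tau> :: "nat \<Rightarrow> real"
  assumes \<gamma>: "\<And>k. 0 < \<gamma> k" "\<And>k. \<gamma> k \<le> 1" and sq: "summable (\<lambda>k. (\<gamma> k)\<^sup>2)"
    and r: "0 < r" "r < 1" and K: "0 \<le> K" and \<eta>: "0 < \<eta>" and \<xi>: "\<And>k. 0 \<le> \<xi> k" "\<And>k. \<xi> k \<le> 1"
    and nonneg: "\<And>k. 0 \<le> \<Phi> k" "\<And>k. 0 \<le> G k" "\<And>k. 0 \<le> Z k" "\<And>k. 0 \<le> ec k" "\<And>k. 0 \<le> et k"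
      "\<And>k. 0 \<le> \<tau> k"
    and G: "\<And>k. G k \<le> K * \<Phi> k"
    and descent: "\<And>k. \<eta> * (\<gamma> k * \<xi> k * G k) \<le> \<Phi> k - \<Phi> (Suc k) + K * ((\<gamma> k)\<^sup>2 * (\<Phi> k + Z k + 1))
       + K * (ec k + \<tau> k) + K * (\<gamma> k * (\<Sum>s<k. r ^ (k - s) * (\<gamma> s * (Z s + 1))))"
    and Z: "\<And>k. Z k \<le> K * (\<Phi> k + ec k + \<tau> k + 1)"
    and \<tau>: "\<And>n. (\<Sum>k\<le>n. \<tau> k) \<le> K + K * (\<Sum>k\<le>n. ec k + (\<gamma> k)\<^sup>2 * Z k)"
    and ec: "\<And>n. (\<Sum>k\<le>n. ec k) \<le> K + K * (\<Sum>k\<le>n. (\<gamma> k)\<^sup>2 * (ez k + 1))"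
    and et: "\<And>n. (\<Sum>k\<le>n. et k) \<le> K + K * (\<Sum>k\<le>n. (\<gamma> k)\<^sup>2 * (ez k + 1))"
    and ez: "\<And>k. ez k \<le> K * (et k + \<xi> k * G k + ec k)"
  shows "\<exists>B. \<forall>n. (\<Sum>k\<le>n. \<gamma> k * (et k + ec k + ez k)) \<le> B"
proof -
  define u where "u k = ec k + et k + \<tau> k" for k
  define \<Gamma> where "\<Gamma> = (\<Sum>k. (\<gamma> k)\<^sup>2)"
  define R where "R = 1 / (1 - r)"
  have u: "0 \<le> u k" "ec k \<le> u k" "ec k + \<tau> k \<le> u k" "et k + ec k \<le> u k" for k
    using nonneg[of k] by (auto simp: u_def)
  have \<Gamma>: "(\<Sum>k\<le>n. (\<gamma> k)\<^sup>2) \<le> \<Gamma>" "0 \<le> \<Gamma>" for n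
    unfolding \<Gamma>_def using sq by (auto intro: sum_le_suminf suminf_nonneg)
  have sq1: "(\<gamma> k)\<^sup>2 \<le> 1" for k using \<gamma>[of k] by (simp add: power_le_one less_imp_le)
  have R: "0 < R" using r by (simp add: R_def)
  have Z': "Z k \<le> K * (\<Phi> k + u k + 1)" for k
    using Z[of k] mult_left_mono[OF u(3)[of k] K] by (simp add: distrib_left)
  have ez': "ez k \<le> K * (1 + K) * (u k + \<Phi> k)" for k
  proof -
    have "\<xi> k * G k \<le> K * \<Phi> k" using G[of k] \<xi>[of k] nonneg(2)[of k] mult_right_mono[of "\<xi> k" 1 "G k"] by linarith
    then have "ez k \<le> K * (u k + K * \<Phi> k)"
      using ez[of k] mult_left_mono[OF _ K, of "et k + \<xi> k * G k + ec k" "u k + K * \<Phi> k"] u(4)[of k] by linarith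
    also have "\<dots> \<le> K * ((1 + K) * (u k + \<Phi> k))"
      using K u(1)[of k] nonneg(1)[of k] by (intro mult_left_mono) (auto simp: algebra_simps)
    finally show ?thesis by (simp add: mult.assoc)
  qed
  \<comment> \<open>All accumulated errors turn out to be affine in this one quantity.\<close>
  define V where "V n = (\<Sum>k\<le>n. (\<gamma> k)\<^sup>2 * (u k + \<Phi> k))" for n
  have V: "0 \<le> V n" for n unfolding V_def using u(1) nonneg(1) by (simp add: sum_nonneg)
  have ezV: "(\<Sum>k\<le>n. (\<gamma> k)\<^sup>2 * (ez k + 1)) \<le> K * (1 + K) * V n + \<Gamma>" for n
  proof -
    have "(\<Sum>k\<le>n. (\<gamma> k)\<^sup>2 * (ez k + 1)) \<le> (\<Sum>k\<le>n. (\<gamma> k)\<^sup>2 * (K * (1 + K) * (u k + \<Phi> k) + 1))"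
      using ez' by (intro sum_mono mult_left_mono) auto
    also have "\<dots> = K * (1 + K) * V n + (\<Sum>k\<le>n. (\<gamma> k)\<^sup>2)"
      unfolding V_def sum_distrib_left sum.distrib[symmetric]
      by (intro sum.cong refl) (simp add: algebra_simps)
    finally show ?thesis using \<Gamma>(1)[of n] by linarith
  qed
  have ZV: "(\<Sum>k\<le>n. (\<gamma> k)\<^sup>2 * Z k) \<le> K * (V n + \<Gamma>)" for n
  proof -
    have "(\<Sum>k\<le>n. (\<gamma> k)\<^sup>2 * Z k) \<le> (\<Sum>k\<le>n. (\<gamma> k)\<^sup>2 * (K * (\<Phi> k + u k + 1)))"
      using Z' by (intro sum_mono mult_left_mono) auto
    also have "\<dots> = K * (V n + (\<Sum>k\<le>n. (\<gamma> k)\<^sup>2))"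
      unfolding V_def sum_distrib_left sum.distrib[symmetric]
      by (intro sum.cong refl) (simp add: algebra_simps)
    also have "\<dots> \<le> K * (V n + \<Gamma>)" using \<Gamma>(1)[of n] K by (intro mult_left_mono) auto
    finally show ?thesis .
  qed
  \<comment> \<open>Dominates both the constant and the \<open>V n\<close>-coefficient of the bound
    (2 + K) ?a + K + K * K * (V n + \<Gamma>) obtained below, where 2 + K <= 2 (1 + K).\<close>
  define A where "A = (1 + K) * (2 * (K + K * (K * (1 + K) + \<Gamma>))) + K + K * (K * (1 + \<Gamma>))"
  have uV: "(\<Sum>k\<le>n. u k) \<le> A + A * V n" for n
  proof -
    let ?a = "K + K * (K * (1 + K) * V n + \<Gamma>)"
    have "K * (\<Sum>k\<le>n. (\<gamma> k)\<^sup>2 * (ez k + 1)) \<le> K * (K * (1 + K) * V n + \<Gamma>)"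
      by (rule mult_left_mono[OF ezV K])
    then have e: "(\<Sum>k\<le>n. ec k) \<le> ?a" "(\<Sum>k\<le>n. et k) \<le> ?a" using ec[of n] et[of n] by linarith+
    have "(\<Sum>k\<le>n. \<tau> k) \<le> K + K * ((\<Sum>k\<le>n. ec k) + (\<Sum>k\<le>n. (\<gamma> k)\<^sup>2 * Z k))"
      using \<tau>[of n] by (simp add: sum.distrib)
    also have "\<dots> \<le> K + K * (?a + K * (V n + \<Gamma>))"
      using e(1) ZV[of n] K by (intro add_left_mono mult_left_mono) auto
    finally have "(\<Sum>k\<le>n. u k) \<le> 2 * ?a + (K + K * (?a + K * (V n + \<Gamma>)))"
      unfolding u_def sum.distrib mult_2 by (intro add_mono e)
    also have "\<dots> \<le> A + A * V n"
    proof -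
      have nn: "0 \<le> K * V n" "0 \<le> K * K" "0 \<le> K * K * V n" "0 \<le> K * \<Gamma>" "0 \<le> K * K * \<Gamma>"
        "0 \<le> K * K * K" "0 \<le> K * K * K * V n" "0 \<le> K * \<Gamma> * V n" "0 \<le> K * K * \<Gamma> * V n"
        "0 \<le> K * K * K * K" "0 \<le> K * K * K * K * V n"
        using K V[of n] \<Gamma>(2) by auto
      show ?thesis unfolding A_def using nn K by (simp add: algebra_simps)
    qed
    finally show ?thesis .
  qed
  have A: "0 \<le> A" unfolding A_def using K \<Gamma>(2) by auto
  \<comment> \<open>The u-part of \<open>V\<close> is absorbed, so the accumulated errors are
    controlled by \<Phi> alone.\<close>
  have "\<exists>B\<ge>0. \<forall>n. (\<Sum>k\<le>n. u k) \<le> B + 2 * (A * (\<Sum>k\<le>n. (\<gamma> k)\<^sup>2 * \<Phi> k))"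
  proof (rule absorb_vanishing_weights[where \<gamma> = "\<lambda>k. (\<gamma> k)\<^sup>2" and A = A])
    show "(\<lambda>k. (\<gamma> k)\<^sup>2) \<longlonglongrightarrow> 0" by (rule summable_LIMSEQ_zero[OF sq])
    show "(\<Sum>k\<le>n. u k) \<le> A + A * (\<Sum>k\<le>n. (\<gamma> k)\<^sup>2 * u k) + A * (\<Sum>k\<le>n. (\<gamma> k)\<^sup>2 * \<Phi> k)" for n
      using uV[of n] unfolding V_def by (simp add: distrib_left sum.distrib)
  qed (use u A in auto)
  then obtain B where B: "0 \<le> B" "\<And>n. (\<Sum>k\<le>n. u k) \<le> B + 2 * (A * (\<Sum>k\<le>n. (\<gamma> k)\<^sup>2 * \<Phi> k))" by blast
  \<comment> \<open>After the noise sum is reordered by the earlier index s, the squares of all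
    later step sizes are charged to s with geometric weights.\<close>
  define tail where "tail s = (\<Sum>j. r ^ j * (\<gamma> (s + j))\<^sup>2)" for s
  have tail: "summable tail" "0 \<le> tail s" for s
    unfolding tail_def using summable_discounted_tail[OF r, of "\<lambda>k. (\<gamma> k)\<^sup>2"] sq r
    by (auto intro!: suminf_nonneg)
  have noise: "(\<Sum>k\<le>n. \<gamma> k * (\<Sum>s<k. r ^ (k - s) * (\<gamma> s * (Z s + 1))))
      \<le> (K + 1) * (\<Sum>s\<le>n. (R * (\<gamma> s)\<^sup>2 + tail s) * (\<Phi> s + 1)) + R * K * (\<Sum>s\<le>n. u s)" for n
  proof -
    have "(\<Sum>k\<le>n. \<gamma> k * (\<Sum>s<k. r ^ (k - s) * (\<gamma> s * (Z s + 1))))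
       = (\<Sum>s\<le>n. \<Sum>k\<in>{s<..n}. r ^ (k - s) * (\<gamma> k * \<gamma> s * (Z s + 1)))"
      unfolding sum_triangle_swap[symmetric] by (simp add: sum_distrib_left mult_ac)
    also have "\<dots> \<le> (\<Sum>s\<le>n. \<Sum>k\<in>{s<..n}. r ^ (k - s) *
        (((\<gamma> s)\<^sup>2 + (\<gamma> k)\<^sup>2) * ((K + 1) * (\<Phi> s + 1)) + K * u s))"
    proof (intro sum_mono mult_left_mono)
      fix k s
      have "\<gamma> k * \<gamma> s * (Z s + 1) \<le> \<gamma> k * \<gamma> s * ((K + 1) * (\<Phi> s + 1) + K * u s)"
        using \<gamma>[of k] \<gamma>[of s] Z'[of s] nonneg(1)[of s] K
        by (intro mult_left_mono) (auto simp: algebra_simps)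
      also have "\<dots> = \<gamma> k * \<gamma> s * ((K + 1) * (\<Phi> s + 1)) + \<gamma> k * \<gamma> s * (K * u s)"
        by (rule distrib_left)
      \<comment> \<open>The two parts are treated differently: the \<Phi>-part needs summable
        weights and receives squares of step sizes, while the u-part is already controlled in sum
        and can afford the crude bound 1.\<close>
      also have "\<dots> \<le> ((\<gamma> s)\<^sup>2 + (\<gamma> k)\<^sup>2) * ((K + 1) * (\<Phi> s + 1)) + 1 * (K * u s)"
      proof (intro add_mono mult_right_mono)
        show "\<gamma> k * \<gamma> s \<le> (\<gamma> s)\<^sup>2 + (\<gamma> k)\<^sup>2"
          using sum_squares_bound[of "\<gamma> k" "\<gamma> s"] zero_le_power2[of "\<gamma> k"] zero_le_power2[of "\<gamma> s"]
            mult_pos_pos[OF \<gamma>(1)[of k] \<gamma>(1)[of s]] by linarith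
        show "\<gamma> k * \<gamma> s \<le> 1" using \<gamma>[of k] \<gamma>[of s] by (intro mult_le_one) auto
      qed (use K u(1) nonneg(1) in auto)
      finally show "\<gamma> k * \<gamma> s * (Z s + 1) \<le> ((\<gamma> s)\<^sup>2 + (\<gamma> k)\<^sup>2) * ((K + 1) * (\<Phi> s + 1)) + K * u s" by simp
    qed (use r in auto)
    also have "\<dots> \<le> (\<Sum>s\<le>n. (K + 1) * ((R * (\<gamma> s)\<^sup>2 + tail s) * (\<Phi> s + 1)) + R * K * u s)"
    proof (rule sum_mono)
      fix s
      have "(\<Sum>k\<in>{s<..n}. r ^ (k - s) * (((\<gamma> s)\<^sup>2 + (\<gamma> k)\<^sup>2) * ((K + 1) * (\<Phi> s + 1)) + K * u s))
         = (\<Sum>k\<in>{s<..n}. r ^ (k - s)) * ((\<gamma> s)\<^sup>2 * ((K + 1) * (\<Phi> s + 1)) + K * u s)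
         + (\<Sum>k\<in>{s<..n}. r ^ (k - s) * (\<gamma> k)\<^sup>2) * ((K + 1) * (\<Phi> s + 1))"
        by (simp add: sum_distrib_left sum_distrib_right sum.distrib[symmetric] algebra_simps)
      also have "\<dots> \<le> R * ((\<gamma> s)\<^sup>2 * ((K + 1) * (\<Phi> s + 1)) + K * u s) + tail s * ((K + 1) * (\<Phi> s + 1))"
        using sum_geometric_le(1)[OF r, of s n] discounted_tail_sum_le[OF r _ sq, of s n] K u(1)[of s] nonneg(1)[of s]
        unfolding R_def tail_def by (intro add_mono mult_right_mono) auto
      finally show "(\<Sum>k\<in>{s<..n}. r ^ (k - s) * (((\<gamma> s)\<^sup>2 + (\<gamma> k)\<^sup>2) * ((K + 1) * (\<Phi> s + 1)) + K * u s))
        \<le> (K + 1) * ((R * (\<gamma> s)\<^sup>2 + tail s) * (\<Phi> s + 1)) + R * K * u s"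
        by (simp add: algebra_simps)
    qed
    finally show ?thesis by (simp add: sum.distrib sum_distrib_left)
  qed
  define w where "w s = (\<gamma> s)\<^sup>2 + (R * (\<gamma> s)\<^sup>2 + tail s)" for s
  have w: "summable w" "0 \<le> w s" "(\<gamma> s)\<^sup>2 \<le> w s" "R * (\<gamma> s)\<^sup>2 + tail s \<le> w s" for s
    unfolding w_def using tail R sq by (auto intro!: summable_add summable_mult)
  \<comment> \<open>Sum of the coefficients 2 K (K + 1) of the weighted \<Phi>-sum and K * K + K + K
    * R * K of the u-sum in the telescoped descent inequality.\<close>
  define A2 where "A2 = K * (K + 1) + K * K + K + K * (K + 1) + K * R * K"
  have A2: "0 \<le> A2" unfolding A2_def using K R by auto
  have summed: "\<Phi> (Suc n) + \<eta> * (\<Sum>k\<le>n. \<gamma> k * \<xi> k * G k) \<le> \<Phi> 0 + A2 * (\<Sum>k\<le>n. w k * (\<Phi> k + 1)) + A2 * (\<Sum>k\<le>n. u k)" for n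
  proof -
    have "\<eta> * (\<Sum>k\<le>n. \<gamma> k * \<xi> k * G k)
       \<le> (\<Sum>k\<le>n. \<Phi> k - \<Phi> (Suc k) + K * ((\<gamma> k)\<^sup>2 * (\<Phi> k + Z k + 1))
       + K * (ec k + \<tau> k) + K * (\<gamma> k * (\<Sum>s<k. r ^ (k - s) * (\<gamma> s * (Z s + 1)))))"
      by (subst sum_distrib_left) (intro sum_mono descent)
    also have "\<dots> = (\<Sum>k\<le>n. \<Phi> k - \<Phi> (Suc k)) + K * (\<Sum>k\<le>n. (\<gamma> k)\<^sup>2 * (\<Phi> k + Z k + 1))
       + K * (\<Sum>k\<le>n. ec k + \<tau> k) + K * (\<Sum>k\<le>n. \<gamma> k * (\<Sum>s<k. r ^ (k - s) * (\<gamma> s * (Z s + 1))))"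
      by (simp only: sum.distrib sum_distrib_left distrib_left)
    also have "(\<Sum>k\<le>n. \<Phi> k - \<Phi> (Suc k)) = \<Phi> 0 - \<Phi> (Suc n)" by (rule sum_telescope)
    also have "(\<Sum>k\<le>n. (\<gamma> k)\<^sup>2 * (\<Phi> k + Z k + 1)) \<le> (\<Sum>k\<le>n. (K + 1) * (w k * (\<Phi> k + 1)) + K * u k)"
    proof (rule sum_mono)
      fix k
      have "(\<gamma> k)\<^sup>2 * (\<Phi> k + Z k + 1) \<le> (\<gamma> k)\<^sup>2 * ((K + 1) * (\<Phi> k + 1) + K * u k)"
        using Z'[of k] by (intro mult_left_mono) (auto simp: algebra_simps)
      also have "\<dots> = (\<gamma> k)\<^sup>2 * ((K + 1) * (\<Phi> k + 1)) + (\<gamma> k)\<^sup>2 * (K * u k)" by (rule distrib_left)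
      also have "\<dots> \<le> w k * ((K + 1) * (\<Phi> k + 1)) + 1 * (K * u k)"
        using w(3) sq1 K u(1) nonneg(1) by (intro add_mono mult_right_mono) auto
      finally show "(\<gamma> k)\<^sup>2 * (\<Phi> k + Z k + 1) \<le> (K + 1) * (w k * (\<Phi> k + 1)) + K * u k" by (simp add: mult_ac)
    qed
    also have "\<dots> = (K + 1) * (\<Sum>k\<le>n. w k * (\<Phi> k + 1)) + K * (\<Sum>k\<le>n. u k)"
      by (simp add: sum.distrib sum_distrib_left)
    also have "(\<Sum>k\<le>n. ec k + \<tau> k) \<le> (\<Sum>k\<le>n. u k)" by (rule sum_mono) (rule u(3))
    also have "(\<Sum>k\<le>n. \<gamma> k * (\<Sum>s<k. r ^ (k - s) * (\<gamma> s * (Z s + 1))))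
       \<le> (K + 1) * (\<Sum>k\<le>n. w k * (\<Phi> k + 1)) + R * K * (\<Sum>s\<le>n. u s)"
    proof -
      have "(\<Sum>s\<le>n. (R * (\<gamma> s)\<^sup>2 + tail s) * (\<Phi> s + 1)) \<le> (\<Sum>k\<le>n. w k * (\<Phi> k + 1))"
        using w(4) nonneg(1) by (intro sum_mono mult_right_mono) auto
      from mult_left_mono[OF this, of "K + 1"] show ?thesis using noise[of n] K by linarith
    qed
    finally have 1: "\<eta> * (\<Sum>k\<le>n. \<gamma> k * \<xi> k * G k) \<le> \<Phi> 0 - \<Phi> (Suc n)
        + K * ((K + 1) * (\<Sum>k\<le>n. w k * (\<Phi> k + 1)) + K * (\<Sum>k\<le>n. u k)) + K * (\<Sum>k\<le>n. u k)
        + K * ((K + 1) * (\<Sum>k\<le>n. w k * (\<Phi> k + 1)) + R * K * (\<Sum>s\<le>n. u s))"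
      using K by (simp add: mult_left_mono)
    have nn: "0 \<le> (\<Sum>k\<le>n. w k * (\<Phi> k + 1))" "0 \<le> (\<Sum>k\<le>n. u k)"
      using w(2) nonneg(1) u(1) by (auto intro!: sum_nonneg)
    have "K * ((K + 1) * (\<Sum>k\<le>n. w k * (\<Phi> k + 1))) + K * ((K + 1) * (\<Sum>k\<le>n. w k * (\<Phi> k + 1)))
       \<le> A2 * (\<Sum>k\<le>n. w k * (\<Phi> k + 1))"
      unfolding distrib_right[symmetric] mult.assoc[symmetric] A2_def
      using nn K R by (intro mult_right_mono) (auto simp: algebra_simps)
    moreover have "K * (K * (\<Sum>k\<le>n. u k)) + K * (\<Sum>k\<le>n. u k) + K * (R * K * (\<Sum>s\<le>n. u s)) \<le> A2 * (\<Sum>k\<le>n. u k)"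
      unfolding distrib_right[symmetric] mult.assoc[symmetric] A2_def
      using nn K R by (intro mult_right_mono) (auto simp: algebra_simps)
    ultimately show ?thesis using 1 by (simp add: distrib_left)
  qed
  define C where "C = \<Phi> 0 + A2 * suminf w + A2 * B"
  \<comment> \<open>The 1 comes from the direct \<Phi>-terms, the 2 * A from replacing the
    accumulated errors by the \<Phi>-sum that controls them.\<close>
  define w' where "w' s = A2 * (1 + 2 * A) * w s" for s
  have C: "0 \<le> C" unfolding C_def using nonneg(1) A2 B(1) w by (simp add: suminf_nonneg)
  have w': "summable w'" "0 \<le> w' s" for s
    unfolding w'_def using w A2 A by (auto intro: summable_mult)
  have bound: "\<Phi> (Suc n) + \<eta> * (\<Sum>k\<le>n. \<gamma> k * \<xi> k * G k) \<le> C + (\<Sum>k\<le>n. w' k * \<Phi> k)" for n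
  proof -
    have "(\<Sum>k\<le>n. w k) \<le> suminf w" using sum_le_suminf[OF w(1), of "{..n}"] w(2) by simp
    then have "A2 * (\<Sum>k\<le>n. w k * (\<Phi> k + 1)) \<le> A2 * ((\<Sum>k\<le>n. w k * \<Phi> k) + suminf w)"
      using A2 by (intro mult_left_mono) (auto simp: distrib_left sum.distrib)
    moreover have "(\<Sum>k\<le>n. u k) \<le> B + 2 * (A * (\<Sum>k\<le>n. w k * \<Phi> k))"
    proof -
      have "(\<Sum>k\<le>n. (\<gamma> k)\<^sup>2 * \<Phi> k) \<le> (\<Sum>k\<le>n. w k * \<Phi> k)"
        using w(3) nonneg(1) by (intro sum_mono mult_right_mono) auto
      from mult_left_mono[OF this A] show ?thesis using B(2)[of n] by linarith
    qed
    then have "A2 * (\<Sum>k\<le>n. u k) \<le> A2 * (B + 2 * (A * (\<Sum>k\<le>n. w k * \<Phi> k)))"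
      using A2 by (rule mult_left_mono)
    ultimately have "\<Phi> (Suc n) + \<eta> * (\<Sum>k\<le>n. \<gamma> k * \<xi> k * G k) \<le> \<Phi> 0 + A2 * ((\<Sum>k\<le>n. w k * \<Phi> k) + suminf w)
       + A2 * (B + 2 * (A * (\<Sum>k\<le>n. w k * \<Phi> k)))"
      using summed[of n] by linarith
    also have "\<dots> = C + A2 * (1 + 2 * A) * (\<Sum>k\<le>n. w k * \<Phi> k)"
      unfolding C_def by (simp add: algebra_simps)
    also have "A2 * (1 + 2 * A) * (\<Sum>k\<le>n. w k * \<Phi> k) = (\<Sum>k\<le>n. w' k * \<Phi> k)"
      unfolding w'_def by (simp add: sum_distrib_left mult_ac)
    finally show ?thesis .
  qed
  have gG: "0 \<le> \<gamma> k * \<xi> k * G k" for k using \<gamma>(1)[of k] \<xi>(1)[of k] nonneg(2)[of k] by simp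
  have "\<Phi> n \<le> C + (\<Sum>s<n. w' s * \<Phi> s)" for n
  proof (cases n)
    case 0
    have "0 \<le> A2 * suminf w + A2 * B" using A2 B(1) w by (simp add: suminf_nonneg)
    then show ?thesis unfolding 0 C_def by simp
  next
    case (Suc n')
    have "0 \<le> \<eta> * (\<Sum>k\<le>n'. \<gamma> k * \<xi> k * G k)" using \<eta> gG by (simp add: sum_nonneg)
    then show ?thesis using bound[of n'] unfolding Suc lessThan_Suc_atMost by linarith
  qed
  note \<Phi> = discrete_gronwall[OF this w'(2) w'(1) C]
  define P where "P = C * exp (suminf w')"
  have P: "0 \<le> P" unfolding P_def using C by simp
  have sum\<Phi>: "(\<Sum>k\<le>n. v k * \<Phi> k) \<le> suminf v * P" if "summable v" "\<And>k. 0 \<le> v k" for v n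
  proof -
    have "(\<Sum>k\<le>n. v k * \<Phi> k) \<le> (\<Sum>k\<le>n. v k) * P"
      unfolding sum_distrib_right using that(2) \<Phi> by (auto intro!: sum_mono mult_left_mono simp: P_def)
    also have "\<dots> \<le> suminf v * P" using that P by (intro mult_right_mono sum_le_suminf) auto
    finally show ?thesis .
  qed
  have uB: "(\<Sum>k\<le>n. u k) \<le> B + 2 * (A * (\<Gamma> * P))" for n
    using B(2)[of n] mult_left_mono[OF sum\<Phi>[OF sq, of n] A] by (simp add: \<Gamma>_def)
  \<comment> \<open>The gradient sum, dropped as nonnegative for the Gronwall argument, is recovered
    from the same inequality now that \<Phi> is bounded.\<close>
  have GB: "(\<Sum>k\<le>n. \<gamma> k * \<xi> k * G k) \<le> (C + suminf w' * P) / \<eta>" for n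
    using bound[of n] nonneg(1)[of "Suc n"] sum\<Phi>[OF w', of n] \<eta> by (simp add: field_simps)
  show ?thesis
  proof (intro exI allI)
    fix n
    \<comment> \<open>The errors in u are summable without any weight, so \<gamma> is bounded by 1
      there; only the gradient term needs its factor \<gamma>.\<close>
    have "(\<Sum>k\<le>n. \<gamma> k * (et k + ec k + ez k)) \<le> (\<Sum>k\<le>n. (1 + K) * u k + K * (\<gamma> k * \<xi> k * G k))"
    proof (rule sum_mono)
      fix k
      have "\<gamma> k * (et k + ec k + ez k) \<le> \<gamma> k * ((1 + K) * u k + K * (\<xi> k * G k))"
      proof (rule mult_left_mono)
        have "K * (et k + ec k) \<le> K * u k" using u(4) K by (rule mult_left_mono)
        then show "et k + ec k + ez k \<le> (1 + K) * u k + K * (\<xi> k * G k)"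
          using ez[of k] u(4)[of k] by (simp add: algebra_simps)
      qed (use \<gamma>(1)[of k] in simp)
      also have "\<dots> = \<gamma> k * ((1 + K) * u k) + K * (\<gamma> k * \<xi> k * G k)" by (simp add: algebra_simps)
      also have "\<gamma> k * ((1 + K) * u k) \<le> 1 * ((1 + K) * u k)"
        using \<gamma>(2)[of k] K u(1)[of k] by (intro mult_right_mono) auto
      finally show "\<gamma> k * (et k + ec k + ez k) \<le> (1 + K) * u k + K * (\<gamma> k * \<xi> k * G k)" by simp
    qed
    also have "\<dots> = (1 + K) * (\<Sum>k\<le>n. u k) + K * (\<Sum>k\<le>n. \<gamma> k * \<xi> k * G k)"
      by (simp add: sum.distrib sum_distrib_left)
    also have "\<dots> \<le> (1 + K) * (B + 2 * (A * (\<Gamma> * P))) + K * ((C + suminf w' * P) / \<eta>)"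
      using uB[of n] GB[of n] K by (intro add_mono mult_left_mono) auto
    finally show "(\<Sum>k\<le>n. \<gamma> k * (et k + ec k + ez k)) \<le> (1 + K) * (B + 2 * (A * (\<Gamma> * P))) + K * ((C + suminf w' * P) / \<eta>)" .
  qed
qed

section \<open>Decomposition of the tracked directions\<close>

lemma stochastic_vector_le_1:
  assumes "stochastic_vector I u" "finite I" "p \<in> I"
  shows "u p \<le> 1"
  using member_le_sum[of p I u] assms by (auto simp: stochastic_vector_def)

context network begin

text \<open>\<open>chain_to\<close> for k ends with factor k - 1, so it is compared with \<xi> at k
  - 1 and the exponent drops by one. Dividing the constant by r repairs this, and the added 1 covers
  t = k, where an identity matrix is compared with entries in [0, 1].\<close>

lemma tracking_rate:
  assumes "tracking_sequence N C\<^sub>0 \<rho> \<xi>" "C\<^sub>0 > 0" "\<rho> < 1"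
  obtains r K where "0 \<le> \<rho>" "0 < r" "r < 1" "1 \<le> K"
    "\<And>k t p q. t \<le> k \<Longrightarrow> p \<in> aug_nodes N \<Longrightarrow> q \<in> aug_nodes N \<Longrightarrow>
       \<bar>chain_to (aug_nodes N) (A_hat N) k t p q - \<xi> (int k - 1) p\<bar> \<le> K * r ^ (k - t)"
proof -
  let ?A = "aug_nodes N"
  have bound: "\<bar>mat_chain ?A (A_hat N) t (k - t) p q - \<xi> (int k) p\<bar> \<le> C\<^sub>0 * \<rho> ^ (k - t)"
    if "t \<le> k" "p \<in> ?A" "q \<in> ?A" for k t p q
    using assms(1) that by (auto simp: tracking_sequence_def)
  have stoch: "stochastic_vector ?A (\<xi> (int k - 1))" for k
    using assms(1) by (auto simp: tracking_sequence_def)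
  have a: "Agent (act 0) \<in> ?A" using active_node by (simp add: aug_nodes_def)
  \<comment> \<open>The bound for products of two factors has exponent one and dominates an absolute
    value, which excludes a negative \<rho>.\<close>
  have "0 \<le> C\<^sub>0 * \<rho>" using bound[OF _ a a, of 0 1] by simp
  then have \<rho>: "0 \<le> \<rho>" using assms(2) by (simp add: zero_le_mult_iff)
  \<comment> \<open>Kept away from 0, since r and later \<open>r ^ period N\<close> occur in
    denominators.\<close>
  define r where "r = max \<rho> (1/2)"
  have r: "0 < r" "r < 1" using assms(3) by (auto simp: r_def)
  have K: "1 \<le> C\<^sub>0 / r + 1" using r assms(2) by simp
  have "\<bar>chain_to ?A (A_hat N) k t p q - \<xi> (int k - 1) p\<bar> \<le> (C\<^sub>0 / r + 1) * r ^ (k - t)"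
    if t: "t \<le> k" and p: "p \<in> ?A" and q: "q \<in> ?A" for k t p q
  proof (cases "t = k")
    case True
    have "0 \<le> \<xi> (int k - 1) p" "\<xi> (int k - 1) p \<le> 1"
      using stoch[of k] p stochastic_vector_le_1[OF stoch finite_aug_nodes p]
      by (auto simp: stochastic_vector_def)
    moreover have "0 \<le> C\<^sub>0 / r" using r assms(2) by simp
    ultimately show ?thesis using True by (auto simp: chain_to_def)
  next
    case False
    with t obtain l where l: "k = Suc (t + l)" using less_imp_Suc_add[of t k] by auto
    have "\<bar>mat_chain ?A (A_hat N) t l p q - \<xi> (int (t + l)) p\<bar> \<le> C\<^sub>0 * \<rho> ^ l"
      using bound[OF _ p q, of t "t + l"] by simp
    also have "\<dots> \<le> C\<^sub>0 * r ^ l" using assms(2) \<rho> by (intro mult_left_mono power_mono) (auto simp: r_def)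
    also have "\<dots> = C\<^sub>0 / r * r ^ (k - t)" using r l by simp
    also have "\<dots> \<le> (C\<^sub>0 / r + 1) * r ^ (k - t)" using r by (intro mult_right_mono) auto
    finally show ?thesis using l by (simp add: chain_to_def)
  qed
  then show thesis using that \<rho> r K by blast
qed

text \<open>The window of length \<open>period N\<close> starting right after the last activation
  contains another one, which can only be at k or later; this bounds the age of the last
  activation.\<close>

lemma last_activation:
  assumes "j \<in> nodes N"
  obtains "k < period N" "\<And>t. t < k \<Longrightarrow> act t \<noteq> j"
  | t where "t < k" "k \<le> t + period N" "act t = j" "\<And>u. t < u \<Longrightarrow> u < k \<Longrightarrow> act u \<noteq> j"
proof (cases "\<exists>t<k. act t = j")
  case True
  define t where "t = Max {t. t < k \<and> act t = j}"
  have fin: "finite {t. t < k \<and> act t = j}" by simp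
  have t: "t < k" "act t = j" using Max_in[OF fin] True by (auto simp: t_def)
  have after: "act u \<noteq> j" if "t < u" "u < k" for u
  proof
    assume "act u = j"
    then have "u \<le> t" unfolding t_def using that by (intro Max_ge[OF fin]) simp
    then show False using that by simp
  qed
  obtain u where "u \<ge> Suc t" "u < Suc t + period N" "act u = j" using active_in_window[OF assms] by blast
  then have "k \<le> t + period N" using after[of u] by (cases "u < k") auto
  then show ?thesis using that(2) t after by blast
next
  case False
  obtain u where u: "u < period N" "act u = j" using active_in_window[OF assms, of 0] by auto
  then have "k < period N" using False by (cases "u < k") auto
  then show ?thesis using that(1) False by blast
qed

end

context async_run begin

text \<open>The defining sum telescopes, since the iterate of an agent changes only when that agent
  is active.\<close>

lemma z_bar_eq:
  assumes "i \<in> nodes N"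
  shows "z_bar N G T k i = G i (x_var T k i)"
proof (induction k)
  case (Suc k)
  let ?d = "\<lambda>t. G i (x_var T (Suc t) i) - G i (x_var T t i)"
  show ?case
  proof (cases "act k = i")
    case True
    then have "{t. t < Suc k \<and> act t = i} = insert k {t. t < k \<and> act t = i}"
      by (auto simp: less_Suc_eq)
    then have "z_bar N G T (Suc k) i = z_bar N G T k i + ?d k"
      by (simp add: z_bar_def)
    then show ?thesis using Suc by simp
  next
    case False
    then have "{t. t < Suc k \<and> act t = i} = {t. t < k \<and> act t = i}"
      by (auto simp: less_Suc_eq)
    then have "z_bar N G T (Suc k) i = z_bar N G T k i" by (simp add: z_bar_def)
    also have "\<dots> = G i (x_var T (Suc k) i)" using Suc step_inactive(1)[of i k] False assms by metis
    finally show ?thesis .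
  qed
qed (simp add: z_bar_def)

text \<open>
  Relative to exact gradients \<open>G\<close>, the last sampled gradient of an agent carries the error \<open>noise\<close> of
  its last activation, and \<open>init_noise\<close> if there was none.
\<close>

primrec noise :: "(nat \<Rightarrow> real ^ 'n \<Rightarrow> real ^ 'n) \<Rightarrow> nat \<Rightarrow> nat \<Rightarrow> real ^ 'n" where
  "noise G 0 = (\<lambda>j. 0)"
| "noise G (Suc k) = (\<lambda>j. if j = act k then g j (x_var T (Suc k) j) (s k) - G j (x_var T (Suc k) j)
     else noise G k j)"

definition init_noise :: "(nat \<Rightarrow> real ^ 'n \<Rightarrow> real ^ 'n) \<Rightarrow> nat \<Rightarrow> nat \<Rightarrow> real ^ 'n" where
  "init_noise G k j = last_grad k j - G j (x_var T k j) - noise G k j"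

lemma init_noise_Suc:
  assumes "j \<in> nodes N"
  shows "init_noise G (Suc k) j = (if j = act k then 0 else init_noise G k j)"
  using step_inactive(1)[of j k] assms by (auto simp: init_noise_def)

lemma norm_init_noise_le:
  assumes "j \<in> nodes N"
  shows "norm (init_noise G k j) \<le> norm (init_noise G 0 j)"
  by (induction k) (auto simp: init_noise_Suc[OF assms])

lemma noise_unchanged:
  assumes "t < k" "\<And>u. t < u \<Longrightarrow> u < k \<Longrightarrow> act u \<noteq> j"
  shows "noise G k j = noise G (Suc t) j"
proof -
  have "Suc t \<le> k" using assms(1) by simp
  then show ?thesis using assms(2)
  proof (induction k rule: dec_induct)
    case (step n)
    then have "act n \<noteq> j" by auto
    then have "noise G (Suc n) j = noise G n j" by auto
    with step show ?case by auto
  qed simp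
qed

lemma noise_before_activation:
  assumes "\<And>t. t < k \<Longrightarrow> act t \<noteq> j"
  shows "noise G k j = 0"
  using assms by (induction k) auto

text \<open>Every agent acts within the first period and then discards its initial sample. The
  initial errors can thus be lumped with the tracking error at the price of finitely many terms,
  without any orthogonality.\<close>

lemma init_noise_vanishes:
  assumes j: "j \<in> nodes N" and "period N \<le> k"
  shows "init_noise G k j = 0"
proof -
  obtain t where t: "t < period N" "act t = j" using active_in_window[OF j, of 0] by auto
  then have "Suc t \<le> k" using assms(2) by simp
  then show ?thesis
    by (induction k rule: dec_induct) (auto simp: init_noise_Suc[OF j] t)
qed

text \<open>Turns the part \<open>w k\<close> common to all propagation weights into
  \<open>w k\<close> times the current sum of sampled gradients.\<close>

lemma sum_last_grad:
  "(\<Sum>j\<in>nodes N. last_grad k j)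
     = (\<Sum>j\<in>nodes N. last_grad 0 j) + (\<Sum>t<k. last_grad (Suc t) (act t) - last_grad t (act t))"
proof (induction k)
  case (Suc k)
  have "(\<Sum>j\<in>nodes N. last_grad (Suc k) j - last_grad k j)
      = (\<Sum>j\<in>{act k}. last_grad (Suc k) j - last_grad k j)"
    by (rule sum.mono_neutral_right) (use active_node in auto)
  then show ?case using Suc by (simp add: sum_subtractf algebra_simps del: last_grad.simps)
qed simp

end

definition tracking_weight :: "async_network \<Rightarrow> (int \<Rightarrow> aug_node \<Rightarrow> real) \<Rightarrow> nat \<Rightarrow> real" where
  "tracking_weight N \<xi> k = \<xi> (int k - 1) (Agent (active N k))"

locale tracked_run = async_run N g \<gamma> s_init s T
  for N and g :: "nat \<Rightarrow> real ^ 'n \<Rightarrow> 'z \<Rightarrow> real ^ 'n" and \<gamma> s_init s and T :: "(real ^ 'n) trajectory" +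
  fixes \<xi> :: "int \<Rightarrow> aug_node \<Rightarrow> real" and r K \<Lambda> :: real and G :: "nat \<Rightarrow> real ^ 'n \<Rightarrow> real ^ 'n"
  assumes r: "0 < r" "r < 1" and K: "1 \<le> K"
    and stochastic: "\<And>k. stochastic_vector (aug_nodes N) (\<xi> (int k - 1))"
    and rate: "\<And>k t p q. t \<le> k \<Longrightarrow> p \<in> aug_nodes N \<Longrightarrow> q \<in> aug_nodes N \<Longrightarrow>
       \<bar>chain_to (aug_nodes N) (A_hat N) k t p q - \<xi> (int k - 1) p\<bar> \<le> K * r ^ (k - t)"
    and lipschitz: "\<And>i. i \<in> nodes N \<Longrightarrow> \<Lambda>-lipschitz_on UNIV (G i)"
begin

abbreviation "w \<equiv> tracking_weight N \<xi>"

text \<open>The share of a perturbation entered at time t whose place and time of entry have not yet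
  been forgotten at time k.\<close>

definition weight_gap :: "nat \<Rightarrow> nat \<Rightarrow> nat \<Rightarrow> real" where
  "weight_gap k t j = chain_to (aug_nodes N) (A_hat N) k t (Agent (act k)) (Agent j) - w k"

text \<open>Contribution of the sample errors to the active tracking variable: with the limit weight
  \<open>w k\<close> the increments of the errors telescope to the errors currently in use, the gaps
  keep the individual increments.\<close>

definition noise_part :: "nat \<Rightarrow> real ^ 'n" where
  "noise_part k = w k *\<^sub>R (\<Sum>j\<in>nodes N. noise G k j)
     + (\<Sum>t<k. weight_gap k t (act t) *\<^sub>R (noise G (Suc t) (act t) - noise G t (act t)))"

definition tracking_part :: "nat \<Rightarrow> real ^ 'n" where
  "tracking_part k = z_var T k (act k) - w k *\<^sub>R (\<Sum>j\<in>nodes N. G j (x_var T k j)) - noise_part k"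

lemma agent_in_aug: "j \<in> nodes N \<Longrightarrow> Agent j \<in> aug_nodes N"
  by (simp add: aug_nodes_def)

lemma weight: "0 \<le> w k" "w k \<le> 1"
  using stochastic[of k] stochastic_vector_le_1[OF stochastic finite_aug_nodes agent_in_aug[OF active_node]]
    agent_in_aug[OF active_node, of k]
  by (auto simp: tracking_weight_def stochastic_vector_def)

lemma weight_gap_le:
  assumes "t \<le> k" "j \<in> nodes N"
  shows "\<bar>weight_gap k t j\<bar> \<le> K * r ^ (k - t)"
  unfolding weight_gap_def tracking_weight_def
  by (intro rate assms agent_in_aug active_node)

text \<open>Each weight in \<open>z_var_eq\<close> is split into \<open>w k\<close> and a gap. The
  \<open>w k\<close>-parts add up to the current sampled gradients, that is exact gradients plus
  \<open>noise\<close> plus \<open>init_noise\<close>; removing the exact gradients and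
  \<open>noise_part\<close> leaves only initial errors and gaps acting on increments of exact
  gradients.\<close>

lemma tracking_part_eq:
  "tracking_part k = w k *\<^sub>R (\<Sum>j\<in>nodes N. init_noise G k j)
     + (\<Sum>q\<in>nodes N. weight_gap k 0 q *\<^sub>R last_grad 0 q)
     + (\<Sum>t<k. weight_gap k t (act t) *\<^sub>R
          (G (act t) (x_var T (Suc t) (act t)) - G (act t) (x_var T t (act t)) - init_noise G t (act t)))"
proof -
  let ?d = "\<lambda>t. last_grad (Suc t) (act t) - last_grad t (act t)"
  let ?e = "\<lambda>t. noise G (Suc t) (act t) - noise G t (act t)"
  let ?g = "\<lambda>t. G (act t) (x_var T (Suc t) (act t)) - G (act t) (x_var T t (act t)) - init_noise G t (act t)"
  \<comment> \<open>Activation at t erases the initial error of the agent, which therefore enters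
    the increment with a minus sign.\<close>
  have d: "?d t = ?e t + ?g t" for t
    using init_noise_Suc[OF active_node, of G t t] by (simp add: init_noise_def[of G])
  have y: "last_grad k j = G j (x_var T k j) + noise G k j + init_noise G k j" for j
    by (simp add: init_noise_def)
  have "z_var T k (act k) = (\<Sum>q\<in>nodes N. (weight_gap k 0 q + w k) *\<^sub>R last_grad 0 q)
      + (\<Sum>t<k. (weight_gap k t (act t) + w k) *\<^sub>R ?d t)"
    unfolding z_var_eq[OF active_node, of k k] weight_gap_def by simp
  also have "\<dots> = w k *\<^sub>R (\<Sum>j\<in>nodes N. last_grad k j) + (\<Sum>q\<in>nodes N. weight_gap k 0 q *\<^sub>R last_grad 0 q)
      + (\<Sum>t<k. weight_gap k t (act t) *\<^sub>R ?d t)"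
    unfolding sum_last_grad[of k]
    by (simp add: scaleR_add_left scaleR_add_right sum.distrib scaleR_right.sum del: last_grad.simps)
  finally show ?thesis
    unfolding tracking_part_def noise_part_def d y
    by (simp add: scaleR_add_right sum.distrib del: last_grad.simps noise.simps)
qed

text \<open>Size of everything but sample errors that is fed into the tracking system at time t; the
  starting values count as an input at time 0.\<close>

definition drive :: "nat \<Rightarrow> real" where
  "drive t = \<Lambda> * norm (x_var T (Suc t) (act t) - x_var T t (act t)) + (\<Sum>j\<in>nodes N. norm (init_noise G t j))
     + (if t = 0 then \<Sum>q\<in>nodes N. norm (last_grad 0 q) else 0)"

lemma \<Lambda>_nonneg: "0 \<le> \<Lambda>"
  using lipschitz_on_nonneg[OF lipschitz[OF active_node]] .

lemma norm_tracking_part_le: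
  "norm (tracking_part k) \<le> K * (\<Sum>t\<le>k. r ^ (k - t) * drive t)"
proof -
  let ?\<iota> = "\<lambda>t. \<Sum>j\<in>nodes N. norm (init_noise G t j)" and ?Y = "\<Sum>q\<in>nodes N. norm (last_grad 0 q)"
  let ?x = "\<lambda>t. \<Lambda> * norm (x_var T (Suc t) (act t) - x_var T t (act t))"
  have rp: "0 \<le> r ^ n" for n using r by simp
  have 1: "norm (w k *\<^sub>R (\<Sum>j\<in>nodes N. init_noise G k j)) \<le> K * ?\<iota> k"
  proof -
    have "norm (w k *\<^sub>R (\<Sum>j\<in>nodes N. init_noise G k j)) \<le> 1 * ?\<iota> k"
      unfolding norm_scaleR using weight[of k] by (intro mult_mono norm_sum) auto
    also have "\<dots> \<le> K * ?\<iota> k" using K by (intro mult_right_mono) (auto intro: sum_nonneg)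
    finally show ?thesis .
  qed
  have 2: "norm (\<Sum>q\<in>nodes N. weight_gap k 0 q *\<^sub>R last_grad 0 q) \<le> K * (r ^ k * ?Y)"
    unfolding sum_distrib_left mult.assoc[symmetric]
    by (rule sum_norm_le) (use weight_gap_le[of 0 k] in \<open>auto intro!: mult_right_mono\<close>)
  have 3: "norm (\<Sum>t<k. weight_gap k t (act t) *\<^sub>R
      (G (act t) (x_var T (Suc t) (act t)) - G (act t) (x_var T t (act t)) - init_noise G t (act t)))
      \<le> (\<Sum>t<k. K * (r ^ (k - t) * (?x t + ?\<iota> t)))"
  proof (rule sum_norm_le)
    fix t assume "t \<in> {..<k}"
    then have t: "\<bar>weight_gap k t (act t)\<bar> \<le> K * r ^ (k - t)"
      by (intro weight_gap_le active_node) auto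
    have "norm (G (act t) (x_var T (Suc t) (act t)) - G (act t) (x_var T t (act t)) - init_noise G t (act t))
       \<le> norm (G (act t) (x_var T (Suc t) (act t)) - G (act t) (x_var T t (act t))) + norm (init_noise G t (act t))"
      by (rule norm_triangle_ineq4)
    also have "\<dots> \<le> ?x t + ?\<iota> t"
    proof (rule add_mono)
      show "norm (G (act t) (x_var T (Suc t) (act t)) - G (act t) (x_var T t (act t))) \<le> ?x t"
        using lipschitz_onD[OF lipschitz[OF active_node]] by (simp add: dist_norm)
      show "norm (init_noise G t (act t)) \<le> ?\<iota> t" by (rule member_le_sum) (auto simp: active_node)
    qed
    finally show "norm (weight_gap k t (act t) *\<^sub>R (G (act t) (x_var T (Suc t) (act t))
        - G (act t) (x_var T t (act t)) - init_noise G t (act t))) \<le> K * (r ^ (k - t) * (?x t + ?\<iota> t))"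
      unfolding norm_scaleR mult.assoc[symmetric] using t rp K by (intro mult_mono) auto
  qed
  have drive: "?x t + ?\<iota> t \<le> drive t" "?\<iota> t \<le> drive t" for t
    unfolding drive_def using \<Lambda>_nonneg by (auto intro!: sum_nonneg add_nonneg_nonneg)
  have "norm (tracking_part k) \<le> K * ?\<iota> k + K * (r ^ k * ?Y) + (\<Sum>t<k. K * (r ^ (k - t) * (?x t + ?\<iota> t)))"
    unfolding tracking_part_eq by (intro norm_triangle_le add_mono 1 2 3)
  also have "\<dots> = K * (?\<iota> k + r ^ k * ?Y + (\<Sum>t<k. r ^ (k - t) * (?x t + ?\<iota> t)))"
    by (simp add: distrib_left sum_distrib_left)
  also have "\<dots> \<le> K * (\<Sum>t\<le>k. r ^ (k - t) * drive t)"
  proof (rule mult_left_mono)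
    \<comment> \<open>At t = k only the initial errors contribute, and the starting values have
      weight r ^ k, as an input at t = 0 does. The missing movement term at t = k is then added as
      slack.\<close>
    have "?\<iota> k + r ^ k * ?Y + (\<Sum>t<k. r ^ (k - t) * (?x t + ?\<iota> t))
       = (\<Sum>t\<le>k. r ^ (k - t) * ((if t < k then ?x t else 0) + ?\<iota> t + (if t = 0 then ?Y else 0)))"
    proof -
      have "(\<Sum>t\<le>k. r ^ (k - t) * (if t = 0 then ?Y else 0)) = r ^ k * ?Y"
        by (simp add: if_distrib[of "\<lambda>x. _ * x"] sum.delta cong: if_cong)
      moreover have "(\<Sum>t\<le>k. r ^ (k - t) * ((if t < k then ?x t else 0) + ?\<iota> t))
          = ?\<iota> k + (\<Sum>t<k. r ^ (k - t) * (?x t + ?\<iota> t))"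
        by (simp add: lessThan_Suc_atMost[symmetric])
      ultimately show ?thesis by (simp add: distrib_left sum.distrib)
    qed
    also have "\<dots> \<le> (\<Sum>t\<le>k. r ^ (k - t) * drive t)"
      unfolding drive_def using rp \<Lambda>_nonneg by (intro sum_mono mult_left_mono) auto
    finally show "?\<iota> k + r ^ k * ?Y + (\<Sum>t<k. r ^ (k - t) * (?x t + ?\<iota> t)) \<le> (\<Sum>t\<le>k. r ^ (k - t) * drive t)" .
  qed (use K in simp)
  finally show ?thesis .
qed

text \<open>A mere size estimate, for the second moment of the direction; it gains no power of the
  step size.\<close>

lemma norm_noise_part_le:
  "norm (noise_part k) \<le> K * (\<Sum>t\<le>k. r ^ (k - t) * (\<Sum>j\<in>nodes N. norm (noise G t j) + norm (noise G (Suc t) j)))"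
proof -
  let ?W = "\<lambda>t. \<Sum>j\<in>nodes N. norm (noise G t j) + norm (noise G (Suc t) j)"
  have W: "norm (noise G (Suc t) (act t) - noise G t (act t)) \<le> ?W t" for t
  proof -
    have "norm (noise G (Suc t) (act t) - noise G t (act t)) \<le> norm (noise G t (act t)) + norm (noise G (Suc t) (act t))"
      using norm_triangle_ineq4[of "noise G (Suc t) (act t)" "noise G t (act t)"] by linarith
    also have "\<dots> \<le> ?W t"
      by (rule member_le_sum[where f = "\<lambda>j. norm (noise G t j) + norm (noise G (Suc t) j)"])
        (auto simp: active_node simp del: noise.simps)
    finally show ?thesis .
  qed
  have "norm (w k *\<^sub>R (\<Sum>j\<in>nodes N. noise G k j)) \<le> K * (\<Sum>j\<in>nodes N. norm (noise G k j))"
    unfolding norm_scaleR using weight[of k] K by (intro mult_mono norm_sum) auto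
  also have "\<dots> \<le> K * ?W k" using K by (intro mult_left_mono sum_mono) auto
  finally have 1: "norm (w k *\<^sub>R (\<Sum>j\<in>nodes N. noise G k j)) \<le> K * ?W k" .
  have 2: "norm (\<Sum>t<k. weight_gap k t (act t) *\<^sub>R (noise G (Suc t) (act t) - noise G t (act t)))
      \<le> (\<Sum>t<k. K * (r ^ (k - t) * ?W t))"
  proof (rule sum_norm_le)
    fix t assume "t \<in> {..<k}"
    then have "\<bar>weight_gap k t (act t)\<bar> \<le> K * r ^ (k - t)" by (intro weight_gap_le active_node) auto
    then show "norm (weight_gap k t (act t) *\<^sub>R (noise G (Suc t) (act t) - noise G t (act t)))
      \<le> K * (r ^ (k - t) * ?W t)"
      unfolding norm_scaleR mult.assoc[symmetric] using W[of t] r K by (intro mult_mono) auto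
  qed
  have "norm (noise_part k) \<le> K * ?W k + (\<Sum>t<k. K * (r ^ (k - t) * ?W t))"
    unfolding noise_part_def by (intro norm_triangle_le add_mono 1 2)
  also have "\<dots> = K * (\<Sum>t\<le>k. r ^ (k - t) * ?W t)"
    by (simp add: lessThan_Suc_atMost[symmetric] sum_distrib_left distrib_left del: noise.simps)
  finally show ?thesis .
qed

end

section \<open>Squares of convolutions with a geometric kernel\<close>

lemma geometric_convolution_square:
  fixes a :: "nat \<Rightarrow> real" and r :: real
  assumes "0 < r" "r < 1"
  shows "(\<Sum>t\<le>k. r ^ (k - t) * a t)\<^sup>2 \<le> 1 / (1 - r) * (\<Sum>t\<le>k. r ^ (k - t) * (a t)\<^sup>2)"
proof -
  have "(\<Sum>t\<le>k. r ^ (k - t) * a t) = (\<Sum>t\<le>k. sqrt (r ^ (k - t)) * (sqrt (r ^ (k - t)) * a t))"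
    using assms by (intro sum.cong) (auto simp: mult.assoc[symmetric] real_sqrt_mult_self)
  also have "\<dots>\<^sup>2 \<le> (\<Sum>t\<le>k. (sqrt (r ^ (k - t)))\<^sup>2) * (\<Sum>t\<le>k. (sqrt (r ^ (k - t)) * a t)\<^sup>2)"
    by (rule Cauchy_Schwarz_ineq_sum)
  also have "\<dots> = (\<Sum>t\<le>k. r ^ (k - t)) * (\<Sum>t\<le>k. r ^ (k - t) * (a t)\<^sup>2)"
    using assms by (simp add: power_mult_distrib)
  also have "\<dots> \<le> 1 / (1 - r) * (\<Sum>t\<le>k. r ^ (k - t) * (a t)\<^sup>2)"
    using sum_geometric_le(2)[OF assms] assms by (intro mult_right_mono sum_nonneg) auto
  finally show ?thesis .
qed

text \<open>Young's inequality for a summable kernel acting on square-summable sequences: one factor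
  1 / (1 - r) comes from the Cauchy-Schwarz inequality with the kernel split into square roots, the
  other from summing the kernel after exchanging the sums.\<close>

lemma sum_geometric_convolution_square:
  fixes a :: "nat \<Rightarrow> real" and r :: real
  assumes "0 < r" "r < 1"
  shows "(\<Sum>k\<le>n. (\<Sum>t\<le>k. r ^ (k - t) * a t)\<^sup>2) \<le> (1 / (1 - r))\<^sup>2 * (\<Sum>t\<le>n. (a t)\<^sup>2)"
proof -
  have R: "0 < 1 / (1 - r)" using assms by simp
  have "(\<Sum>k\<le>n. \<Sum>t\<le>k. r ^ (k - t) * (a t)\<^sup>2)
      = (\<Sum>k\<le>n. \<Sum>t | t \<in> {..n} \<and> t \<le> k. r ^ (k - t) * (a t)\<^sup>2)"
    by (intro sum.cong refl) auto
  also have "\<dots> = (\<Sum>t\<le>n. \<Sum>k | k \<in> {..n} \<and> t \<le> k. r ^ (k - t) * (a t)\<^sup>2)"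
    by (rule sum.swap_restrict) auto
  also have "\<dots> \<le> (\<Sum>t\<le>n. 1 / (1 - r) * (a t)\<^sup>2)"
  proof (rule sum_mono)
    fix t
    have "(\<Sum>k | k \<in> {..n} \<and> t \<le> k. r ^ (k - t)) = (\<Sum>j\<in>(\<lambda>k. k - t) ` {k. k \<in> {..n} \<and> t \<le> k}. r ^ j)"
      by (subst sum.reindex) (auto simp: inj_on_def)
    also have "\<dots> \<le> 1 / (1 - r)" by (rule sum_powers_le[OF assms]) simp
    finally show "(\<Sum>k | k \<in> {..n} \<and> t \<le> k. r ^ (k - t) * (a t)\<^sup>2) \<le> 1 / (1 - r) * (a t)\<^sup>2"
      unfolding sum_distrib_right[symmetric] by (rule mult_right_mono) simp
  qed
  finally have double: "(\<Sum>k\<le>n. \<Sum>t\<le>k. r ^ (k - t) * (a t)\<^sup>2) \<le> 1 / (1 - r) * (\<Sum>t\<le>n. (a t)\<^sup>2)"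
    by (simp only: sum_distrib_left)
  have "(\<Sum>k\<le>n. (\<Sum>t\<le>k. r ^ (k - t) * a t)\<^sup>2) \<le> (\<Sum>k\<le>n. 1 / (1 - r) * (\<Sum>t\<le>k. r ^ (k - t) * (a t)\<^sup>2))"
    by (intro sum_mono geometric_convolution_square assms)
  also have "\<dots> = 1 / (1 - r) * (\<Sum>k\<le>n. \<Sum>t\<le>k. r ^ (k - t) * (a t)\<^sup>2)" by (simp only: sum_distrib_left)
  also have "\<dots> \<le> 1 / (1 - r) * (1 / (1 - r) * (\<Sum>t\<le>n. (a t)\<^sup>2))"
    by (rule mult_left_mono[OF double]) (use R in simp)
  finally show ?thesis by (simp add: power2_eq_square mult.assoc)
qed

section \<open>Expected costs and their gradients\<close>

text \<open>\<open>grad\<close> is a definite description, so the gradient must be shown to exist,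
  as the Riesz vector \<open>adjoint f' 1\<close>, and to be unique.\<close>

lemma GDERIV_grad:
  assumes "f differentiable (at x)"
  shows "GDERIV f x :> grad f x"
proof -
  obtain f' where f': "(f has_derivative f') (at x)" using assms by (auto simp: differentiable_def)
  then have "linear f'" by (rule has_derivative_linear)
  then have "f' = (\<lambda>h. inner h (adjoint f' 1))" by (simp add: adjoint_works fun_eq_iff)
  with f' have g: "GDERIV f x :> adjoint f' 1" by (simp add: gderiv_def)
  have "D = adjoint f' 1" if "GDERIV f x :> D" for D
  proof -
    have "(\<lambda>h. inner h D) = (\<lambda>h. inner h (adjoint f' 1))"
      using that g unfolding gderiv_def by (rule has_derivative_unique)
    then show ?thesis by (metis vector_eq_rdot inner_commute)
  qed
  with g show ?thesis unfolding grad_def by (rule theI)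
qed

lemma grad_eqI:
  assumes "GDERIV f x :> D"
  shows "grad f x = D"
proof -
  have "GDERIV f x :> grad f x"
    using assms by (intro GDERIV_grad) (auto simp: gderiv_def differentiable_def)
  then have "(\<lambda>h. inner h D) = (\<lambda>h. inner h (grad f x))"
    using assms unfolding gderiv_def by (metis has_derivative_unique)
  then show ?thesis by (metis vector_eq_rdot inner_commute)
qed

text \<open>Mean value theorem along the segment. It yields L in place of L/2, which only affects
  later constants.\<close>

lemma gradient_remainder_le:
  fixes f :: "real ^ 'n \<Rightarrow> real"
  assumes d: "\<And>x. f differentiable (at x)" and L: "L-lipschitz_on UNIV (grad f)"
  shows "\<bar>f y - f x - inner (grad f x) (y - x)\<bar> \<le> L * (norm (y - x))\<^sup>2"
proof -
  define \<phi> where "\<phi> t = f (x + t *\<^sub>R (y - x))" for t :: real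
  have der: "(\<phi> has_real_derivative inner (grad f (x + t *\<^sub>R (y - x))) (y - x)) (at t)" for t
  proof -
    have f: "(f has_derivative (\<lambda>h. inner h (grad f (x + t *\<^sub>R (y - x))))) (at (x + t *\<^sub>R (y - x)))"
      using GDERIV_grad[OF d] by (simp add: gderiv_def)
    have line: "((\<lambda>t. x + t *\<^sub>R (y - x)) has_derivative (\<lambda>s. s *\<^sub>R (y - x))) (at t)"
      by (auto intro!: derivative_eq_intros)
    have "(\<phi> has_derivative (\<lambda>s. inner (s *\<^sub>R (y - x)) (grad f (x + t *\<^sub>R (y - x))))) (at t)"
      unfolding \<phi>_def by (rule has_derivative_compose[OF line f])
    then show ?thesis
      unfolding has_field_derivative_def
      by (rule has_derivative_eq_rhs) (simp add: fun_eq_iff inner_commute mult.commute)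
  qed
  obtain t where t: "0 < t" "t < 1" "\<phi> 1 - \<phi> 0 = (1 - 0) * inner (grad f (x + t *\<^sub>R (y - x))) (y - x)"
    using MVT2[of 0 1 \<phi> "\<lambda>t. inner (grad f (x + t *\<^sub>R (y - x))) (y - x)"] der by auto
  have "f y - f x - inner (grad f x) (y - x) = inner (grad f (x + t *\<^sub>R (y - x)) - grad f x) (y - x)"
    using t(3) by (simp add: \<phi>_def inner_diff_left)
  also have "\<bar>\<dots>\<bar> \<le> norm (grad f (x + t *\<^sub>R (y - x)) - grad f x) * norm (y - x)"
    by (rule Cauchy_Schwarz_ineq2)
  also have "\<dots> \<le> (L * norm (t *\<^sub>R (y - x))) * norm (y - x)"
    using lipschitz_onD[OF L, of "x + t *\<^sub>R (y - x)" x] by (intro mult_right_mono) (auto simp: dist_norm)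
  also have "\<dots> \<le> (L * norm (y - x)) * norm (y - x)"
    using t lipschitz_on_nonneg[OF L] by (intro mult_right_mono mult_left_mono) (auto intro: mult_left_le_one_le)
  finally show ?thesis by (simp add: power2_eq_square mult.assoc)
qed

text \<open>A gradient step of length 1 / (2 (L + 1)) decreases f by at least a quarter of the
  squared gradient divided by L + 1, and f cannot fall below b. Using L + 1 avoids a division by
  zero for L = 0.\<close>

lemma grad_square_le_gap:
  fixes f :: "real ^ 'n \<Rightarrow> real"
  assumes d: "\<And>x. f differentiable (at x)" and L: "L-lipschitz_on UNIV (grad f)" and b: "\<And>x. b \<le> f x"
  shows "(norm (grad f x))\<^sup>2 \<le> 4 * (L + 1) * (f x - b)"
proof -
  define s where "s = 1 / (2 * (L + 1))"
  have L0: "0 \<le> L" using lipschitz_on_nonneg[OF L] .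
  have s: "0 < s" "L * s \<le> 1/2" using L0 by (auto simp: s_def field_simps)
  define y where "y = x - s *\<^sub>R grad f x"
  have "b \<le> f y" by (rule b)
  also have "f y \<le> f x + inner (grad f x) (y - x) + L * (norm (y - x))\<^sup>2"
    using gradient_remainder_le[OF d L, of y x] by linarith
  also have "\<dots> = f x - s * (norm (grad f x))\<^sup>2 * (1 - L * s)"
    using s by (simp add: y_def power_mult_distrib dot_square_norm power2_eq_square algebra_simps)
  also have "\<dots> \<le> f x - s * (norm (grad f x))\<^sup>2 * (1/2)"
    using s by (intro diff_left_mono mult_left_mono) auto
  finally have "s * (norm (grad f x))\<^sup>2 \<le> 2 * (f x - b)" by simp
  then show ?thesis using L0 by (simp add: s_def field_simps)
qed

lemma GDERIV_if_quadratic_remainder: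
  fixes f :: "'a::real_inner \<Rightarrow> real"
  assumes "\<And>y. \<bar>f y - f x - inner D (y - x)\<bar> \<le> L * (norm (y - x))\<^sup>2"
  shows "GDERIV f x :> D"
  unfolding gderiv_def has_derivative_at
proof (intro conjI)
  show "bounded_linear (\<lambda>h. inner h D)" by (rule bounded_linear_inner_left)
  show "(\<lambda>h. norm (f (x + h) - f x - inner h D) / norm h) \<midarrow>0\<rightarrow> 0"
  proof (rule Lim_null_comparison)
    show "\<forall>\<^sub>F h in at 0. norm (norm (f (x + h) - f x - inner h D) / norm h) \<le> L * norm h"
    proof (rule eventually_at_filter[THEN iffD2], rule always_eventually, intro allI impI)
      fix h :: 'a assume "h \<noteq> 0"
      then show "norm (norm (f (x + h) - f x - inner h D) / norm h) \<le> L * norm h"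
        using assms[of "x + h"] by (simp add: inner_commute divide_le_eq power2_eq_square mult.assoc)
    qed
    show "((\<lambda>h. L * norm h) \<longlongrightarrow> 0) (at 0)" by (intro tendsto_eq_intros) auto
  qed
qed

section \<open>Differentiation of the expected costs\<close>

locale stochastic_problem = prob_space P for P :: "'z measure" +
  fixes m :: nat and f :: "nat \<Rightarrow> real ^ 'n \<Rightarrow> 'z \<Rightarrow> real" and Li :: "nat \<Rightarrow> real"
  assumes problem: "valid_problem P m f Li"
begin

lemma integrable_cost: "i \<in> {1..m} \<Longrightarrow> integrable P (f i x)"
  and sample_grad_measurable:
    "i \<in> {1..m} \<Longrightarrow> (\<lambda>(x, \<zeta>). sample_grad f i x \<zeta>) \<in> borel_measurable (borel \<Otimes>\<^sub>M P)"
  and AE_smooth: "i \<in> {1..m} \<Longrightarrow> AE \<zeta> in P. C1_lipschitz_grad (Li i) (\<lambda>x. f i x \<zeta>)"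
  using problem by (auto simp: valid_problem_def)

lemma lipschitz_constant_nonneg: "i \<in> {1..m} \<Longrightarrow> 0 \<le> Li i"
proof -
  assume i: "i \<in> {1..m}"
  have "AE \<zeta> in P. 0 \<le> Li i"
    using AE_smooth[OF i] by (rule eventually_mono) (auto simp: C1_lipschitz_grad_def dest: lipschitz_on_nonneg)
  then show "0 \<le> Li i" by simp
qed

lemma AE_remainder:
  assumes i: "i \<in> {1..m}"
  shows "AE \<zeta> in P. \<bar>f i y \<zeta> - f i x \<zeta> - inner (sample_grad f i x \<zeta>) (y - x)\<bar> \<le> Li i * (norm (y - x))\<^sup>2"
  using AE_smooth[OF i]
  by eventually_elim (auto simp: C1_lipschitz_grad_def sample_grad_def intro!: gradient_remainder_le)

lemma sample_grad_measurable': "i \<in> {1..m} \<Longrightarrow> sample_grad f i x \<in> borel_measurable P"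
  using measurable_compose[OF measurable_Pair1' sample_grad_measurable, of x] by simp

text \<open>Integrability is given for the costs only. By the quadratic remainder, the partial
  derivative in direction c differs from the difference of the costs at x + e_c and x by at most
  \<open>Li i\<close>, so finitely many costs dominate the gradient.\<close>

lemma integrable_sample_grad:
  assumes i: "i \<in> {1..m}"
  shows "integrable P (sample_grad f i x)"
proof (rule Bochner_Integration.integrable_bound)
  let ?b = "\<lambda>\<zeta>. \<Sum>c\<in>UNIV. \<bar>f i (x + axis c 1) \<zeta>\<bar> + \<bar>f i x \<zeta>\<bar> + Li i"
  show "integrable P ?b" using integrable_cost[OF i] by auto
  show "sample_grad f i x \<in> borel_measurable P" by (rule sample_grad_measurable'[OF i])
  have "AE \<zeta> in P. \<forall>c\<in>UNIV. \<bar>f i (x + axis c 1) \<zeta> - f i x \<zeta> - inner (sample_grad f i x \<zeta>) (axis c 1)\<bar> \<le> Li i"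
    using AE_remainder[OF i, of "x + axis _ 1" x] by (intro AE_finite_allI) (auto simp: norm_axis_1)
  then show "AE \<zeta> in P. norm (sample_grad f i x \<zeta>) \<le> norm (?b \<zeta>)"
  proof eventually_elim
    case (elim \<zeta>)
    have "norm (sample_grad f i x \<zeta>) \<le> (\<Sum>c\<in>UNIV. \<bar>sample_grad f i x \<zeta> $ c\<bar>)" by (rule norm_le_l1_cart)
    also have "\<dots> \<le> ?b \<zeta>"
    proof (rule sum_mono)
      fix c show "\<bar>sample_grad f i x \<zeta> $ c\<bar> \<le> \<bar>f i (x + axis c 1) \<zeta>\<bar> + \<bar>f i x \<zeta>\<bar> + Li i"
        using elim[rule_format, of c] by (simp add: inner_axis)
    qed
    finally show ?case by simp
  qed
qed

text \<open>Differentiation under the integral without a limit theorem: the quadratic remainder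
  bound holds almost surely with a deterministic constant, so it can be integrated, and it
  characterises the gradient.\<close>

lemma GDERIV_mean_cost:
  assumes i: "i \<in> {1..m}"
  shows "GDERIV (mean_cost P f i) x :> (\<integral>\<zeta>. sample_grad f i x \<zeta> \<partial>P)"
proof (rule GDERIV_if_quadratic_remainder)
  fix y
  let ?r = "\<lambda>\<zeta>. f i y \<zeta> - f i x \<zeta> - inner (sample_grad f i x \<zeta>) (y - x)"
  note int = integrable_cost[OF i] integrable_sample_grad[OF i]
  have "mean_cost P f i y - mean_cost P f i x - inner (\<integral>\<zeta>. sample_grad f i x \<zeta> \<partial>P) (y - x) = (\<integral>\<zeta>. ?r \<zeta> \<partial>P)"
    using int by (simp add: mean_cost_def)
  also have "\<bar>\<dots>\<bar> \<le> (\<integral>\<zeta>. \<bar>?r \<zeta>\<bar> \<partial>P)" by (rule integral_abs_bound)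
  also have "\<dots> \<le> (\<integral>\<zeta>. Li i * (norm (y - x))\<^sup>2 \<partial>P)"
    by (rule integral_mono_AE) (use int AE_remainder[OF i] in auto)
  also have "\<dots> = Li i * (norm (y - x))\<^sup>2" using prob_space by simp
  finally show "\<bar>mean_cost P f i y - mean_cost P f i x - inner (\<integral>\<zeta>. sample_grad f i x \<zeta> \<partial>P) (y - x)\<bar>
      \<le> Li i * (norm (y - x))\<^sup>2" .
qed

lemma true_grad_eq: "i \<in> {1..m} \<Longrightarrow> true_grad P f i x = (\<integral>\<zeta>. sample_grad f i x \<zeta> \<partial>P)"
  unfolding true_grad_def by (rule grad_eqI) (rule GDERIV_mean_cost)

lemma true_grad_lipschitz:
  assumes i: "i \<in> {1..m}"
  shows "(Li i)-lipschitz_on UNIV (true_grad P f i)"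
proof (rule lipschitz_onI)
  fix x y
  note int = integrable_sample_grad[OF i]
  have "norm (true_grad P f i x - true_grad P f i y) = norm (\<integral>\<zeta>. sample_grad f i x \<zeta> - sample_grad f i y \<zeta> \<partial>P)"
    using int by (simp add: true_grad_eq[OF i])
  also have "\<dots> \<le> (\<integral>\<zeta>. norm (sample_grad f i x \<zeta> - sample_grad f i y \<zeta>) \<partial>P)" by (rule integral_norm_bound)
  also have "\<dots> \<le> (\<integral>\<zeta>. Li i * norm (x - y) \<partial>P)"
  proof (rule integral_mono_AE)
    show "AE \<zeta> in P. norm (sample_grad f i x \<zeta> - sample_grad f i y \<zeta>) \<le> Li i * norm (x - y)"
      using AE_smooth[OF i] by eventually_elim
        (auto simp: C1_lipschitz_grad_def sample_grad_def dist_norm[symmetric] intro!: lipschitz_onD)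
  qed (use int in auto)
  also have "\<dots> = Li i * norm (x - y)" using prob_space by simp
  finally show "dist (true_grad P f i x) (true_grad P f i y) \<le> Li i * dist x y" by (simp add: dist_norm)
qed (rule lipschitz_constant_nonneg[OF i])

lemma total_cost_eq: "total_cost P m f x = (\<Sum>i=1..m. mean_cost P f i x)"
  unfolding total_cost_def sample_total_def mean_cost_def
  by (rule Bochner_Integration.integral_sum) (rule integrable_cost)

lemma GDERIV_total_cost: "GDERIV (total_cost P m f) x :> (\<Sum>i=1..m. true_grad P f i x)"
proof -
  have "((\<lambda>x. \<Sum>i=1..m. mean_cost P f i x) has_derivative (\<lambda>h. \<Sum>i=1..m. inner h (true_grad P f i x))) (at x)"
    by (rule has_derivative_sum) (use GDERIV_mean_cost in \<open>auto simp: gderiv_def true_grad_eq\<close>)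
  then show ?thesis by (simp add: gderiv_def total_cost_eq[abs_def] inner_sum_right)
qed

lemma grad_total_cost: "grad (total_cost P m f) x = (\<Sum>i=1..m. true_grad P f i x)"
  by (rule grad_eqI[OF GDERIV_total_cost])

lemma total_cost_differentiable: "total_cost P m f differentiable (at x)"
  using GDERIV_total_cost[of x] by (auto simp: gderiv_def differentiable_def)

lemma total_cost_bounded_below: "\<exists>b. \<forall>x. b \<le> total_cost P m f x"
proof -
  obtain b where b: "integrable P b" "AE \<zeta> in P. \<forall>x. b \<zeta> \<le> sample_total m f x \<zeta>"
    using problem by (auto simp: valid_problem_def)
  have "(\<integral>\<zeta>. b \<zeta> \<partial>P) \<le> total_cost P m f x" for x
    unfolding total_cost_def
  proof (rule integral_mono_AE[OF b(1)])
    show "integrable P (sample_total m f x)"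
      unfolding sample_total_def[abs_def] using integrable_cost by auto
    show "AE \<zeta> in P. b \<zeta> \<le> sample_total m f x \<zeta>" using b(2) by eventually_elim auto
  qed
  then show ?thesis by blast
qed

end

section \<open>Adaptedness and orthogonality of the sample errors\<close>

lemma norm_add_square_le:
  fixes x y :: "'a::real_normed_vector"
  shows "(norm (x + y))\<^sup>2 \<le> 2 * (norm x)\<^sup>2 + 2 * (norm y)\<^sup>2"
proof -
  have "(norm (x + y))\<^sup>2 \<le> (norm x + norm y)\<^sup>2" by (intro power_mono norm_triangle_ineq) simp
  then show ?thesis using sum_squares_bound[of "norm x" "norm y"] by (simp add: power2_sum)
qed

lemma square_sum_le:
  fixes a :: "'i \<Rightarrow> real"
  shows "(\<Sum>i\<in>I. a i)\<^sup>2 \<le> real (card I) * (\<Sum>i\<in>I. (a i)\<^sup>2)"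
  using Cauchy_Schwarz_ineq_sum[of "\<lambda>_. 1" a I] by simp

text \<open>Integrability refers to M, measurability to a possibly smaller sigma-algebra A. With A a
  history this expresses being adapted and square integrable at once.\<close>

definition sq_integrable :: "'a measure \<Rightarrow> 'a measure \<Rightarrow> ('a \<Rightarrow> 'b::euclidean_space) \<Rightarrow> bool" where
  "sq_integrable M A X \<longleftrightarrow> X \<in> borel_measurable A \<and> integrable M (\<lambda>\<omega>. (norm (X \<omega>))\<^sup>2)"

lemma sq_integrable_cong:
  assumes "space A = space M" "\<And>\<omega>. \<omega> \<in> space M \<Longrightarrow> X \<omega> = Y \<omega>"
  shows "sq_integrable M A X = sq_integrable M A Y"
proof -
  have "X \<in> borel_measurable A \<longleftrightarrow> Y \<in> borel_measurable A" using assms by (intro measurable_cong) auto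
  moreover have "integrable M (\<lambda>\<omega>. (norm (X \<omega>))\<^sup>2) \<longleftrightarrow> integrable M (\<lambda>\<omega>. (norm (Y \<omega>))\<^sup>2)"
    using assms by (intro Bochner_Integration.integrable_cong) auto
  ultimately show ?thesis by (simp add: sq_integrable_def)
qed

context
  fixes M A :: "'a measure"
  assumes sub: "subalgebra M A"
begin

lemma sq_integrable_measurable: "sq_integrable M A X \<Longrightarrow> X \<in> borel_measurable M"
  using measurable_from_subalg[OF sub] by (auto simp: sq_integrable_def)

lemma sq_integrable_bound:
  assumes "X \<in> borel_measurable A" "integrable M b" "\<And>\<omega>. \<omega> \<in> space M \<Longrightarrow> (norm (X \<omega>))\<^sup>2 \<le> b \<omega>"
  shows "sq_integrable M A X"
  unfolding sq_integrable_def
proof (intro conjI)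
  have [measurable]: "X \<in> borel_measurable M" using measurable_from_subalg[OF sub assms(1)] .
  show "integrable M (\<lambda>\<omega>. (norm (X \<omega>))\<^sup>2)"
  proof (rule Bochner_Integration.integrable_bound[OF assms(2)])
    show "AE \<omega> in M. norm ((norm (X \<omega>))\<^sup>2) \<le> norm (b \<omega>)"
    proof (rule AE_I2)
      fix \<omega> assume "\<omega> \<in> space M"
      then show "norm ((norm (X \<omega>))\<^sup>2) \<le> norm (b \<omega>)" using assms(3)[of \<omega>] by simp
    qed
  qed simp
qed (rule assms(1))

lemma sq_integrable_zero: "sq_integrable M A (\<lambda>_. 0)"
  by (simp add: sq_integrable_def)

lemma sq_integrable_scaleR: "sq_integrable M A X \<Longrightarrow> sq_integrable M A (\<lambda>\<omega>. c *\<^sub>R X \<omega>)"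
  unfolding sq_integrable_def by (auto simp: power_mult_distrib intro!: borel_measurable_scaleR)

lemma sq_integrable_add:
  assumes "sq_integrable M A X" "sq_integrable M A Y"
  shows "sq_integrable M A (\<lambda>\<omega>. X \<omega> + Y \<omega>)"
proof (rule sq_integrable_bound)
  show "integrable M (\<lambda>\<omega>. 2 * (norm (X \<omega>))\<^sup>2 + 2 * (norm (Y \<omega>))\<^sup>2)"
    using assms by (auto simp: sq_integrable_def)
qed (use assms in \<open>auto simp: sq_integrable_def norm_add_square_le\<close>)

lemma sq_integrable_diff:
  assumes "sq_integrable M A X" "sq_integrable M A Y"
  shows "sq_integrable M A (\<lambda>\<omega>. X \<omega> - Y \<omega>)"
  using sq_integrable_add[OF assms(1) sq_integrable_scaleR[OF assms(2), of "-1"]] by simp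

lemma sq_integrable_sum:
  assumes "\<And>i. i \<in> I \<Longrightarrow> sq_integrable M A (X i)"
  shows "sq_integrable M A (\<lambda>\<omega>. \<Sum>i\<in>I. X i \<omega>)"
  using assms by (induction I rule: infinite_finite_induct) (auto intro: sq_integrable_zero sq_integrable_add)

lemma sq_integrable_lipschitz:
  assumes "finite_measure M" and g: "L-lipschitz_on UNIV g" and X: "sq_integrable M A X"
  shows "sq_integrable M A (\<lambda>\<omega>. g (X \<omega>))"
proof (rule sq_integrable_bound)
  interpret finite_measure M by fact
  have "continuous_on UNIV g" by (rule lipschitz_on_continuous_on[OF g])
  then show "(\<lambda>\<omega>. g (X \<omega>)) \<in> borel_measurable A"
    using X by (auto simp: sq_integrable_def intro: borel_measurable_continuous_on)
  show "integrable M (\<lambda>\<omega>. 2 * (norm (g 0))\<^sup>2 + 2 * (L\<^sup>2 * (norm (X \<omega>))\<^sup>2))"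
    using X by (auto simp: sq_integrable_def)
  fix \<omega>
  have "(norm (g (X \<omega>) - g 0))\<^sup>2 \<le> (L * norm (X \<omega>))\<^sup>2"
    using lipschitz_onD[OF g, of "X \<omega>" 0] by (intro power_mono) (auto simp: dist_norm)
  then show "(norm (g (X \<omega>)))\<^sup>2 \<le> 2 * (norm (g 0))\<^sup>2 + 2 * (L\<^sup>2 * (norm (X \<omega>))\<^sup>2)"
    using norm_add_square_le[of "g 0" "g (X \<omega>) - g 0"] by (simp add: power_mult_distrib)
qed

end

lemma sq_integrable_products:
  assumes "sq_integrable M M X" "sq_integrable M M Y"
  shows "integrable M (\<lambda>\<omega>. norm (X \<omega>) * norm (Y \<omega>))" "integrable M (\<lambda>\<omega>. inner (X \<omega>) (Y \<omega>))"
proof -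
  have [measurable]: "X \<in> borel_measurable M" "Y \<in> borel_measurable M"
    using assms by (auto simp: sq_integrable_def)
  have b: "integrable M (\<lambda>\<omega>. (norm (X \<omega>))\<^sup>2 + (norm (Y \<omega>))\<^sup>2)"
    using assms by (auto simp: sq_integrable_def)
  have le: "norm (X \<omega>) * norm (Y \<omega>) \<le> (norm (X \<omega>))\<^sup>2 + (norm (Y \<omega>))\<^sup>2" for \<omega>
    using sum_squares_bound[of "norm (X \<omega>)" "norm (Y \<omega>)"]
      mult_nonneg_nonneg[OF norm_ge_zero[of "X \<omega>"] norm_ge_zero[of "Y \<omega>"]] by linarith
  show "integrable M (\<lambda>\<omega>. norm (X \<omega>) * norm (Y \<omega>))"
    by (rule Bochner_Integration.integrable_bound[OF b]) (use le in auto)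
  show "integrable M (\<lambda>\<omega>. inner (X \<omega>) (Y \<omega>))"
  proof (rule Bochner_Integration.integrable_bound[OF b])
    have "norm (inner (X \<omega>) (Y \<omega>)) \<le> norm ((norm (X \<omega>))\<^sup>2 + (norm (Y \<omega>))\<^sup>2)" for \<omega>
      using order_trans[OF Cauchy_Schwarz_ineq2 le] by simp
    then show "AE \<omega> in M. norm (inner (X \<omega>) (Y \<omega>)) \<le> norm ((norm (X \<omega>))\<^sup>2 + (norm (Y \<omega>))\<^sup>2)" by simp
  qed simp
qed

lemma borel_measurable_component:
  fixes X :: "'a \<Rightarrow> real ^ 'n"
  shows "X \<in> borel_measurable A \<Longrightarrow> (\<lambda>\<omega>. X \<omega> $ c) \<in> borel_measurable A"
  by (rule measurable_compose[OF _ borel_measurable_nth])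

lemma sq_integrable_component:
  fixes X :: "'a \<Rightarrow> real ^ 'n"
  assumes "sq_integrable M M X"
  shows "sq_integrable M M (\<lambda>\<omega>. X \<omega> $ c)"
proof (rule sq_integrable_bound)
  show "subalgebra M M" by (simp add: subalgebra_def)
  show "(norm (X \<omega> $ c))\<^sup>2 \<le> (norm (X \<omega>))\<^sup>2" for \<omega>
    using component_le_norm_cart[of "X \<omega>" c] by (simp add: abs_le_square_iff[symmetric])
  have [measurable]: "X \<in> borel_measurable M" using assms by (simp add: sq_integrable_def)
  show "(\<lambda>\<omega>. X \<omega> $ c) \<in> borel_measurable M" by (rule borel_measurable_component) fact
qed (use assms in \<open>auto simp: sq_integrable_def\<close>)

section \<open>The random iterates and their filtration\<close>

locale async_sgd = network N + M: prob_space M + problem: stochastic_problem P "agents N" f Li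
  for N and M :: "'o measure" and P :: "'z measure"
    and f :: "nat \<Rightarrow> real ^ 'n \<Rightarrow> 'z \<Rightarrow> real" and Li +
  fixes \<zeta>_init :: "'o \<Rightarrow> 'z" and \<zeta> :: "nat \<Rightarrow> 'o \<Rightarrow> 'z" and R :: "'o \<Rightarrow> (real ^ 'n) trajectory"
    and \<gamma> :: "nat \<Rightarrow> real" and \<sigma> :: real
  assumes samples: "samples_of M P \<zeta>_init \<zeta>"
    and is_runs: "\<And>\<omega>. \<omega> \<in> space M \<Longrightarrow> is_run N (sample_grad f) \<gamma> (\<zeta>_init \<omega>) (\<lambda>k. \<zeta> k \<omega>) (R \<omega>)"
    and gradients: "stochastic_gradients M P N f \<zeta>_init \<zeta> R \<sigma>"
begin

abbreviation "G \<equiv> true_grad P f"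

lemma nodes_eq: "nodes N = {1..agents N}"
  by (simp add: nodes_def)

lemma runs: "\<omega> \<in> space M \<Longrightarrow> async_run N (sample_grad f) \<gamma> (\<zeta>_init \<omega>) (\<lambda>k. \<zeta> k \<omega>) (R \<omega>)"
  by (unfold_locales) (rule is_runs)

definition hist :: "nat \<Rightarrow> 'o measure" where
  "hist = history M P \<zeta>_init \<zeta>"

abbreviation "adapted k X \<equiv> sq_integrable M (hist k) X"

lemma sample_measurable: "\<zeta>_init \<in> measurable M P" "\<zeta> k \<in> measurable M P"
  using samples by (auto simp: samples_of_def)

lemma space_hist [simp]: "space (hist k) = space M"
  by (simp add: hist_def history_def space_measure_of_conv)

lemma sets_hist: "sets (hist k) = sigma_sets (space M)
     ({\<zeta>_init -` B \<inter> space M | B. B \<in> sets P} \<union> (\<Union>t<k. {\<zeta> t -` B \<inter> space M | B. B \<in> sets P}))"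
  unfolding hist_def history_def by (rule sets_measure_of) auto

lemma hist_subalgebra: "subalgebra M (hist k)"
  unfolding subalgebra_def
proof (intro conjI)
  show "sets (hist k) \<subseteq> sets M"
    unfolding sets_hist by (rule sets.sigma_sets_subset) (use sample_measurable in \<open>auto intro: measurable_sets\<close>)
qed simp

lemma hist_mono: "k \<le> l \<Longrightarrow> subalgebra (hist l) (hist k)"
  unfolding subalgebra_def sets_hist
  by (intro conjI sigma_sets_mono' Un_mono UN_mono) auto

lemma adapted_mono: "k \<le> l \<Longrightarrow> adapted k X \<Longrightarrow> adapted l X"
  using measurable_from_subalg[OF hist_mono] by (auto simp: sq_integrable_def)

lemma adapted_sq_integrable: "adapted k X \<Longrightarrow> sq_integrable M M X"
  using measurable_from_subalg[OF hist_subalgebra] by (auto simp: sq_integrable_def)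

lemma adapted_cong: "(\<And>\<omega>. \<omega> \<in> space M \<Longrightarrow> X \<omega> = Y \<omega>) \<Longrightarrow> adapted k X = adapted k Y"
  by (rule sq_integrable_cong) auto

lemma adapted_congI: "(\<And>\<omega>. \<omega> \<in> space M \<Longrightarrow> X \<omega> = Y \<omega>) \<Longrightarrow> adapted k Y \<Longrightarrow> adapted k X"
  using adapted_cong by blast

lemmas adapted_intros = sq_integrable_zero[OF hist_subalgebra] sq_integrable_scaleR[OF hist_subalgebra]
  sq_integrable_add[OF hist_subalgebra] sq_integrable_diff[OF hist_subalgebra]
  sq_integrable_sum[OF hist_subalgebra]

lemma true_grad_lipschitz: "i \<in> nodes N \<Longrightarrow> (Li i)-lipschitz_on UNIV (G i)"
  by (rule problem.true_grad_lipschitz) (simp add: nodes_eq)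

lemma adapted_true_grad: "i \<in> nodes N \<Longrightarrow> adapted k X \<Longrightarrow> adapted k (\<lambda>\<omega>. G i (X \<omega>))"
  by (rule sq_integrable_lipschitz[OF hist_subalgebra M.finite_measure_axioms true_grad_lipschitz])

lemma sample_measurable_hist: "\<zeta>_init \<in> measurable (hist k) P" "t < k \<Longrightarrow> \<zeta> t \<in> measurable (hist k) P"
  by (rule measurableI; use sample_measurable in \<open>auto simp: sets_hist dest: measurable_space intro: sigma_sets.Basic\<close>)+

lemma sample_grad_measurable_hist:
  assumes "i \<in> nodes N" "X \<in> borel_measurable (hist k)" "s \<in> measurable (hist k) P"
  shows "(\<lambda>\<omega>. sample_grad f i (X \<omega>) (s \<omega>)) \<in> borel_measurable (hist k)"
  using measurable_compose[OF measurable_Pair[OF assms(2,3)] problem.sample_grad_measurable] assms(1)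
  by (simp add: nodes_eq)

abbreviation "X k i \<equiv> \<lambda>\<omega>. x_var (R \<omega>) k i"
abbreviation "V k i \<equiv> \<lambda>\<omega>. v_var (R \<omega>) k i"
abbreviation "Z k i \<equiv> \<lambda>\<omega>. z_var (R \<omega>) k i"

definition Y :: "nat \<Rightarrow> nat \<Rightarrow> 'o \<Rightarrow> real ^ 'n" where
  "Y k j \<omega> = async_run.last_grad N (sample_grad f) (\<zeta>_init \<omega>) (\<lambda>k. \<zeta> k \<omega>) (R \<omega>) k j"

definition \<epsilon> :: "nat \<Rightarrow> nat \<Rightarrow> 'o \<Rightarrow> real ^ 'n" where
  "\<epsilon> k j \<omega> = async_run.noise N (sample_grad f) (\<lambda>k. \<zeta> k \<omega>) (R \<omega>) G k j"

definition sample_error :: "nat \<Rightarrow> 'o \<Rightarrow> real ^ 'n" where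
  "sample_error k \<omega> = sample_grad f (act k) (X (Suc k) (act k) \<omega>) (\<zeta> k \<omega>) - G (act k) (X (Suc k) (act k) \<omega>)"

lemma \<epsilon>_rec: "\<omega> \<in> space M \<Longrightarrow> \<epsilon> 0 j \<omega> = 0"
  "\<omega> \<in> space M \<Longrightarrow> \<epsilon> (Suc k) j \<omega> = (if j = act k then sample_error k \<omega> else \<epsilon> k j \<omega>)"
  by (auto simp: \<epsilon>_def sample_error_def async_run.noise.simps[OF runs])

lemma Y_rec: "\<omega> \<in> space M \<Longrightarrow> Y 0 j \<omega> = sample_grad f j 0 (\<zeta>_init \<omega>)"
  "\<omega> \<in> space M \<Longrightarrow> Y (Suc k) j \<omega>
     = (if j = act k then sample_grad f j (X (Suc k) j \<omega>) (\<zeta> k \<omega>) else Y k j \<omega>)"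
  by (auto simp: Y_def async_run.last_grad.simps[OF runs])

text \<open>Square integrability is contained in the variance identity, whose extended integral has
  the finite value of the squared \<sigma>.\<close>

lemma sample_error_adapted:
  assumes X: "adapted k (X (Suc k) (act k))"
  shows "adapted (Suc k) (sample_error k)" and "(\<integral>\<omega>. (norm (sample_error k \<omega>))\<^sup>2 \<partial>M) = \<sigma>\<^sup>2"
proof -
  have X': "adapted (Suc k) (X (Suc k) (act k))" by (rule adapted_mono[OF _ X]) simp
  have "(\<lambda>\<omega>. sample_grad f (act k) (X (Suc k) (act k) \<omega>) (\<zeta> k \<omega>)) \<in> borel_measurable (hist (Suc k))"
    by (rule sample_grad_measurable_hist) (use X' active_node sample_measurable_hist(2)[of k "Suc k"] in \<open>auto simp: sq_integrable_def\<close>)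
  moreover have "(\<lambda>\<omega>. G (act k) (X (Suc k) (act k) \<omega>)) \<in> borel_measurable (hist (Suc k))"
    using adapted_true_grad[OF active_node X'] by (simp add: sq_integrable_def)
  ultimately have meas: "sample_error k \<in> borel_measurable (hist (Suc k))"
    unfolding sample_error_def[abs_def] by simp
  then have [measurable]: "sample_error k \<in> borel_measurable M"
    by (rule measurable_from_subalg[OF hist_subalgebra])
  have "(\<integral>\<^sup>+\<omega>. ennreal ((norm (sample_error k \<omega>))\<^sup>2) \<partial>M) = ennreal (\<sigma>\<^sup>2)"
    using gradients by (simp add: stochastic_gradients_def sample_error_def)
  then have "has_bochner_integral M (\<lambda>\<omega>. (norm (sample_error k \<omega>))\<^sup>2) (\<sigma>\<^sup>2)"
    by (intro has_bochner_integral_nn_integral) auto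
  then show "adapted (Suc k) (sample_error k)" and "(\<integral>\<omega>. (norm (sample_error k \<omega>))\<^sup>2 \<partial>M) = \<sigma>\<^sup>2"
    using meas by (auto simp: sq_integrable_def has_bochner_integral_iff)
qed

text \<open>History index k and time index t are separate because delayed reads at iteration k reach
  variables of earlier times.\<close>

definition vars_adapted :: "nat \<Rightarrow> nat \<Rightarrow> bool" where
  "vars_adapted k t \<longleftrightarrow>
     (\<forall>i\<in>nodes N. adapted k (X t i) \<and> adapted k (V t i) \<and> adapted k (Z t i) \<and> adapted k (Y t i)) \<and>
     (\<forall>(j, i)\<in>edges N. adapted k (\<lambda>\<omega>. mass (R \<omega>) t i j) \<and> adapted k (\<lambda>\<omega>. buf (R \<omega>) t i j))"

lemma vars_adapted_mono: "k \<le> l \<Longrightarrow> vars_adapted k t \<Longrightarrow> vars_adapted l t"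
  using adapted_mono unfolding vars_adapted_def by fast

lemma initial_gradient_adapted:
  assumes i: "i \<in> nodes N"
  shows "adapted k (\<lambda>\<omega>. sample_grad f i 0 (\<zeta>_init \<omega>))"
proof -
  have meas: "(\<lambda>\<omega>. sample_grad f i 0 (\<zeta>_init \<omega>)) \<in> borel_measurable (hist k)"
    by (rule sample_grad_measurable_hist[OF i]) (auto simp: sample_measurable_hist)
  then have [measurable]: "(\<lambda>\<omega>. sample_grad f i 0 (\<zeta>_init \<omega>)) \<in> borel_measurable M"
    by (rule measurable_from_subalg[OF hist_subalgebra])
  have "(\<integral>\<^sup>+\<omega>. ennreal ((norm (sample_grad f i 0 (\<zeta>_init \<omega>)))\<^sup>2) \<partial>M) < \<infinity>"
    using gradients i by (auto simp: stochastic_gradients_def)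
  then have "integrable M (\<lambda>\<omega>. (norm (sample_grad f i 0 (\<zeta>_init \<omega>)))\<^sup>2)"
    by (intro integrableI_nonneg) auto
  with meas show ?thesis by (simp add: sq_integrable_def)
qed

lemma vars_adapted_0: "vars_adapted 0 0"
  unfolding vars_adapted_def
proof (intro conjI ballI)
  fix i assume i: "i \<in> nodes N"
  note init = async_run.init[OF runs]
  show "adapted 0 (X 0 i)" "adapted 0 (V 0 i)"
    by (rule adapted_congI, erule init(1,2)[OF _ i], rule adapted_intros)+
  show "adapted 0 (Z 0 i)" "adapted 0 (Y 0 i)"
    by (rule adapted_congI, erule init(3)[OF _ i] Y_rec(1), rule initial_gradient_adapted[OF i])+
next
  fix e assume e: "e \<in> edges N"
  note init = async_run.init[OF runs]
  obtain j i where ji: "e = (j, i)" by force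
  with e have "(j, i) \<in> edges N" by simp
  note init' = init(4,5)[OF _ this]
  have "adapted 0 (\<lambda>\<omega>. mass (R \<omega>) 0 i j)" "adapted 0 (\<lambda>\<omega>. buf (R \<omega>) 0 i j)"
    by (rule adapted_congI, erule init', rule adapted_intros)+
  then show "case e of (j, i) \<Rightarrow> adapted 0 (\<lambda>\<omega>. mass (R \<omega>) 0 i j) \<and> adapted 0 (\<lambda>\<omega>. buf (R \<omega>) 0 i j)"
    using ji by simp
qed

text \<open>The new x depends on the old x and z and on delayed v, so it is known before the sample
  of iteration k is drawn; this is what makes the sample error orthogonal to the past. The new z
  uses that sample and belongs to the next history.\<close>

lemma vars_adapted_Suc:
  assumes past: "\<And>t. t \<le> k \<Longrightarrow> vars_adapted k t"
  shows "adapted k (X (Suc k) (act k))" and "vars_adapted (Suc k) (Suc k)"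
proof -
  let ?i = "act k"
  have i: "?i \<in> nodes N" by (rule active_node)
  note step = async_run.step[OF runs, where k = k] and inactive = async_run.step_inactive[OF runs, where k = k]
  have now: "vars_adapted k k" by (rule past) simp
  have v: "adapted k (V (Suc k) ?i)"
    by (rule adapted_congI, erule step(1), intro adapted_intros; use now i in \<open>simp add: vars_adapted_def\<close>)
  have delayed: "nat (tau N k ?i j) \<le> k" for j using tau_le[of k ?i j] by simp
  show x: "adapted k (X (Suc k) ?i)"
  proof (rule adapted_congI, erule step(2), intro adapted_intros v)
    fix j assume "j \<in> N_in N ?i"
    then show "adapted k (V (nat (tau N k ?i j)) j)"
      using past[OF delayed] N_in_subset unfolding vars_adapted_def by blast
  qed
  have up: "adapted k U \<Longrightarrow> adapted (Suc k) U" for U :: "'o \<Rightarrow> real ^ 'n" by (rule adapted_mono) simp_all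
  \<comment> \<open>The new sampled gradient is square integrable as the sum of its error, of finite
    variance, and a Lipschitz function of the new iterate.\<close>
  have "adapted (Suc k) (\<lambda>\<omega>. sample_error k \<omega> + G ?i (X (Suc k) ?i \<omega>))"
    by (intro adapted_intros sample_error_adapted(1)[OF x] adapted_true_grad[OF i] up x)
  then have y: "adapted (Suc k) (Y (Suc k) ?i)"
    by (subst adapted_cong[of _ "\<lambda>\<omega>. sample_error k \<omega> + G ?i (X (Suc k) ?i \<omega>)"])
      (auto simp: Y_rec sample_error_def)
  have half: "adapted (Suc k) (\<lambda>\<omega>. z_half (R \<omega>) k)"
  proof -
    have eq: "z_half (R \<omega>) k = Z k ?i \<omega>
      + (\<Sum>j\<in>N_in N ?i. mass (R \<omega>) (nat (tau N k ?i j)) ?i j - buf (R \<omega>) k ?i j)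
      + (Y (Suc k) ?i \<omega> - Y k ?i \<omega>)" if "\<omega> \<in> space M" for \<omega>
      unfolding Y_def by (rule async_run.z_half_eq[OF runs[OF that]])
    have edge: "(j, ?i) \<in> edges N" if "j \<in> N_in N ?i" for j using that by (simp add: N_in_def)
    show ?thesis
    proof (rule adapted_congI, erule eq, intro adapted_intros y)
      show "adapted (Suc k) (Z k ?i)" "adapted (Suc k) (Y k ?i)"
        using now i up unfolding vars_adapted_def by auto
      fix j assume j: "j \<in> N_in N ?i"
      show "adapted (Suc k) (\<lambda>\<omega>. mass (R \<omega>) (nat (tau N k ?i j)) ?i j)"
        using past[OF delayed, of j] edge[OF j] up unfolding vars_adapted_def by blast
      show "adapted (Suc k) (\<lambda>\<omega>. buf (R \<omega>) k ?i j)"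
        using now edge[OF j] up unfolding vars_adapted_def by blast
    qed
  qed
  show "vars_adapted (Suc k) (Suc k)"
    unfolding vars_adapted_def
  proof (intro conjI ballI)
    fix j assume j: "j \<in> nodes N"
    have old: "adapted (Suc k) (X k j)" "adapted (Suc k) (V k j)" "adapted (Suc k) (Z k j)" "adapted (Suc k) (Y k j)"
      using now j up unfolding vars_adapted_def by auto
    have z: "adapted (Suc k) (Z (Suc k) ?i)"
      by (rule adapted_congI, erule step(4), intro adapted_intros half)
    show "adapted (Suc k) (X (Suc k) j)"
      by (cases "j = ?i") (use up[OF x] old j inactive(1) in \<open>auto intro: adapted_congI\<close>)
    show "adapted (Suc k) (V (Suc k) j)"
      by (cases "j = ?i") (use up[OF v] old j inactive(2) in \<open>auto intro: adapted_congI\<close>)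
    show "adapted (Suc k) (Z (Suc k) j)"
      by (cases "j = ?i") (use z old j inactive(3) in \<open>auto intro: adapted_congI\<close>)
    show "adapted (Suc k) (Y (Suc k) j)"
    proof (cases "j = ?i")
      case False
      then have "Y (Suc k) j \<omega> = Y k j \<omega>" if "\<omega> \<in> space M" for \<omega> using Y_rec(2)[OF that] by simp
      then show ?thesis using old(4) adapted_cong[of "Y (Suc k) j" "Y k j"] by simp
    qed (use y in simp)
  next
    fix e assume e: "e \<in> edges N"
    obtain j l where jl: "e = (j, l)" by force
    have old: "adapted (Suc k) (\<lambda>\<omega>. mass (R \<omega>) k l j)" "adapted (Suc k) (\<lambda>\<omega>. buf (R \<omega>) k l j)"
      using now e jl up unfolding vars_adapted_def by blast+
    have "adapted (Suc k) (\<lambda>\<omega>. mass (R \<omega>) (Suc k) l j)"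
    proof (cases "j = ?i")
      case True
      then have "l \<in> N_out N ?i" using e jl by (simp add: N_out_def)
      from step(5)[OF _ this] have "adapted (Suc k) (\<lambda>\<omega>. mass (R \<omega>) (Suc k) l ?i)
          = adapted (Suc k) (\<lambda>\<omega>. mass (R \<omega>) k l ?i + col_wt N l ?i *\<^sub>R z_half (R \<omega>) k)"
        by (intro adapted_cong)
      then show ?thesis using True old(1) adapted_intros(3)[OF _ adapted_intros(2)[OF half]] by simp
    next
      case False
      then show ?thesis
        by (intro adapted_congI[OF _ old(1)]) (use e jl inactive(4) in auto)
    qed
    moreover have "adapted (Suc k) (\<lambda>\<omega>. buf (R \<omega>) (Suc k) l j)"
    proof (cases "l = ?i")
      case True
      then have j: "j \<in> N_in N ?i" using e jl by (simp add: N_in_def)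
      then have "adapted (Suc k) (\<lambda>\<omega>. mass (R \<omega>) (nat (tau N k ?i j)) ?i j)"
        using past[OF delayed, of j] up unfolding vars_adapted_def N_in_def by blast
      then show ?thesis unfolding True by (rule adapted_congI[rotated]) (rule step(6)[OF _ j])
    next
      case False
      then show ?thesis
        by (intro adapted_congI[OF _ old(2)]) (use e jl inactive(5) in auto)
    qed
    ultimately show "case e of (j, i) \<Rightarrow> adapted (Suc k) (\<lambda>\<omega>. mass (R \<omega>) (Suc k) i j)
        \<and> adapted (Suc k) (\<lambda>\<omega>. buf (R \<omega>) (Suc k) i j)"
      using jl by simp
  qed
qed

lemma vars_adapted: "t \<le> k \<Longrightarrow> vars_adapted k t"
proof -
  have "vars_adapted k k" for k
  proof (induction k rule: less_induct)
    case (less k)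
    show ?case
    proof (cases k)
      case 0
      then show ?thesis using vars_adapted_0 by simp
    next
      case (Suc l)
      then show ?thesis using less vars_adapted_mono by (auto intro!: vars_adapted_Suc(2))
    qed
  qed
  then show "t \<le> k \<Longrightarrow> vars_adapted k t" using vars_adapted_mono by blast
qed

lemma adapted_next: "adapted k (X (Suc k) (act k))"
  by (rule vars_adapted_Suc(1)) (rule vars_adapted)

lemma adapted_vars:
  assumes "i \<in> nodes N" "t \<le> k"
  shows "adapted k (X t i)" "adapted k (V t i)" "adapted k (Z t i)" "adapted k (Y t i)"
  using vars_adapted[OF assms(2)] assms(1) unfolding vars_adapted_def by auto

lemma adapted_\<epsilon>: "adapted k (\<epsilon> k j)" and \<epsilon>_second_moment: "(\<integral>\<omega>. (norm (\<epsilon> k j \<omega>))\<^sup>2 \<partial>M) \<le> \<sigma>\<^sup>2"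
proof -
  have "adapted k (\<epsilon> k j) \<and> (\<integral>\<omega>. (norm (\<epsilon> k j \<omega>))\<^sup>2 \<partial>M) \<le> \<sigma>\<^sup>2"
  proof (induction k)
    case 0
    have "adapted 0 (\<epsilon> 0 j) = adapted 0 (\<lambda>_. 0 :: real ^ 'n)" by (rule adapted_cong) (simp add: \<epsilon>_rec)
    moreover have "(\<integral>\<omega>. (norm (\<epsilon> 0 j \<omega>))\<^sup>2 \<partial>M) = (\<integral>\<omega>. 0 \<partial>M)"
      by (rule Bochner_Integration.integral_cong) (simp_all add: \<epsilon>_rec)
    ultimately show ?case using adapted_intros(1) by simp
  next
    case (Suc k)
    let ?e = "if j = act k then sample_error k else \<epsilon> k j"
    have "adapted (Suc k) (\<epsilon> (Suc k) j) = adapted (Suc k) ?e" by (rule adapted_cong) (simp add: \<epsilon>_rec)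
    moreover have "(\<integral>\<omega>. (norm (\<epsilon> (Suc k) j \<omega>))\<^sup>2 \<partial>M) = (\<integral>\<omega>. (norm (?e \<omega>))\<^sup>2 \<partial>M)"
      by (rule Bochner_Integration.integral_cong) (simp_all add: \<epsilon>_rec)
    ultimately show ?case
      using Suc sample_error_adapted[OF adapted_next[of k]] adapted_mono[of k "Suc k"] by auto
  qed
  then show "adapted k (\<epsilon> k j)" and "(\<integral>\<omega>. (norm (\<epsilon> k j \<omega>))\<^sup>2 \<partial>M) \<le> \<sigma>\<^sup>2" by auto
qed

text \<open>Unbiasedness is assumed coordinate by coordinate, so in each coordinate the factor from
  U, known at time k, is pulled through the conditional expectation and the coordinates are
  added.\<close>

lemma sample_error_orthogonal:
  assumes U: "adapted k U"
  shows "(\<integral>\<omega>. inner (U \<omega>) (sample_error k \<omega>) \<partial>M) = 0"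
proof -
  interpret sub: finite_measure_subalgebra M "hist k"
    by unfold_locales (rule hist_subalgebra)
  note X = adapted_next[of k]
  let ?S = "\<lambda>\<omega>. sample_error k \<omega> + G (act k) (X (Suc k) (act k) \<omega>)" and ?T = "\<lambda>\<omega>. G (act k) (X (Suc k) (act k) \<omega>)"
  have S: "sq_integrable M M ?S"
    by (rule adapted_sq_integrable[of "Suc k"])
      (intro adapted_intros sample_error_adapted(1) X adapted_true_grad active_node adapted_mono[of k "Suc k"], simp)
  have T: "sq_integrable M M ?T" by (rule adapted_sq_integrable[OF adapted_true_grad[OF active_node X]])
  have UM: "sq_integrable M M U" by (rule adapted_sq_integrable[OF U])
  have int: "integrable M (\<lambda>\<omega>. U \<omega> $ c * W \<omega> $ c)" if "sq_integrable M M W" for W :: "'o \<Rightarrow> real ^ 'n" and c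
    using sq_integrable_products(2)[OF sq_integrable_component[OF UM] sq_integrable_component[OF that], of c c]
    by (simp add: inner_real_def)
  have comp: "(\<integral>\<omega>. U \<omega> $ c * sample_error k \<omega> $ c \<partial>M) = 0" for c
  proof -
    have U': "(\<lambda>\<omega>. U \<omega> $ c) \<in> borel_measurable (hist k)"
      using U by (intro borel_measurable_component) (simp add: sq_integrable_def)
    have [measurable]: "(\<lambda>\<omega>. ?S \<omega> $ c) \<in> borel_measurable M" "(\<lambda>\<omega>. ?T \<omega> $ c) \<in> borel_measurable M"
      "(\<lambda>\<omega>. U \<omega> $ c) \<in> borel_measurable M"
      by (rule borel_measurable_component, use S T UM in \<open>simp only: sq_integrable_def\<close>)+
    note int = int[of _ c]
    have "(\<integral>\<omega>. U \<omega> $ c * real_cond_exp M (hist k) (\<lambda>\<omega>. ?S \<omega> $ c) \<omega> \<partial>M) = (\<integral>\<omega>. U \<omega> $ c * ?S \<omega> $ c \<partial>M)"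
      by (rule sub.real_cond_exp_intg(2)) (use int[OF S] U' in measurable)
    moreover have "(\<integral>\<omega>. U \<omega> $ c * real_cond_exp M (hist k) (\<lambda>\<omega>. ?S \<omega> $ c) \<omega> \<partial>M) = (\<integral>\<omega>. U \<omega> $ c * ?T \<omega> $ c \<partial>M)"
    proof (rule integral_cong_AE)
      have "AE \<omega> in M. real_cond_exp M (hist k) (\<lambda>\<omega>. ?S \<omega> $ c) \<omega> = ?T \<omega> $ c"
        using gradients by (simp add: stochastic_gradients_def sample_error_def hist_def)
      then show "AE \<omega> in M. U \<omega> $ c * real_cond_exp M (hist k) (\<lambda>\<omega>. ?S \<omega> $ c) \<omega> = U \<omega> $ c * ?T \<omega> $ c"
        by eventually_elim simp
    qed measurable
    ultimately have "(\<integral>\<omega>. U \<omega> $ c * ?S \<omega> $ c - U \<omega> $ c * ?T \<omega> $ c \<partial>M) = 0"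
      using int[OF S] int[OF T] by simp
    then show ?thesis by (simp add: algebra_simps)
  qed
  have "(\<integral>\<omega>. inner (U \<omega>) (sample_error k \<omega>) \<partial>M) = (\<Sum>c\<in>UNIV. \<integral>\<omega>. U \<omega> $ c * sample_error k \<omega> $ c \<partial>M)"
    unfolding inner_vec_def inner_real_def
    by (rule Bochner_Integration.integral_sum)
      (rule int[OF adapted_sq_integrable[OF sample_error_adapted(1)[OF X]]])
  then show ?thesis using comp by simp
qed

end

section \<open>Moment estimates\<close>

lemma square_add3_le: "(a + c + d)\<^sup>2 \<le> 3 * a\<^sup>2 + 3 * c\<^sup>2 + 3 * d\<^sup>2" for a c d :: real
  using sum_squares_bound[of a c] sum_squares_bound[of a d] sum_squares_bound[of c d]
  by (simp add: power2_eq_square algebra_simps)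

locale tracked_sgd = async_sgd N M P f Li \<zeta>_init \<zeta> R \<gamma> \<sigma>
  for N and M :: "'o measure" and P :: "'z measure"
    and f :: "nat \<Rightarrow> real ^ 'n \<Rightarrow> 'z \<Rightarrow> real" and Li \<zeta>_init \<zeta> R \<gamma> \<sigma> +
  fixes \<xi> :: "int \<Rightarrow> aug_node \<Rightarrow> real" and \<psi> :: "nat \<Rightarrow> nat \<Rightarrow> real" and r K \<Lambda> L b C\<^sub>0 \<rho> :: real
  assumes rate_bounds: "0 < r" "r < 1" and K: "1 \<le> K"
    and \<xi>_stochastic: "\<And>k. stochastic_vector (aug_nodes N) (\<xi> (int k - 1))"
    and \<xi>_rate: "\<And>k t p q. t \<le> k \<Longrightarrow> p \<in> aug_nodes N \<Longrightarrow> q \<in> aug_nodes N \<Longrightarrow>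
       \<bar>chain_to (aug_nodes N) (A_hat N) k t p q - \<xi> (int k - 1) p\<bar> \<le> K * r ^ (k - t)"
    and \<Lambda>: "\<And>i. i \<in> nodes N \<Longrightarrow> \<Lambda>-lipschitz_on UNIV (true_grad P f i)"
    and \<psi>: "consensus_sequence N C\<^sub>0 \<rho> \<psi>" "\<bar>\<rho>\<bar> < 1"
    and L: "L-lipschitz_on UNIV (grad (total_cost P (agents N) f))"
    and b: "\<And>x. b \<le> total_cost P (agents N) f x"
    and \<gamma>: "\<And>k. 0 < \<gamma> k" "\<And>k. \<gamma> k \<le> 1"
begin

abbreviation "F \<equiv> total_cost P (agents N) f"
abbreviation "gF \<equiv> grad (total_cost P (agents N) f)"
abbreviation "w \<equiv> tracking_weight N \<xi>"
abbreviation "direction k \<equiv> Z k (act k)"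
abbreviation "E \<equiv> M.expectation"

lemma tracked:
  assumes "\<omega> \<in> space M"
  shows "tracked_run N (sample_grad f) \<gamma> (\<zeta>_init \<omega>) (\<lambda>k. \<zeta> k \<omega>) (R \<omega>) \<xi> r K \<Lambda> G"
  by (intro tracked_run.intro runs[OF assms] tracked_run_axioms.intro)
    (use rate_bounds K \<xi>_stochastic \<xi>_rate \<Lambda> in blast)+

lemma gF_eq: "gF x = (\<Sum>j\<in>nodes N. G j x)"
  unfolding problem.grad_total_cost nodes_eq ..

definition mean :: "nat \<Rightarrow> 'o \<Rightarrow> real ^ 'n" where
  "mean k \<omega> = x_psi N \<psi> (R \<omega>) k"

definition grad_sum :: "nat \<Rightarrow> 'o \<Rightarrow> real ^ 'n" where
  "grad_sum k \<omega> = (\<Sum>j\<in>nodes N. G j (X k j \<omega>))"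

text \<open>The propagation weights depend on the network and \<xi> but not on the outcome, so they
  are numbers that can be taken out of expectations.\<close>

definition gap :: "nat \<Rightarrow> nat \<Rightarrow> real" where
  "gap k t = tracked_run.weight_gap N \<xi> k t (act t)"

definition direction_noise :: "nat \<Rightarrow> 'o \<Rightarrow> real ^ 'n" where
  "direction_noise k \<omega> = w k *\<^sub>R (\<Sum>j\<in>nodes N. \<epsilon> k j \<omega>)
     + (\<Sum>t<k. gap k t *\<^sub>R (\<epsilon> (Suc t) (act t) \<omega> - \<epsilon> t (act t) \<omega>))"

definition tracking_error :: "nat \<Rightarrow> 'o \<Rightarrow> real ^ 'n" where
  "tracking_error k \<omega> = direction k \<omega> - w k *\<^sub>R grad_sum k \<omega> - direction_noise k \<omega>"

lemma direction_noise_eq: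
  "\<omega> \<in> space M \<Longrightarrow> direction_noise k \<omega>
     = tracked_run.noise_part N (sample_grad f) (\<lambda>k. \<zeta> k \<omega>) (R \<omega>) \<xi> G k"
  by (simp add: direction_noise_def tracked_run.noise_part_def[OF tracked] gap_def \<epsilon>_def)

lemma tracking_error_eq:
  "\<omega> \<in> space M \<Longrightarrow> tracking_error k \<omega>
     = tracked_run.tracking_part N (sample_grad f) (\<lambda>k. \<zeta> k \<omega>) (R \<omega>) \<xi> G k"
  by (simp add: tracking_error_def tracked_run.tracking_part_def[OF tracked] direction_noise_eq grad_sum_def)

lemma adapted_h_vec: "q \<in> blocks N \<Longrightarrow> adapted k (\<lambda>\<omega>. h_vec N (R \<omega>) k q)"
proof -
  have i: "(q - 1) mod agents N + 1 \<in> nodes N" using m_pos by (simp add: nodes_def Suc_le_eq)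
  show ?thesis
    by (cases "(q - 1) div agents N = 0") (use adapted_vars(1,2)[OF i] in \<open>simp_all add: h_vec_def Let_def\<close>)
qed

lemma adapted_mean: "adapted k (mean k)"
  unfolding mean_def[abs_def] x_psi_def by (intro adapted_intros adapted_h_vec)

lemma adapted_mean': "t \<le> k \<Longrightarrow> adapted k (mean t)"
  by (rule adapted_mono[OF _ adapted_mean])

lemma adapted_gF: "adapted k U \<Longrightarrow> adapted k (\<lambda>\<omega>. gF (U \<omega>))"
  by (rule sq_integrable_lipschitz[OF hist_subalgebra M.finite_measure_axioms L])

lemma adapted_direction: "t \<le> k \<Longrightarrow> adapted k (direction t)"
  by (intro adapted_vars active_node)

lemma adapted_grad_sum: "adapted k (grad_sum k)"
  unfolding grad_sum_def[abs_def] by (intro adapted_intros adapted_true_grad adapted_vars) auto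

lemma adapted_\<epsilon>': "t \<le> k \<Longrightarrow> adapted k (\<epsilon> t j)"
  by (rule adapted_mono[OF _ adapted_\<epsilon>])

lemma adapted_direction_noise: "adapted k (direction_noise k)"
  unfolding direction_noise_def[abs_def] by (intro adapted_intros adapted_\<epsilon>') auto

lemma adapted_tracking_error: "adapted k (tracking_error k)"
  unfolding tracking_error_def[abs_def]
  by (intro adapted_intros adapted_direction adapted_grad_sum adapted_direction_noise) auto

lemma integrable_norm_square: "adapted k U \<Longrightarrow> integrable M (\<lambda>\<omega>. (norm (U \<omega>))\<^sup>2)"
  by (simp add: sq_integrable_def)

lemma integrable_inner: "adapted k U \<Longrightarrow> adapted k W \<Longrightarrow> integrable M (\<lambda>\<omega>. inner (U \<omega>) (W \<omega>))"
  by (rule sq_integrable_products(2)[OF adapted_sq_integrable adapted_sq_integrable])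

lemma integrable_norms:
  fixes U W :: "'o \<Rightarrow> real ^ 'n"
  shows "adapted k U \<Longrightarrow> adapted k W \<Longrightarrow> integrable M (\<lambda>\<omega>. norm (U \<omega>) * norm (W \<omega>))"
  by (rule sq_integrable_products(1)[OF adapted_sq_integrable adapted_sq_integrable])

lemma integrable_E_c: "integrable M (\<lambda>\<omega>. E_c N \<psi> (R \<omega>) k)"
  unfolding E_c_def mean_def[symmetric]
  by (intro Bochner_Integration.integrable_sum integrable_norm_square[of k] adapted_intros adapted_h_vec adapted_mean)

lemma z_bar_eq_G: "\<omega> \<in> space M \<Longrightarrow> i \<in> nodes N \<Longrightarrow> z_bar N G (R \<omega>) k i = G i (X k i \<omega>)"
  by (rule async_run.z_bar_eq[OF runs])

lemma E_z_eq: "\<omega> \<in> space M \<Longrightarrow> E_z N G (R \<omega>) k = (norm (G (act k) (X k (act k) \<omega>)))\<^sup>2"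
  by (simp add: E_z_def z_bar_eq_G active_node)

lemma E_t_eq: "\<omega> \<in> space M \<Longrightarrow>
    E_t N G \<xi> (R \<omega>) k = (norm (G (act k) (X k (act k) \<omega>) - w k *\<^sub>R grad_sum k \<omega>))\<^sup>2"
  by (simp add: E_t_def z_bar_eq_G active_node grad_sum_def tracking_weight_def)

lemma integrable_E_z: "integrable M (\<lambda>\<omega>. E_z N G (R \<omega>) k)"
proof -
  have "integrable M (\<lambda>\<omega>. (norm (G (act k) (X k (act k) \<omega>)))\<^sup>2)"
    by (intro integrable_norm_square[of k] adapted_true_grad adapted_vars active_node order_refl)
  then show ?thesis by (subst Bochner_Integration.integrable_cong[OF refl E_z_eq])
qed

lemma integrable_E_t: "integrable M (\<lambda>\<omega>. E_t N G \<xi> (R \<omega>) k)"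
proof -
  have "integrable M (\<lambda>\<omega>. (norm (G (act k) (X k (act k) \<omega>) - w k *\<^sub>R grad_sum k \<omega>))\<^sup>2)"
    by (intro integrable_norm_square[of k] adapted_intros adapted_true_grad adapted_vars active_node
        order_refl adapted_grad_sum)
  then show ?thesis by (subst Bochner_Integration.integrable_cong[OF refl E_t_eq])
qed

lemma weight: "0 \<le> w k" "w k \<le> 1"
proof -
  obtain \<omega> where "\<omega> \<in> space M" using M.not_empty by blast
  then show "0 \<le> w k" "w k \<le> 1" using tracked_run.weight[OF tracked] by auto
qed

lemma gap_le:
  assumes "t \<le> k"
  shows "\<bar>gap k t\<bar> \<le> K * r ^ (k - t)"
proof -
  obtain \<omega> where "\<omega> \<in> space M" using M.not_empty by blast
  then show ?thesis unfolding gap_def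
    using tracked_run.weight_gap_le[OF tracked] assms active_node by blast
qed

lemma \<psi>_weight: "0 \<le> \<psi> k (act k)" "\<psi> k (act k) \<le> 1"
  using \<psi>(1) stochastic_vector_le_1[of "blocks N" "\<psi> k"] node_in_blocks[OF active_node[of k]]
  by (auto simp: consensus_sequence_def stochastic_vector_def)

lemma L_nonneg: "0 \<le> L" and \<Lambda>_nonneg: "0 \<le> \<Lambda>"
  using lipschitz_on_nonneg[OF L] lipschitz_on_nonneg[OF \<Lambda>[OF active_node]] by auto

lemma mean_Suc:
  "\<omega> \<in> space M \<Longrightarrow> mean (Suc k) \<omega> = mean k \<omega> - (\<gamma> k * \<psi> k (act k)) *\<^sub>R direction k \<omega>"
  unfolding mean_def by (rule async_run.x_psi_Suc[OF runs \<psi>])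

lemma norm_mean_diff_le:
  assumes "\<omega> \<in> space M" "s \<le> k"
  shows "norm (mean k \<omega> - mean s \<omega>) \<le> (\<Sum>u=s..<k. \<gamma> u * norm (direction u \<omega>))"
  using assms(2)
proof (induction k rule: dec_induct)
  case (step k)
  have "norm (mean (Suc k) \<omega> - mean s \<omega>) \<le> norm (mean k \<omega> - mean s \<omega>) + norm ((\<gamma> k * \<psi> k (act k)) *\<^sub>R direction k \<omega>)"
    using norm_triangle_ineq4[of "mean k \<omega> - mean s \<omega>" "(\<gamma> k * \<psi> k (act k)) *\<^sub>R direction k \<omega>"]
    by (simp add: mean_Suc[OF assms(1)] algebra_simps)
  moreover have "norm ((\<gamma> k * \<psi> k (act k)) *\<^sub>R direction k \<omega>) \<le> \<gamma> k * norm (direction k \<omega>)"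
  proof -
    have "\<gamma> k * \<psi> k (act k) \<le> \<gamma> k" using \<gamma>(1)[of k] \<psi>_weight[of k] by (simp add: mult_left_le)
    then show ?thesis using \<gamma>(1)[of k] \<psi>_weight[of k] by (simp add: abs_mult mult_right_mono)
  qed
  ultimately show ?case using step by simp
qed simp

text \<open>Every agent iterate is a block of \<open>h_vec\<close>, hence within the square root of
  \<open>E_c\<close> of the mean; there are \<open>agents N\<close> summands of Lipschitz constant
  \<Lambda>.\<close>

lemma mean_gradient_error:
  assumes "\<omega> \<in> space M"
  shows "(norm (grad_sum k \<omega> - gF (mean k \<omega>)))\<^sup>2 \<le> \<Lambda>\<^sup>2 * (real (agents N))\<^sup>2 * E_c N \<psi> (R \<omega>) k"
proof -
  have Ec: "0 \<le> E_c N \<psi> (R \<omega>) k" by (simp add: E_c_def sum_nonneg)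
  have "norm (grad_sum k \<omega> - gF (mean k \<omega>)) \<le> (\<Sum>j\<in>nodes N. \<Lambda> * sqrt (E_c N \<psi> (R \<omega>) k))"
    unfolding grad_sum_def gF_eq sum_subtractf[symmetric]
  proof (rule sum_norm_le)
    fix j assume j: "j \<in> nodes N"
    have "norm (G j (X k j \<omega>) - G j (mean k \<omega>)) \<le> \<Lambda> * norm (X k j \<omega> - mean k \<omega>)"
      using lipschitz_onD[OF \<Lambda>[OF j]] by (simp add: dist_norm)
    also have "\<dots> \<le> \<Lambda> * sqrt (E_c N \<psi> (R \<omega>) k)"
      using async_run.norm_h_vec_diff_le[OF runs[OF assms] node_in_blocks[OF j], of k \<psi>]
      by (intro mult_left_mono \<Lambda>_nonneg)
        (simp add: async_run.h_vec_agent[OF runs[OF assms] j] mean_def)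
    finally show "norm (G j (X k j \<omega>) - G j (mean k \<omega>)) \<le> \<Lambda> * sqrt (E_c N \<psi> (R \<omega>) k)" .
  qed
  also have "\<dots> = \<Lambda> * real (agents N) * sqrt (E_c N \<psi> (R \<omega>) k)" by (simp add: nodes_def)
  finally have "(norm (grad_sum k \<omega> - gF (mean k \<omega>)))\<^sup>2 \<le> (\<Lambda> * real (agents N) * sqrt (E_c N \<psi> (R \<omega>) k))\<^sup>2"
    by (intro power_mono) auto
  then show ?thesis using Ec by (simp add: power_mult_distrib)
qed

section \<open>Expected errors and the descent inequality\<close>

definition \<Phi> :: "nat \<Rightarrow> real" where "\<Phi> k = E (\<lambda>\<omega>. F (mean k \<omega>)) - b"
definition gsq :: "nat \<Rightarrow> real" where "gsq k = E (\<lambda>\<omega>. (norm (gF (mean k \<omega>)))\<^sup>2)"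
definition dsq :: "nat \<Rightarrow> real" where "dsq k = E (\<lambda>\<omega>. (norm (direction k \<omega>))\<^sup>2)"
definition tsq :: "nat \<Rightarrow> real" where "tsq k = E (\<lambda>\<omega>. (norm (tracking_error k \<omega>))\<^sup>2)"
definition ec :: "nat \<Rightarrow> real" where "ec k = E (\<lambda>\<omega>. E_c N \<psi> (R \<omega>) k)"
definition et :: "nat \<Rightarrow> real" where "et k = E (\<lambda>\<omega>. E_t N G \<xi> (R \<omega>) k)"
definition ez :: "nat \<Rightarrow> real" where "ez k = E (\<lambda>\<omega>. E_z N G (R \<omega>) k)"

lemma moments_nonneg: "0 \<le> gsq k" "0 \<le> dsq k" "0 \<le> tsq k" "0 \<le> ec k" "0 \<le> et k" "0 \<le> ez k"
  unfolding gsq_def dsq_def tsq_def ec_def et_def ez_def E_c_def E_t_def E_z_def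
  by (auto intro!: Bochner_Integration.integral_nonneg sum_nonneg)

lemma F_remainder: "\<bar>F y - F x - inner (gF x) (y - x)\<bar> \<le> L * (norm (y - x))\<^sup>2"
  by (rule gradient_remainder_le[OF problem.total_cost_differentiable L])

lemma integrable_F_mean: "integrable M (\<lambda>\<omega>. F (mean k \<omega>))"
proof (rule Bochner_Integration.integrable_bound)
  let ?b = "\<lambda>\<omega>. \<bar>F 0\<bar> + (norm (gF 0))\<^sup>2 + (1 + L) * (norm (mean k \<omega>))\<^sup>2"
  show "integrable M ?b" using integrable_norm_square[OF adapted_mean] by auto
  have "continuous_on UNIV F"
    using problem.total_cost_differentiable
    by (intro differentiable_imp_continuous_on) (simp add: differentiable_on_def)
  then show "(\<lambda>\<omega>. F (mean k \<omega>)) \<in> borel_measurable M"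
    using sq_integrable_measurable[OF hist_subalgebra adapted_mean] by (rule borel_measurable_continuous_on)
  show "AE \<omega> in M. norm (F (mean k \<omega>)) \<le> norm (?b \<omega>)"
  proof (rule AE_I2)
    fix \<omega>
    let ?x = "mean k \<omega>"
    have "\<bar>F ?x\<bar> \<le> \<bar>F 0\<bar> + \<bar>inner (gF 0) ?x\<bar> + L * (norm ?x)\<^sup>2" using F_remainder[of ?x 0] by simp
    moreover have "\<bar>inner (gF 0) ?x\<bar> \<le> (norm (gF 0))\<^sup>2 + (norm ?x)\<^sup>2"
      using Cauchy_Schwarz_ineq2[of "gF 0" ?x] sum_squares_bound[of "norm (gF 0)" "norm ?x"]
        mult_nonneg_nonneg[OF norm_ge_zero[of "gF 0"] norm_ge_zero[of ?x]] by linarith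
    ultimately have "\<bar>F ?x\<bar> \<le> ?b \<omega>" by (simp add: distrib_right)
    then show "norm (F ?x) \<le> norm (?b \<omega>)" by simp
  qed
qed

lemma \<Phi>_nonneg: "0 \<le> \<Phi> k"
proof -
  have "E (\<lambda>\<omega>. b) \<le> E (\<lambda>\<omega>. F (mean k \<omega>))" using b integrable_F_mean by (intro integral_mono) auto
  then show ?thesis by (simp add: \<Phi>_def M.prob_space)
qed

lemma gsq_le: "gsq k \<le> 4 * (L + 1) * \<Phi> k"
proof -
  have "gsq k \<le> E (\<lambda>\<omega>. 4 * (L + 1) * (F (mean k \<omega>) - b))"
    unfolding gsq_def using integrable_F_mean[of k] integrable_norm_square[OF adapted_gF[OF adapted_mean], of k]
    by (intro integral_mono grad_square_le_gap[OF problem.total_cost_differentiable L b]) auto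
  also have "\<dots> = 4 * (L + 1) * \<Phi> k" using integrable_F_mean[of k] by (simp add: \<Phi>_def M.prob_space)
  finally show ?thesis .
qed

text \<open>The only way in which sample errors enter the descent inequality with a single factor
  \<gamma>; estimating it by norms would not suffice.\<close>

definition cross :: "nat \<Rightarrow> real" where
  "cross k = E (\<lambda>\<omega>. inner (gF (mean k \<omega>)) (direction_noise k \<omega>))"

lemma mult_le_squares: "a * c \<le> a\<^sup>2 + c\<^sup>2" for a c :: real
  using sum_squares_bound[of a c] zero_le_power2[of a] zero_le_power2[of c] by (cases "a * c \<ge> 0") linarith+

text \<open>Smoothness is applied to the step of the weighted mean, with the direction written as
  \<open>w k\<close> times the gradient at the mean, plus an error, plus noise. In the product of
  gradient and error the whole factor \<gamma> goes to the gradient, so the error appears with its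
  plain square, which only has to be summable. The noise term is kept as an expectation.\<close>

lemma expected_descent:
  "\<gamma> k * \<psi> k (act k) * w k * gsq k \<le> \<Phi> k - \<Phi> (Suc k) + (\<gamma> k)\<^sup>2 * gsq k + L * (\<gamma> k)\<^sup>2 * dsq k
     + 2 * (\<Lambda>\<^sup>2 * (real (agents N))\<^sup>2) * ec k + 2 * tsq k + \<gamma> k * \<bar>cross k\<bar>"
proof -
  define c where "c = \<gamma> k * \<psi> k (act k)"
  let ?\<Lambda> = "\<Lambda>\<^sup>2 * (real (agents N))\<^sup>2"
  have c: "0 \<le> c" "c \<le> \<gamma> k"
    unfolding c_def using \<gamma>(1)[of k] \<psi>_weight[of k] by (auto simp: mult_left_le)
  have pointwise: "c * w k * (norm (gF (mean k \<omega>)))\<^sup>2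
      \<le> F (mean k \<omega>) - F (mean (Suc k) \<omega>) + (\<gamma> k)\<^sup>2 * (norm (gF (mean k \<omega>)))\<^sup>2
        + L * (\<gamma> k)\<^sup>2 * (norm (direction k \<omega>))\<^sup>2 + 2 * ?\<Lambda> * E_c N \<psi> (R \<omega>) k
        + 2 * (norm (tracking_error k \<omega>))\<^sup>2 - c * inner (gF (mean k \<omega>)) (direction_noise k \<omega>)"
    if \<omega>: "\<omega> \<in> space M" for \<omega>
  proof -
    let ?g = "gF (mean k \<omega>)" and ?z = "direction k \<omega>"
    let ?e = "w k *\<^sub>R (grad_sum k \<omega> - ?g) + tracking_error k \<omega>"
    have z: "?z = w k *\<^sub>R ?g + ?e + direction_noise k \<omega>"
      by (simp add: tracking_error_def scaleR_diff_right)
    have "F (mean (Suc k) \<omega>) \<le> F (mean k \<omega>) - c * inner ?g ?z + L * (c\<^sup>2 * (norm ?z)\<^sup>2)"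
      using F_remainder[of "mean (Suc k) \<omega>" "mean k \<omega>"]
      by (simp add: mean_Suc[OF \<omega>] c_def[symmetric] power_mult_distrib)
    moreover have "L * (c\<^sup>2 * (norm ?z)\<^sup>2) \<le> L * ((\<gamma> k)\<^sup>2 * (norm ?z)\<^sup>2)"
      using c L_nonneg by (intro mult_left_mono mult_right_mono power_mono) auto
    moreover have "inner ?g ?z = w k * (norm ?g)\<^sup>2 + inner ?g ?e + inner ?g (direction_noise k \<omega>)"
      by (subst z) (simp add: inner_add_right dot_square_norm)
    moreover have "- (c * inner ?g ?e) \<le> (\<gamma> k)\<^sup>2 * (norm ?g)\<^sup>2 + (norm ?e)\<^sup>2"
    proof -
      have "- (c * inner ?g ?e) \<le> c * (norm ?g * norm ?e)"
        using mult_left_mono[OF Cauchy_Schwarz_ineq2[of ?g ?e] c(1)] c(1)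
          abs_ge_minus_self[of "c * inner ?g ?e"] by (simp only: abs_mult abs_of_nonneg)
      also have "\<dots> \<le> \<gamma> k * (norm ?g * norm ?e)" using c by (intro mult_right_mono) auto
      also have "\<dots> \<le> (\<gamma> k)\<^sup>2 * (norm ?g)\<^sup>2 + (norm ?e)\<^sup>2"
        using mult_le_squares[of "\<gamma> k * norm ?g" "norm ?e"] by (simp add: power_mult_distrib mult.assoc)
      finally show ?thesis .
    qed
    moreover have "(norm ?e)\<^sup>2 \<le> 2 * ?\<Lambda> * E_c N \<psi> (R \<omega>) k + 2 * (norm (tracking_error k \<omega>))\<^sup>2"
    proof -
      have "(norm (w k *\<^sub>R (grad_sum k \<omega> - ?g)))\<^sup>2 \<le> (norm (grad_sum k \<omega> - ?g))\<^sup>2"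
        using weight[of k] by (intro power_mono) (auto simp: mult_left_le_one_le)
      then show ?thesis
        using norm_add_square_le[of "w k *\<^sub>R (grad_sum k \<omega> - ?g)" "tracking_error k \<omega>"]
          mean_gradient_error[OF \<omega>, of k] by linarith
    qed
    ultimately show ?thesis by (simp add: distrib_left algebra_simps)
  qed
  note int = integrable_F_mean integrable_norm_square[OF adapted_gF[OF adapted_mean], of k]
    integrable_norm_square[OF adapted_direction[OF order_refl], of k] integrable_E_c
    integrable_norm_square[OF adapted_tracking_error, of k]
    integrable_inner[OF adapted_gF[OF adapted_mean] adapted_direction_noise, of k]
  have "E (\<lambda>\<omega>. c * w k * (norm (gF (mean k \<omega>)))\<^sup>2)
      \<le> E (\<lambda>\<omega>. F (mean k \<omega>) - F (mean (Suc k) \<omega>) + (\<gamma> k)\<^sup>2 * (norm (gF (mean k \<omega>)))\<^sup>2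
        + L * (\<gamma> k)\<^sup>2 * (norm (direction k \<omega>))\<^sup>2 + 2 * ?\<Lambda> * E_c N \<psi> (R \<omega>) k
        + 2 * (norm (tracking_error k \<omega>))\<^sup>2 - c * inner (gF (mean k \<omega>)) (direction_noise k \<omega>))"
    by (rule integral_mono) (use int pointwise in auto)
  also have "\<dots> = E (\<lambda>\<omega>. F (mean k \<omega>)) - E (\<lambda>\<omega>. F (mean (Suc k) \<omega>)) + (\<gamma> k)\<^sup>2 * gsq k + L * (\<gamma> k)\<^sup>2 * dsq k
     + 2 * ?\<Lambda> * ec k + 2 * tsq k - c * cross k"
    unfolding gsq_def dsq_def ec_def tsq_def cross_def using int by simp
  finally have "c * w k * gsq k \<le> \<Phi> k - \<Phi> (Suc k) + (\<gamma> k)\<^sup>2 * gsq k + L * (\<gamma> k)\<^sup>2 * dsq k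
     + 2 * ?\<Lambda> * ec k + 2 * tsq k - c * cross k"
    using int(2) by (simp add: \<Phi>_def gsq_def)
  moreover have "- (c * cross k) \<le> \<gamma> k * \<bar>cross k\<bar>"
  proof -
    have "- (c * cross k) \<le> \<bar>c * cross k\<bar>" by (rule abs_ge_minus_self)
    also have "\<dots> = c * \<bar>cross k\<bar>" using c(1) by (simp only: abs_mult abs_of_nonneg)
    also have "\<dots> \<le> \<gamma> k * \<bar>cross k\<bar>" using c by (intro mult_right_mono) auto
    finally show ?thesis .
  qed
  ultimately show ?thesis unfolding c_def[symmetric] by linarith
qed

text \<open>Since \<open>w k\<close> lies in [0, 1], its square is at most \<open>w k\<close>. One
  factor is kept on the squared gradient, because the descent inequality controls exactly this
  weighted quantity.\<close>

lemma ez_le: "ez k \<le> 2 * et k + 4 * (w k * gsq k) + 4 * (\<Lambda>\<^sup>2 * (real (agents N))\<^sup>2) * ec k"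
proof -
  let ?\<Lambda> = "\<Lambda>\<^sup>2 * (real (agents N))\<^sup>2"
  have pointwise: "E_z N G (R \<omega>) k \<le> 2 * E_t N G \<xi> (R \<omega>) k + 4 * (w k * (norm (gF (mean k \<omega>)))\<^sup>2) + 4 * ?\<Lambda> * E_c N \<psi> (R \<omega>) k"
    if \<omega>: "\<omega> \<in> space M" for \<omega>
  proof -
    let ?g = "gF (mean k \<omega>)" and ?S = "grad_sum k \<omega>"
    have "E_z N G (R \<omega>) k \<le> 2 * E_t N G \<xi> (R \<omega>) k + 2 * (norm (w k *\<^sub>R ?S))\<^sup>2"
      unfolding E_z_eq[OF \<omega>] E_t_eq[OF \<omega>]
      using norm_add_square_le[of "G (act k) (X k (act k) \<omega>) - w k *\<^sub>R ?S" "w k *\<^sub>R ?S"] by simp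
    moreover have "(norm (w k *\<^sub>R ?S))\<^sup>2 \<le> w k * (norm ?S)\<^sup>2"
    proof -
      have "(w k)\<^sup>2 \<le> w k" using weight[of k] by (simp add: power2_eq_square mult_left_le)
      then show ?thesis by (simp add: power_mult_distrib mult_right_mono)
    qed
    moreover have "w k * (norm ?S)\<^sup>2 \<le> w k * (2 * (norm ?g)\<^sup>2 + 2 * (norm (?S - ?g))\<^sup>2)"
      using norm_add_square_le[of ?g "?S - ?g"] weight[of k] by (intro mult_left_mono) auto
    moreover have "w k * (norm (?S - ?g))\<^sup>2 \<le> 1 * (norm (?S - ?g))\<^sup>2"
      using weight[of k] by (intro mult_right_mono) auto
    ultimately show ?thesis using mean_gradient_error[OF \<omega>, of k] by (simp add: distrib_left)
  qed
  note int = integrable_E_t[of k] integrable_E_c[of k] integrable_E_z[of k]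
    integrable_norm_square[OF adapted_gF[OF adapted_mean], of k]
  have "ez k \<le> E (\<lambda>\<omega>. 2 * E_t N G \<xi> (R \<omega>) k + 4 * (w k * (norm (gF (mean k \<omega>)))\<^sup>2) + 4 * ?\<Lambda> * E_c N \<psi> (R \<omega>) k)"
    unfolding ez_def by (rule integral_mono) (use int pointwise in auto)
  also have "\<dots> = 2 * et k + 4 * (w k * gsq k) + 4 * ?\<Lambda> * ec k"
    unfolding et_def gsq_def ec_def using int by simp
  finally show ?thesis .
qed

text \<open>A sample error still in use at time \<open>t\<close> was drawn at most \<open>period N\<close> iterations earlier, whence the window.\<close>

definition drift :: "nat \<Rightarrow> nat \<Rightarrow> real" where
  "drift k t = L * (\<Sum>u | u < k \<and> t \<le> u + period N. \<gamma> u * (dsq u + \<sigma>\<^sup>2))"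

lemma drift_antimono: "s \<le> t \<Longrightarrow> drift k t \<le> drift k s"
  unfolding drift_def using L_nonneg \<gamma>(1) moments_nonneg(2)
  by (intro mult_left_mono sum_mono2) (auto intro!: mult_nonneg_nonneg less_imp_le[OF \<gamma>(1)] add_nonneg_nonneg)

lemma drift_nonneg: "0 \<le> drift k t"
  unfolding drift_def using L_nonneg \<gamma>(1) moments_nonneg(2)
  by (auto intro!: mult_nonneg_nonneg sum_nonneg less_imp_le[OF \<gamma>(1)] add_nonneg_nonneg)

text \<open>
  The sample error of iteration \<open>s\<close> is orthogonal to the gradient at \<open>mean s\<close>, so only the movement of
  the mean since then contributes.
\<close>

lemma gradient_sample_error_le:
  assumes "s < k"
  shows "\<bar>E (\<lambda>\<omega>. inner (gF (mean k \<omega>)) (sample_error s \<omega>))\<bar> \<le> L * (\<Sum>u=s..<k. \<gamma> u * (dsq u + \<sigma>\<^sup>2))"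
proof -
  note e = sample_error_adapted(1)[OF adapted_next[of s]]
  have ek: "adapted k (sample_error s)" by (rule adapted_mono[OF _ e]) (use assms in simp)
  note gk = adapted_gF[OF adapted_mean[of k]]
  have gs: "adapted k (\<lambda>\<omega>. gF (mean s \<omega>))" by (intro adapted_gF adapted_mean') (use assms in simp)
  have diff: "adapted k (\<lambda>\<omega>. gF (mean k \<omega>) - gF (mean s \<omega>))" by (intro adapted_intros gk gs)
  have prod: "integrable M (\<lambda>\<omega>. norm (direction u \<omega>) * norm (sample_error s \<omega>))" if "u \<in> {s..<k}" for u
    by (rule integrable_norms[of k]) (use that ek adapted_direction[of u k] in auto)
  have eq: "E (\<lambda>\<omega>. inner (gF (mean k \<omega>)) (sample_error s \<omega>))
      = E (\<lambda>\<omega>. inner (gF (mean k \<omega>) - gF (mean s \<omega>)) (sample_error s \<omega>))"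
    using integrable_inner[OF gk ek] integrable_inner[OF gs ek]
      sample_error_orthogonal[OF adapted_gF[OF adapted_mean], of s]
    by (simp add: inner_diff_left)
  have "\<bar>E (\<lambda>\<omega>. inner (gF (mean k \<omega>)) (sample_error s \<omega>))\<bar>
      \<le> E (\<lambda>\<omega>. \<bar>inner (gF (mean k \<omega>) - gF (mean s \<omega>)) (sample_error s \<omega>)\<bar>)"
    unfolding eq by (rule integral_abs_bound)
  also have "\<dots> \<le> E (\<lambda>\<omega>. L * (\<Sum>u=s..<k. \<gamma> u * (norm (direction u \<omega>) * norm (sample_error s \<omega>))))"
  proof (rule integral_mono)
    show "integrable M (\<lambda>\<omega>. \<bar>inner (gF (mean k \<omega>) - gF (mean s \<omega>)) (sample_error s \<omega>)\<bar>)"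
      by (rule integrable_abs[OF integrable_inner[OF diff ek]])
    show "integrable M (\<lambda>\<omega>. L * (\<Sum>u=s..<k. \<gamma> u * (norm (direction u \<omega>) * norm (sample_error s \<omega>))))"
      by (intro integrable_mult_right Bochner_Integration.integrable_sum prod)
    fix \<omega> assume \<omega>: "\<omega> \<in> space M"
    have "\<bar>inner (gF (mean k \<omega>) - gF (mean s \<omega>)) (sample_error s \<omega>)\<bar>
        \<le> norm (gF (mean k \<omega>) - gF (mean s \<omega>)) * norm (sample_error s \<omega>)"
      by (rule Cauchy_Schwarz_ineq2)
    also have "\<dots> \<le> (L * norm (mean k \<omega> - mean s \<omega>)) * norm (sample_error s \<omega>)"
      using lipschitz_onD[OF L] by (intro mult_right_mono) (auto simp: dist_norm)
    also have "\<dots> \<le> (L * (\<Sum>u=s..<k. \<gamma> u * norm (direction u \<omega>))) * norm (sample_error s \<omega>)"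
      using norm_mean_diff_le[OF \<omega>, of s k] assms L_nonneg by (intro mult_right_mono mult_left_mono) auto
    finally show "\<bar>inner (gF (mean k \<omega>) - gF (mean s \<omega>)) (sample_error s \<omega>)\<bar>
        \<le> L * (\<Sum>u=s..<k. \<gamma> u * (norm (direction u \<omega>) * norm (sample_error s \<omega>)))"
      by (simp add: sum_distrib_right mult.assoc)
  qed
  also have "\<dots> = L * (\<Sum>u=s..<k. \<gamma> u * E (\<lambda>\<omega>. norm (direction u \<omega>) * norm (sample_error s \<omega>)))"
    using prod by (subst integral_mult_right_zero, subst Bochner_Integration.integral_sum) auto
  also have "\<dots> \<le> L * (\<Sum>u=s..<k. \<gamma> u * (dsq u + \<sigma>\<^sup>2))"
  proof (intro mult_left_mono sum_mono)
    fix u assume u: "u \<in> {s..<k}"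
    have "E (\<lambda>\<omega>. norm (direction u \<omega>) * norm (sample_error s \<omega>))
        \<le> E (\<lambda>\<omega>. (norm (direction u \<omega>))\<^sup>2 + (norm (sample_error s \<omega>))\<^sup>2)"
      using integrable_norm_square[OF adapted_direction[OF order_refl]] integrable_norm_square[OF e]
      by (intro integral_mono prod[OF u] mult_le_squares) auto
    also have "\<dots> = dsq u + \<sigma>\<^sup>2"
      using integrable_norm_square[OF adapted_direction[OF order_refl]] integrable_norm_square[OF e]
        sample_error_adapted(2)[OF adapted_next[of s]] by (simp add: dsq_def)
    finally show "E (\<lambda>\<omega>. norm (direction u \<omega>) * norm (sample_error s \<omega>)) \<le> dsq u + \<sigma>\<^sup>2" .
  qed (use L_nonneg \<gamma>(1) in \<open>auto intro: less_imp_le\<close>)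
  finally show ?thesis .
qed

text \<open>The error in use at time t is the sample error of the last activation s, and t <= s +
  \<open>period N\<close>; hence all iterations from s to k - 1 lie in the window of
  \<open>drift\<close>.\<close>

lemma gradient_\<epsilon>_le:
  assumes "j \<in> nodes N" "t \<le> k"
  shows "\<bar>E (\<lambda>\<omega>. inner (gF (mean k \<omega>)) (\<epsilon> t j \<omega>))\<bar> \<le> drift k t"
  using assms(1)
proof (rule last_activation[of j t])
  assume "\<And>s. s < t \<Longrightarrow> act s \<noteq> j"
  then have "\<epsilon> t j \<omega> = 0" if "\<omega> \<in> space M" for \<omega>
    unfolding \<epsilon>_def by (intro async_run.noise_before_activation[OF runs[OF that]])
  then have "E (\<lambda>\<omega>. inner (gF (mean k \<omega>)) (\<epsilon> t j \<omega>)) = E (\<lambda>\<omega>. 0)"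
    by (intro Bochner_Integration.integral_cong) auto
  then show ?thesis using drift_nonneg by simp
next
  fix s assume s: "s < t" "t \<le> s + period N" "act s = j" "\<And>u. s < u \<Longrightarrow> u < t \<Longrightarrow> act u \<noteq> j"
  have "\<epsilon> t j \<omega> = sample_error s \<omega>" if "\<omega> \<in> space M" for \<omega>
  proof -
    have "\<epsilon> t j \<omega> = \<epsilon> (Suc s) j \<omega>"
      unfolding \<epsilon>_def by (intro async_run.noise_unchanged[OF runs[OF that]] s)
    then show ?thesis using s(3) \<epsilon>_rec(2)[OF that] by simp
  qed
  then have eq: "E (\<lambda>\<omega>. inner (gF (mean k \<omega>)) (\<epsilon> t j \<omega>)) = E (\<lambda>\<omega>. inner (gF (mean k \<omega>)) (sample_error s \<omega>))"
    by (intro Bochner_Integration.integral_cong) auto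
  have "\<bar>E (\<lambda>\<omega>. inner (gF (mean k \<omega>)) (\<epsilon> t j \<omega>))\<bar> \<le> L * (\<Sum>u=s..<k. \<gamma> u * (dsq u + \<sigma>\<^sup>2))"
    unfolding eq by (rule gradient_sample_error_le) (use s assms in simp)
  also have "\<dots> \<le> drift k t"
    unfolding drift_def using L_nonneg s moments_nonneg(2)
    by (intro mult_left_mono sum_mono2) (auto intro!: mult_nonneg_nonneg less_imp_le[OF \<gamma>(1)] add_nonneg_nonneg)
  finally show ?thesis .
qed

text \<open>The current errors contribute \<open>agents N\<close> terms of weight at most 1; each
  increment contributes two errors with weight K * r ^ (k - t). This explains the factor in
  front.\<close>

lemma cross_le_drift: "\<bar>cross k\<bar> \<le> (real (agents N) + 2 * K) * (\<Sum>t\<le>k. r ^ (k - t) * drift k t)"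
proof -
  let ?i = "\<lambda>t j. E (\<lambda>\<omega>. inner (gF (mean k \<omega>)) (\<epsilon> t j \<omega>))"
  have int: "integrable M (\<lambda>\<omega>. inner (gF (mean k \<omega>)) (\<epsilon> t j \<omega>))" if "t \<le> k" for t j
    by (rule integrable_inner[OF adapted_gF[OF adapted_mean] adapted_\<epsilon>'[OF that]])
  have "cross k = E (\<lambda>\<omega>. w k * (\<Sum>j\<in>nodes N. inner (gF (mean k \<omega>)) (\<epsilon> k j \<omega>))
      + (\<Sum>t<k. gap k t * (inner (gF (mean k \<omega>)) (\<epsilon> (Suc t) (act t) \<omega>) - inner (gF (mean k \<omega>)) (\<epsilon> t (act t) \<omega>))))"
    unfolding cross_def direction_noise_def by (simp add: inner_add_right inner_sum_right inner_diff_right)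
  also have "\<dots> = w k * (\<Sum>j\<in>nodes N. ?i k j) + (\<Sum>t<k. gap k t * (?i (Suc t) (act t) - ?i t (act t)))"
  proof -
    have 1: "E (\<lambda>\<omega>. \<Sum>t<k. gap k t * (inner (gF (mean k \<omega>)) (\<epsilon> (Suc t) (act t) \<omega>) - inner (gF (mean k \<omega>)) (\<epsilon> t (act t) \<omega>)))
        = (\<Sum>t<k. gap k t * (?i (Suc t) (act t) - ?i t (act t)))"
      using int by (subst Bochner_Integration.integral_sum) auto
    have 2: "E (\<lambda>\<omega>. \<Sum>j\<in>nodes N. inner (gF (mean k \<omega>)) (\<epsilon> k j \<omega>)) = (\<Sum>j\<in>nodes N. ?i k j)"
      using int by (intro Bochner_Integration.integral_sum) auto
    show ?thesis using int
      by (subst Bochner_Integration.integral_add) (auto simp: 1 2)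
  qed
  finally have "\<bar>cross k\<bar> \<le> \<bar>w k * (\<Sum>j\<in>nodes N. ?i k j)\<bar> + \<bar>\<Sum>t<k. gap k t * (?i (Suc t) (act t) - ?i t (act t))\<bar>"
    by (simp only: abs_triangle_ineq)
  also have "\<dots> \<le> real (agents N) * drift k k + (\<Sum>t<k. (2 * K) * (r ^ (k - t) * drift k t))"
  proof (rule add_mono)
    have "\<bar>\<Sum>j\<in>nodes N. ?i k j\<bar> \<le> (\<Sum>j\<in>nodes N. drift k k)"
      by (rule order_trans[OF sum_abs]) (intro sum_mono gradient_\<epsilon>_le order_refl)
    then have "\<bar>\<Sum>j\<in>nodes N. ?i k j\<bar> \<le> real (agents N) * drift k k" by (simp add: nodes_def)
    moreover have "\<bar>w k * (\<Sum>j\<in>nodes N. ?i k j)\<bar> \<le> \<bar>\<Sum>j\<in>nodes N. ?i k j\<bar>"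
      using weight[of k] by (simp add: abs_mult mult_left_le_one_le)
    ultimately show "\<bar>w k * (\<Sum>j\<in>nodes N. ?i k j)\<bar> \<le> real (agents N) * drift k k" by linarith
    show "\<bar>\<Sum>t<k. gap k t * (?i (Suc t) (act t) - ?i t (act t))\<bar> \<le> (\<Sum>t<k. (2 * K) * (r ^ (k - t) * drift k t))"
    proof (rule order_trans[OF sum_abs], rule sum_mono)
      fix t assume "t \<in> {..<k}"
      then have t: "t < k" by simp
      have "\<bar>?i (Suc t) (act t) - ?i t (act t)\<bar> \<le> 2 * drift k t"
        using gradient_\<epsilon>_le[OF active_node[of t], of "Suc t" k] gradient_\<epsilon>_le[OF active_node[of t], of t k]
          drift_antimono[of t "Suc t" k] t by linarith
      then have "\<bar>gap k t\<bar> * \<bar>?i (Suc t) (act t) - ?i t (act t)\<bar> \<le> (K * r ^ (k - t)) * (2 * drift k t)"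
        using gap_le[of t k] t K rate_bounds by (intro mult_mono) auto
      then show "\<bar>gap k t * (?i (Suc t) (act t) - ?i t (act t))\<bar> \<le> (2 * K) * (r ^ (k - t) * drift k t)"
        by (simp add: abs_mult mult_ac)
    qed
  qed
  also have "\<dots> \<le> (real (agents N) + 2 * K) * drift k k + (\<Sum>t<k. (real (agents N) + 2 * K) * (r ^ (k - t) * drift k t))"
    using K drift_nonneg rate_bounds by (intro add_mono sum_mono mult_right_mono) auto
  also have "\<dots> = (real (agents N) + 2 * K) * (\<Sum>t\<le>k. r ^ (k - t) * drift k t)"
    by (simp add: lessThan_Suc_atMost[symmetric] sum_distrib_left distrib_left)
  finally show ?thesis .
qed

text \<open>Exchanging the sums, the movement at u is counted for all t up to u +
  \<open>period N\<close>. Extending the geometric sum by one period costs the factor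
  \<open>r ^ period N\<close> in the denominator, and the decay in k - u survives.\<close>

lemma drift_convolution_le:
  "(\<Sum>t\<le>k. r ^ (k - t) * drift k t)
     \<le> L / (r ^ period N * (1 - r)) * (\<Sum>u<k. r ^ (k - u) * (\<gamma> u * (dsq u + \<sigma>\<^sup>2)))"
proof -
  have weights: "(\<Sum>t | t \<le> k \<and> t \<le> u + period N. r ^ (k - t)) \<le> r ^ (k - u) / (r ^ period N * (1 - r))"
    if u: "u < k" for u
  proof -
    have "(\<Sum>t | t \<le> k \<and> t \<le> u + period N. r ^ (k - t)) * r ^ period N
        = (\<Sum>t | t \<le> k \<and> t \<le> u + period N. r ^ (k - u) * r ^ (u + period N - t))"
      unfolding sum_distrib_right
      by (intro sum.cong refl) (use u in \<open>auto simp: power_add[symmetric]\<close>)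
    also have "\<dots> \<le> r ^ (k - u) * (\<Sum>t\<le>u + period N. r ^ (u + period N - t))"
      unfolding sum_distrib_left[symmetric] using rate_bounds by (intro mult_left_mono sum_mono2) auto
    also have "\<dots> \<le> r ^ (k - u) * (1 / (1 - r))"
      using sum_geometric_le(2)[OF rate_bounds] rate_bounds by (intro mult_left_mono) auto
    finally show ?thesis using rate_bounds by (simp add: field_simps)
  qed
  have "(\<Sum>t\<le>k. r ^ (k - t) * drift k t)
      = L * (\<Sum>t\<in>{..k}. \<Sum>u | u \<in> {..<k} \<and> t \<le> u + period N. r ^ (k - t) * (\<gamma> u * (dsq u + \<sigma>\<^sup>2)))"
    unfolding drift_def by (simp add: sum_distrib_left mult_ac)
  also have "\<dots> = L * (\<Sum>u\<in>{..<k}. \<Sum>t | t \<in> {..k} \<and> t \<le> u + period N. r ^ (k - t) * (\<gamma> u * (dsq u + \<sigma>\<^sup>2)))"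
    by (subst sum.swap_restrict) auto
  also have "\<dots> \<le> L * (\<Sum>u\<in>{..<k}. r ^ (k - u) / (r ^ period N * (1 - r)) * (\<gamma> u * (dsq u + \<sigma>\<^sup>2)))"
  proof (intro mult_left_mono sum_mono)
    fix u assume "u \<in> {..<k}"
    then have u: "u < k" by simp
    have "0 \<le> \<gamma> u * (dsq u + \<sigma>\<^sup>2)" using \<gamma>(1)[of u] moments_nonneg(2)[of u] by simp
    from mult_right_mono[OF weights[OF u] this]
    show "(\<Sum>t | t \<in> {..k} \<and> t \<le> u + period N. r ^ (k - t) * (\<gamma> u * (dsq u + \<sigma>\<^sup>2)))
        \<le> r ^ (k - u) / (r ^ period N * (1 - r)) * (\<gamma> u * (dsq u + \<sigma>\<^sup>2))"
      by (simp add: sum_distrib_right)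
  qed (rule L_nonneg)
  also have "\<dots> = L / (r ^ period N * (1 - r)) * (\<Sum>u<k. r ^ (k - u) * (\<gamma> u * (dsq u + \<sigma>\<^sup>2)))"
    by (simp add: sum_distrib_left)
  finally show ?thesis .
qed

text \<open>One factor 1 / (1 - r) stems from the Cauchy-Schwarz inequality for the convolution, the
  other from summing its kernel. There is no factor \<gamma>: the noise in the direction does not
  decay, but the squared direction is always accompanied by two step sizes.\<close>

definition noise_bound :: real where
  "noise_bound = K\<^sup>2 * (1 / (1 - r)) * (1 / (1 - r)) * (4 * (real (agents N))\<^sup>2 * \<sigma>\<^sup>2)"

lemma direction_noise_second_moment: "E (\<lambda>\<omega>. (norm (direction_noise k \<omega>))\<^sup>2) \<le> noise_bound"
proof -
  let ?W = "\<lambda>t \<omega>. \<Sum>j\<in>nodes N. norm (\<epsilon> t j \<omega>) + norm (\<epsilon> (Suc t) j \<omega>)"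
  define Q where "Q t \<omega> = (\<Sum>j\<in>nodes N. 2 * (norm (\<epsilon> t j \<omega>))\<^sup>2 + 2 * (norm (\<epsilon> (Suc t) j \<omega>))\<^sup>2)" for t \<omega>
  let ?R = "1 / (1 - r)"
  have R: "0 \<le> ?R" using rate_bounds by simp
  have W: "(?W t \<omega>)\<^sup>2 \<le> real (agents N) * Q t \<omega>" for t \<omega>
  proof -
    have "(?W t \<omega>)\<^sup>2 \<le> real (card (nodes N)) * (\<Sum>j\<in>nodes N. (norm (\<epsilon> t j \<omega>) + norm (\<epsilon> (Suc t) j \<omega>))\<^sup>2)"
      by (rule square_sum_le)
    also have "\<dots> \<le> real (card (nodes N)) * Q t \<omega>"
      unfolding Q_def using norm_add_square_le[of "norm (\<epsilon> t _ \<omega>)" "norm (\<epsilon> (Suc t) _ \<omega>)"]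
      by (intro mult_left_mono sum_mono) auto
    finally show ?thesis by (simp add: nodes_def)
  qed
  have pointwise: "(norm (direction_noise k \<omega>))\<^sup>2
      \<le> K\<^sup>2 * (?R * (\<Sum>t\<le>k. r ^ (k - t) * (real (agents N) * Q t \<omega>)))" if \<omega>: "\<omega> \<in> space M" for \<omega>
  proof -
    have "norm (direction_noise k \<omega>) \<le> K * (\<Sum>t\<le>k. r ^ (k - t) * ?W t \<omega>)"
      unfolding direction_noise_eq[OF \<omega>] \<epsilon>_def by (rule tracked_run.norm_noise_part_le[OF tracked[OF \<omega>]])
    then have "(norm (direction_noise k \<omega>))\<^sup>2 \<le> K\<^sup>2 * (\<Sum>t\<le>k. r ^ (k - t) * ?W t \<omega>)\<^sup>2"
      unfolding power_mult_distrib[symmetric] by (intro power_mono) auto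
    also have "\<dots> \<le> K\<^sup>2 * (?R * (\<Sum>t\<le>k. r ^ (k - t) * (?W t \<omega>)\<^sup>2))"
      by (intro mult_left_mono geometric_convolution_square rate_bounds) auto
    also have "\<dots> \<le> K\<^sup>2 * (?R * (\<Sum>t\<le>k. r ^ (k - t) * (real (agents N) * Q t \<omega>)))"
      using W rate_bounds R by (intro mult_left_mono sum_mono) auto
    finally show ?thesis .
  qed
  have intQ: "integrable M (Q t)" and EQ: "E (Q t) \<le> 4 * real (agents N) * \<sigma>\<^sup>2" for t
  proof -
    note int = integrable_norm_square[OF adapted_\<epsilon>]
    show "integrable M (Q t)" unfolding Q_def[abs_def] using int by auto
    have "E (Q t) = (\<Sum>j\<in>nodes N. 2 * E (\<lambda>\<omega>. (norm (\<epsilon> t j \<omega>))\<^sup>2) + 2 * E (\<lambda>\<omega>. (norm (\<epsilon> (Suc t) j \<omega>))\<^sup>2))"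
      unfolding Q_def[abs_def] using int by (subst Bochner_Integration.integral_sum) auto
    also have "\<dots> \<le> (\<Sum>j\<in>nodes N. 2 * \<sigma>\<^sup>2 + 2 * \<sigma>\<^sup>2)"
      by (intro sum_mono add_mono mult_left_mono \<epsilon>_second_moment) auto
    finally show "E (Q t) \<le> 4 * real (agents N) * \<sigma>\<^sup>2" by (simp add: nodes_def mult_ac)
  qed
  have "E (\<lambda>\<omega>. (norm (direction_noise k \<omega>))\<^sup>2) \<le> E (\<lambda>\<omega>. K\<^sup>2 * (?R * (\<Sum>t\<le>k. r ^ (k - t) * (real (agents N) * Q t \<omega>))))"
    using intQ by (intro integral_mono pointwise integrable_norm_square[OF adapted_direction_noise]
        integrable_mult_right Bochner_Integration.integrable_sum) auto
  also have "\<dots> = K\<^sup>2 * (?R * (\<Sum>t\<le>k. r ^ (k - t) * (real (agents N) * E (Q t))))"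
    using intQ by (simp only: integral_mult_right_zero Bochner_Integration.integral_sum integrable_mult_right)
  also have "\<dots> \<le> K\<^sup>2 * (?R * (\<Sum>t\<le>k. r ^ (k - t) * (real (agents N) * (4 * real (agents N) * \<sigma>\<^sup>2))))"
    using EQ R rate_bounds by (intro mult_left_mono sum_mono) auto
  also have "\<dots> = K\<^sup>2 * ?R * (4 * (real (agents N))\<^sup>2 * \<sigma>\<^sup>2) * (\<Sum>t\<le>k. r ^ (k - t))"
    unfolding sum_distrib_right[symmetric] by (simp add: power2_eq_square mult_ac)
  also have "\<dots> \<le> K\<^sup>2 * ?R * (4 * (real (agents N))\<^sup>2 * \<sigma>\<^sup>2) * ?R"
    using sum_geometric_le(2)[OF rate_bounds] R by (intro mult_left_mono) auto
  finally show ?thesis by (simp add: noise_bound_def mult_ac)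
qed

lemma dsq_le: "dsq k \<le> 4 * (gsq k + \<Lambda>\<^sup>2 * (real (agents N))\<^sup>2 * ec k + noise_bound + tsq k)"
proof -
  let ?\<Lambda> = "\<Lambda>\<^sup>2 * (real (agents N))\<^sup>2"
  have pointwise: "(norm (direction k \<omega>))\<^sup>2 \<le> 4 * (norm (gF (mean k \<omega>)))\<^sup>2 + 4 * (?\<Lambda> * E_c N \<psi> (R \<omega>) k)
      + 4 * (norm (direction_noise k \<omega>))\<^sup>2 + 4 * (norm (tracking_error k \<omega>))\<^sup>2" if \<omega>: "\<omega> \<in> space M" for \<omega>
  proof -
    let ?g = "gF (mean k \<omega>)" and ?n = "direction_noise k \<omega>" and ?t = "tracking_error k \<omega>"
    have "direction k \<omega> = w k *\<^sub>R (?g + (grad_sum k \<omega> - ?g)) + (?n + ?t)"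
      by (simp add: tracking_error_def)
    then have "(norm (direction k \<omega>))\<^sup>2 \<le> 2 * (norm (w k *\<^sub>R (?g + (grad_sum k \<omega> - ?g))))\<^sup>2 + 2 * (norm (?n + ?t))\<^sup>2"
      by (simp only: norm_add_square_le)
    moreover have "(norm (w k *\<^sub>R (?g + (grad_sum k \<omega> - ?g))))\<^sup>2 \<le> (norm (?g + (grad_sum k \<omega> - ?g)))\<^sup>2"
      using weight[of k] by (intro power_mono) (auto simp: mult_left_le_one_le)
    ultimately show ?thesis
      using norm_add_square_le[of ?g "grad_sum k \<omega> - ?g"] norm_add_square_le[of ?n ?t]
        mean_gradient_error[OF \<omega>, of k] by linarith
  qed
  note int = integrable_norm_square[OF adapted_gF[OF adapted_mean], of k] integrable_E_c[of k]
    integrable_norm_square[OF adapted_direction_noise, of k] integrable_norm_square[OF adapted_tracking_error, of k]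
    integrable_norm_square[OF adapted_direction[OF order_refl], of k]
  have "dsq k \<le> E (\<lambda>\<omega>. 4 * (norm (gF (mean k \<omega>)))\<^sup>2 + 4 * (?\<Lambda> * E_c N \<psi> (R \<omega>) k)
      + 4 * (norm (direction_noise k \<omega>))\<^sup>2 + 4 * (norm (tracking_error k \<omega>))\<^sup>2)"
    unfolding dsq_def by (rule integral_mono) (use int pointwise in auto)
  also have "\<dots> = 4 * gsq k + 4 * (?\<Lambda> * ec k) + 4 * E (\<lambda>\<omega>. (norm (direction_noise k \<omega>))\<^sup>2) + 4 * tsq k"
    unfolding gsq_def ec_def tsq_def using int by simp
  finally show ?thesis using direction_noise_second_moment[of k] by (simp add: distrib_left)
qed

text \<open>On each path the tracking error is a geometric convolution of \<open>drive\<close>, so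
  its squares are summed by Young's inequality before expectations are taken. The movement of an
  iterate is bounded by \<open>E_c\<close> and the scaled direction; starting values and initial
  errors give the constant.\<close>

lemma sum_tsq_le:
  "\<exists>B\<ge>0. \<forall>n. (\<Sum>k\<le>n. tsq k) \<le> B + K\<^sup>2 * (1 / (1 - r))\<^sup>2 * (24 * \<Lambda>\<^sup>2) * (\<Sum>k\<le>n. ec k + (\<gamma> k)\<^sup>2 * dsq k)"
proof -
  let ?c = "K\<^sup>2 * (1 / (1 - r))\<^sup>2"
  define \<iota> where "\<iota> j \<omega> = Y 0 j \<omega> - G j (X 0 j \<omega>) - \<epsilon> 0 j \<omega>" for j \<omega>
  define I where "I \<omega> = real (agents N) * (\<Sum>j\<in>nodes N. (norm (\<iota> j \<omega>))\<^sup>2)" for \<omega>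
  define J where "J \<omega> = real (agents N) * (\<Sum>j\<in>nodes N. (norm (Y 0 j \<omega>))\<^sup>2)" for \<omega>
  have ad: "adapted 0 (\<iota> j)" "adapted 0 (Y 0 j)" if "j \<in> nodes N" for j
    unfolding \<iota>_def[abs_def] using that
    by (auto intro!: adapted_intros adapted_vars adapted_true_grad adapted_\<epsilon>)
  have int: "integrable M I" "integrable M J"
    unfolding I_def[abs_def] J_def[abs_def] using ad by (auto intro!: integrable_norm_square[of 0])
  have nonneg: "0 \<le> I \<omega>" "0 \<le> J \<omega>" for \<omega> by (auto simp: I_def J_def intro!: sum_nonneg mult_nonneg_nonneg)
  have pointwise: "(\<Sum>k\<le>n. (norm (tracking_error k \<omega>))\<^sup>2)
      \<le> ?c * (24 * \<Lambda>\<^sup>2 * (\<Sum>k\<le>n. E_c N \<psi> (R \<omega>) k + (\<gamma> k)\<^sup>2 * (norm (direction k \<omega>))\<^sup>2)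
          + (3 * real (period N) * I \<omega> + 3 * J \<omega>))" if \<omega>: "\<omega> \<in> space M" for n \<omega>
  proof -
    interpret run: tracked_run N "sample_grad f" \<gamma> "\<zeta>_init \<omega>" "\<lambda>k. \<zeta> k \<omega>" "R \<omega>" \<xi> r K \<Lambda> G
      by (rule tracked[OF \<omega>])
    \<comment> \<open>24 = 3 * 8: the 3 from squaring a sum of three terms, the 8 = 2 * 2 * 2 from
      squaring the bound of \<open>norm_x_diff_le\<close>. The initial errors count only during the
      first period.\<close>
    have drive: "(run.drive t)\<^sup>2 \<le> 24 * \<Lambda>\<^sup>2 * (E_c N \<psi> (R \<omega>) t + (\<gamma> t)\<^sup>2 * (norm (direction t \<omega>))\<^sup>2)
       + ((if t < period N then 3 * I \<omega> else 0) + (if t = 0 then 3 * J \<omega> else 0))" for t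
    proof -
      let ?a = "\<Lambda> * norm (X (Suc t) (act t) \<omega> - X t (act t) \<omega>)"
      let ?i = "\<Sum>j\<in>nodes N. norm (run.init_noise G t j)"
      let ?j = "if t = 0 then \<Sum>q\<in>nodes N. norm (run.last_grad 0 q) else 0"
      have Ec: "0 \<le> E_c N \<psi> (R \<omega>) t" by (simp add: E_c_def sum_nonneg)
      have "(run.drive t)\<^sup>2 \<le> 3 * ?a\<^sup>2 + 3 * ?i\<^sup>2 + 3 * ?j\<^sup>2"
        unfolding run.drive_def by (rule square_add3_le)
      moreover have "?a\<^sup>2 \<le> 8 * \<Lambda>\<^sup>2 * (E_c N \<psi> (R \<omega>) t + (\<gamma> t)\<^sup>2 * (norm (direction t \<omega>))\<^sup>2)"
      proof -
        have "(norm (X (Suc t) (act t) \<omega> - X t (act t) \<omega>))\<^sup>2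
            \<le> (2 * sqrt (E_c N \<psi> (R \<omega>) t) + \<gamma> t * norm (direction t \<omega>))\<^sup>2"
          using run.norm_x_diff_le[of t \<psi>] \<gamma>(1)[of t] by (intro power_mono) auto
        also have "\<dots> \<le> 2 * (2 * sqrt (E_c N \<psi> (R \<omega>) t))\<^sup>2 + 2 * (\<gamma> t * norm (direction t \<omega>))\<^sup>2"
          using norm_add_square_le[of "2 * sqrt (E_c N \<psi> (R \<omega>) t)" "\<gamma> t * norm (direction t \<omega>)"] by simp
        also have "\<dots> \<le> 8 * (E_c N \<psi> (R \<omega>) t + (\<gamma> t)\<^sup>2 * (norm (direction t \<omega>))\<^sup>2)"
          using Ec by (simp add: power_mult_distrib)
        finally have "\<Lambda>\<^sup>2 * (norm (X (Suc t) (act t) \<omega> - X t (act t) \<omega>))\<^sup>2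
            \<le> \<Lambda>\<^sup>2 * (8 * (E_c N \<psi> (R \<omega>) t + (\<gamma> t)\<^sup>2 * (norm (direction t \<omega>))\<^sup>2))"
          by (rule mult_left_mono) simp
        then show ?thesis by (simp add: power_mult_distrib algebra_simps)
      qed
      moreover have "?i\<^sup>2 \<le> (if t < period N then I \<omega> else 0)"
      proof (cases "t < period N")
        case True
        have "?i \<le> (\<Sum>j\<in>nodes N. norm (\<iota> j \<omega>))"
        proof (rule sum_mono)
          fix j assume "j \<in> nodes N"
          from run.norm_init_noise_le[OF this, of G t]
          show "norm (run.init_noise G t j) \<le> norm (\<iota> j \<omega>)" by (simp add: run.init_noise_def[of _ 0] \<iota>_def Y_def \<epsilon>_def)
        qed
        then have "?i\<^sup>2 \<le> (\<Sum>j\<in>nodes N. norm (\<iota> j \<omega>))\<^sup>2" by (intro power_mono sum_nonneg) auto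
        also have "\<dots> \<le> I \<omega>" using square_sum_le[of "\<lambda>j. norm (\<iota> j \<omega>)" "nodes N"] by (simp add: I_def nodes_def)
        finally show ?thesis using True by simp
      next
        case False
        then have "?i = 0" using run.init_noise_vanishes[of _ t G] by (intro sum.neutral) auto
        then show ?thesis using False by simp
      qed
      moreover have "?j\<^sup>2 \<le> (if t = 0 then J \<omega> else 0)"
        using square_sum_le[of "\<lambda>j. norm (Y 0 j \<omega>)" "nodes N"] by (simp add: J_def nodes_def Y_def del: run.last_grad.simps)
      ultimately show ?thesis by (auto split: if_splits)
    qed
    have "(\<Sum>k\<le>n. (norm (tracking_error k \<omega>))\<^sup>2) \<le> (\<Sum>k\<le>n. K\<^sup>2 * (\<Sum>t\<le>k. r ^ (k - t) * run.drive t)\<^sup>2)"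
      unfolding tracking_error_eq[OF \<omega>] power_mult_distrib[symmetric]
      by (intro sum_mono power_mono run.norm_tracking_part_le) auto
    also have "\<dots> \<le> K\<^sup>2 * ((1 / (1 - r))\<^sup>2 * (\<Sum>t\<le>n. (run.drive t)\<^sup>2))"
      unfolding sum_distrib_left[symmetric]
      by (intro mult_left_mono sum_geometric_convolution_square rate_bounds) auto
    also have "\<dots> = ?c * (\<Sum>t\<le>n. (run.drive t)\<^sup>2)" by simp
    also have "\<dots> \<le> ?c * (24 * \<Lambda>\<^sup>2 * (\<Sum>k\<le>n. E_c N \<psi> (R \<omega>) k + (\<gamma> k)\<^sup>2 * (norm (direction k \<omega>))\<^sup>2)
          + (3 * real (period N) * I \<omega> + 3 * J \<omega>))"
    proof (rule mult_left_mono)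
      have "(\<Sum>t\<le>n. if t < period N then 3 * I \<omega> else 0) = (\<Sum>t\<in>{..n} \<inter> {..<period N}. 3 * I \<omega>)"
        by (subst sum.inter_restrict) (auto intro!: sum.cong)
      also have "\<dots> \<le> (\<Sum>t<period N. 3 * I \<omega>)" by (rule sum_mono2) (use nonneg in auto)
      finally have 1: "(\<Sum>t\<le>n. if t < period N then 3 * I \<omega> else 0) \<le> 3 * real (period N) * I \<omega>" by simp
      have 2: "(\<Sum>t\<le>n. if t = 0 then 3 * J \<omega> else 0) = 3 * J \<omega>" by simp
      have "(\<Sum>t\<le>n. (run.drive t)\<^sup>2) \<le> (\<Sum>t\<le>n. 24 * \<Lambda>\<^sup>2 * (E_c N \<psi> (R \<omega>) t + (\<gamma> t)\<^sup>2 * (norm (direction t \<omega>))\<^sup>2)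
       + ((if t < period N then 3 * I \<omega> else 0) + (if t = 0 then 3 * J \<omega> else 0)))"
        by (rule sum_mono) (rule drive)
      also have "\<dots> = 24 * \<Lambda>\<^sup>2 * (\<Sum>k\<le>n. E_c N \<psi> (R \<omega>) k + (\<gamma> k)\<^sup>2 * (norm (direction k \<omega>))\<^sup>2)
          + ((\<Sum>t\<le>n. if t < period N then 3 * I \<omega> else 0) + (\<Sum>t\<le>n. if t = 0 then 3 * J \<omega> else 0))"
        by (simp only: sum.distrib sum_distrib_left distrib_left)
      finally show "(\<Sum>t\<le>n. (run.drive t)\<^sup>2) \<le> 24 * \<Lambda>\<^sup>2 * (\<Sum>k\<le>n. E_c N \<psi> (R \<omega>) k + (\<gamma> k)\<^sup>2 * (norm (direction k \<omega>))\<^sup>2)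
          + (3 * real (period N) * I \<omega> + 3 * J \<omega>)"
        using 1 2 by linarith
    qed simp
    finally show ?thesis .
  qed
  define B where "B = ?c * (3 * real (period N) * E I + 3 * E J)"
  have "0 \<le> B" unfolding B_def using nonneg
    by (intro mult_nonneg_nonneg add_nonneg_nonneg Bochner_Integration.integral_nonneg) auto
  moreover have "(\<Sum>k\<le>n. tsq k) \<le> B + ?c * (24 * \<Lambda>\<^sup>2) * (\<Sum>k\<le>n. ec k + (\<gamma> k)\<^sup>2 * dsq k)" for n
  proof -
    note ints = integrable_E_c integrable_norm_square[OF adapted_direction[OF order_refl]] int
    have ints': "integrable M (\<lambda>\<omega>. \<Sum>k\<le>n. E_c N \<psi> (R \<omega>) k + (\<gamma> k)\<^sup>2 * (norm (direction k \<omega>))\<^sup>2)"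
      by (intro Bochner_Integration.integrable_sum Bochner_Integration.integrable_add integrable_mult_right ints)
    have "(\<Sum>k\<le>n. tsq k) = E (\<lambda>\<omega>. \<Sum>k\<le>n. (norm (tracking_error k \<omega>))\<^sup>2)"
      unfolding tsq_def by (rule Bochner_Integration.integral_sum[symmetric])
        (rule integrable_norm_square[OF adapted_tracking_error])
    also have "\<dots> \<le> E (\<lambda>\<omega>. ?c * (24 * \<Lambda>\<^sup>2 * (\<Sum>k\<le>n. E_c N \<psi> (R \<omega>) k + (\<gamma> k)\<^sup>2 * (norm (direction k \<omega>))\<^sup>2)
          + (3 * real (period N) * I \<omega> + 3 * J \<omega>)))"
      by (intro integral_mono pointwise Bochner_Integration.integrable_sum Bochner_Integration.integrable_add
          integrable_mult_right ints ints' integrable_norm_square[OF adapted_tracking_error])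
    also have "\<dots> = ?c * (24 * \<Lambda>\<^sup>2 * E (\<lambda>\<omega>. \<Sum>k\<le>n. E_c N \<psi> (R \<omega>) k + (\<gamma> k)\<^sup>2 * (norm (direction k \<omega>))\<^sup>2)
          + (3 * real (period N) * E I + 3 * E J))"
      using ints' int by (simp del: Bochner_Integration.integral_sum)
    also have "E (\<lambda>\<omega>. \<Sum>k\<le>n. E_c N \<psi> (R \<omega>) k + (\<gamma> k)\<^sup>2 * (norm (direction k \<omega>))\<^sup>2)
       = (\<Sum>k\<le>n. ec k + (\<gamma> k)\<^sup>2 * dsq k)"
      unfolding ec_def dsq_def using ints by (subst Bochner_Integration.integral_sum) auto
    finally show ?thesis by (simp add: B_def distrib_left mult_ac)
  qed
  ultimately show ?thesis by blast
qed

end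

section \<open>Reduction to the estimate for real sequences\<close>

context tracked_sgd begin

lemma cross_le: "\<bar>cross k\<bar> \<le> (real (agents N) + 2 * K) * (L / (r ^ period N * (1 - r))) * (1 + \<sigma>\<^sup>2)
    * (\<Sum>s<k. r ^ (k - s) * (\<gamma> s * (dsq s + 1)))"
proof -
  let ?a = "real (agents N) + 2 * K" and ?b = "L / (r ^ period N * (1 - r))"
  have nonneg: "0 \<le> ?a" "0 \<le> ?b" using K L_nonneg rate_bounds by auto
  have "\<bar>cross k\<bar> \<le> ?a * (\<Sum>t\<le>k. r ^ (k - t) * drift k t)" by (rule cross_le_drift)
  also have "\<dots> \<le> ?a * (?b * (\<Sum>u<k. r ^ (k - u) * (\<gamma> u * (dsq u + \<sigma>\<^sup>2))))"
    by (intro mult_left_mono drift_convolution_le nonneg)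
  also have "\<dots> \<le> ?a * (?b * (\<Sum>u<k. r ^ (k - u) * (\<gamma> u * ((1 + \<sigma>\<^sup>2) * (dsq u + 1)))))"
    using rate_bounds moments_nonneg(2) \<gamma>(1)
    by (intro mult_left_mono sum_mono nonneg) (auto simp: algebra_simps intro: less_imp_le)
  also have "\<dots> = ?a * ?b * (1 + \<sigma>\<^sup>2) * (\<Sum>s<k. r ^ (k - s) * (\<gamma> s * (dsq s + 1)))"
    by (simp only: sum_distrib_left mult_ac)
  finally show ?thesis .
qed

text \<open>Brings the assumed bounds into the form with a single constant: the variance term is
  absorbed by \<open>ez l + 1\<close> at the price of the factor 1 + \<open>agents N\<close> *
  \<sigma> * \<sigma>.\<close>

lemma summed_error_weakened:
  assumes "0 \<le> C2" "C1 \<le> C" "C2 * (1 + real (agents N) * \<sigma>\<^sup>2) \<le> C"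
    and le: "S \<le> C1 + C2 * (\<Sum>l\<le>n. (\<gamma> l)\<^sup>2 * (ez l + real (agents N) * \<sigma>\<^sup>2))"
  shows "S \<le> C + C * (\<Sum>l\<le>n. (\<gamma> l)\<^sup>2 * (ez l + 1))"
proof -
  have "(\<Sum>l\<le>n. (\<gamma> l)\<^sup>2 * (ez l + real (agents N) * \<sigma>\<^sup>2))
      \<le> (\<Sum>l\<le>n. (\<gamma> l)\<^sup>2 * ((1 + real (agents N) * \<sigma>\<^sup>2) * (ez l + 1)))"
    using moments_nonneg(6) by (intro sum_mono mult_left_mono) (auto simp: algebra_simps)
  then have "C2 * (\<Sum>l\<le>n. (\<gamma> l)\<^sup>2 * (ez l + real (agents N) * \<sigma>\<^sup>2))
      \<le> C2 * (\<Sum>l\<le>n. (\<gamma> l)\<^sup>2 * ((1 + real (agents N) * \<sigma>\<^sup>2) * (ez l + 1)))"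
    using assms(1) by (rule mult_left_mono)
  also have "\<dots> = C2 * (1 + real (agents N) * \<sigma>\<^sup>2) * (\<Sum>l\<le>n. (\<gamma> l)\<^sup>2 * (ez l + 1))"
    by (simp only: sum_distrib_left mult_ac)
  also have "\<dots> \<le> C * (\<Sum>l\<le>n. (\<gamma> l)\<^sup>2 * (ez l + 1))"
    using assms(3) moments_nonneg(6) by (intro mult_right_mono sum_nonneg) auto
  finally show ?thesis using le assms(2) by linarith
qed

lemma weighted_merit_bounded:
  assumes \<eta>: "0 < \<eta>" "\<And>k. \<eta> \<le> \<psi> k (act k)" and sq: "summable (\<lambda>k. (\<gamma> k)\<^sup>2)"
    and C2: "0 \<le> C2c" "0 \<le> C2t"
    and hc: "\<And>n. (\<Sum>l\<le>n. ec l) \<le> C1c + C2c * (\<Sum>l\<le>n. (\<gamma> l)\<^sup>2 * (ez l + real (agents N) * \<sigma>\<^sup>2))"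
    and ht: "\<And>n. (\<Sum>l\<le>n. et l) \<le> C1t + C2t * (\<Sum>l\<le>n. (\<gamma> l)\<^sup>2 * (ez l + real (agents N) * \<sigma>\<^sup>2))"
  shows "\<exists>B. \<forall>n. (\<Sum>k\<le>n. \<gamma> k * (et k + ec k + ez k)) \<le> B"
proof -
  obtain B where B: "0 \<le> B"
    "\<And>n. (\<Sum>k\<le>n. tsq k) \<le> B + K\<^sup>2 * (1 / (1 - r))\<^sup>2 * (24 * \<Lambda>\<^sup>2) * (\<Sum>k\<le>n. ec k + (\<gamma> k)\<^sup>2 * dsq k)"
    using sum_tsq_le by blast
  define c1 where "c1 = 4 * (L + 1)"
  have c1: "0 \<le> c1" "L \<le> c1" using L_nonneg by (auto simp: c1_def)
  define \<Lambda>m where "\<Lambda>m = \<Lambda>\<^sup>2 * (real (agents N))\<^sup>2"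
  define c\<tau> where "c\<tau> = K\<^sup>2 * (1 / (1 - r))\<^sup>2 * (24 * \<Lambda>\<^sup>2)"
  define cx where "cx = (real (agents N) + 2 * K) * (L / (r ^ period N * (1 - r))) * (1 + \<sigma>\<^sup>2)"
  define cc where "cc = C2c * (1 + real (agents N) * \<sigma>\<^sup>2)"
  define ct where "ct = C2t * (1 + real (agents N) * \<sigma>\<^sup>2)"
  have nonneg: "0 \<le> \<Lambda>m" "0 \<le> c\<tau>" "0 \<le> cx" "0 \<le> cc" "0 \<le> ct" "0 \<le> noise_bound"
    unfolding \<Lambda>m_def c\<tau>_def cx_def cc_def ct_def noise_bound_def
    using K L_nonneg rate_bounds C2 by auto
  \<comment> \<open>\<open>C1c\<close> and \<open>C1t\<close> carry no sign, so nonnegative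
    majorants enter the common constant.\<close>
  obtain a1 a2 where a: "0 \<le> a1" "C1c \<le> a1" "0 \<le> a2" "C1t \<le> a2" using abs_ge_self abs_ge_zero by metis
  \<comment> \<open>One constant for all inequalities: the multiples 4 come from
    \<open>dsq_le\<close> and \<open>ez_le\<close>, and \<open>c1\<close> also dominates L.\<close>
  define KK where "KK = 4 * c1 + 4 * \<Lambda>m + 4 * noise_bound + 4 + B + c\<tau> + cx + cc + ct + a1 + a2"
  have KK: "0 \<le> KK" "c1 \<le> KK" "4 * c1 \<le> KK" "L \<le> KK" "2 * \<Lambda>m \<le> KK" "4 * \<Lambda>m \<le> KK" "4 \<le> KK" "2 \<le> KK"
    "4 * noise_bound \<le> KK" "B \<le> KK" "c\<tau> \<le> KK" "cx \<le> KK" "cc \<le> KK" "ct \<le> KK" "C1c \<le> KK" "C1t \<le> KK"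
    unfolding KK_def using nonneg B(1) c1 a by - linarith+
  note nn = moments_nonneg
  show ?thesis
  proof (rule weighted_errors_bounded[where \<xi> = w and \<Phi> = \<Phi> and G = gsq and Z = dsq and \<tau> = tsq and K = KK and \<eta> = \<eta> and r = r])
    fix k
    have G: "gsq k \<le> c1 * \<Phi> k" using gsq_le[of k] by (simp only: c1_def)
    then show "gsq k \<le> KK * \<Phi> k" using mult_right_mono[OF KK(2) \<Phi>_nonneg[of k]] by linarith
    show "\<eta> * (\<gamma> k * w k * gsq k) \<le> \<Phi> k - \<Phi> (Suc k) + KK * ((\<gamma> k)\<^sup>2 * (\<Phi> k + dsq k + 1))
       + KK * (ec k + tsq k) + KK * (\<gamma> k * (\<Sum>s<k. r ^ (k - s) * (\<gamma> s * (dsq s + 1))))"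
    proof -
      let ?S = "\<Sum>s<k. r ^ (k - s) * (\<gamma> s * (dsq s + 1))"
      have S: "0 \<le> ?S" using rate_bounds \<gamma>(1) nn(2)
        by (auto intro!: sum_nonneg mult_nonneg_nonneg add_nonneg_nonneg less_imp_le[OF \<gamma>(1)])
      have "\<eta> * (\<gamma> k * w k * gsq k) \<le> \<psi> k (act k) * (\<gamma> k * w k * gsq k)"
        using \<eta>(2)[of k] \<gamma>(1)[of k] weight[of k] nn(1)[of k] by (intro mult_right_mono) auto
      also have "\<dots> = \<gamma> k * \<psi> k (act k) * w k * gsq k" by simp
      finally have "\<eta> * (\<gamma> k * w k * gsq k) \<le> \<Phi> k - \<Phi> (Suc k) + (\<gamma> k)\<^sup>2 * gsq k + L * (\<gamma> k)\<^sup>2 * dsq k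
         + 2 * \<Lambda>m * ec k + 2 * tsq k + \<gamma> k * \<bar>cross k\<bar>"
        using expected_descent[of k] unfolding \<Lambda>m_def by linarith
      moreover have "(\<gamma> k)\<^sup>2 * gsq k \<le> KK * ((\<gamma> k)\<^sup>2 * \<Phi> k)"
      proof -
        have "(\<gamma> k)\<^sup>2 * gsq k \<le> (\<gamma> k)\<^sup>2 * (KK * \<Phi> k)"
          using G mult_right_mono[OF KK(2) \<Phi>_nonneg[of k]] by (intro mult_left_mono) auto
        then show ?thesis by (simp add: mult_ac)
      qed
      moreover have "L * (\<gamma> k)\<^sup>2 * dsq k \<le> KK * ((\<gamma> k)\<^sup>2 * dsq k)"
        unfolding mult.assoc using KK(4) nn(2)[of k] by (intro mult_right_mono) auto
      moreover have "0 \<le> KK * (\<gamma> k)\<^sup>2" using KK(1) by simp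
      moreover have "2 * \<Lambda>m * ec k \<le> KK * ec k" "2 * tsq k \<le> KK * tsq k"
        using KK(5,8) nn(3)[of k] nn(4)[of k] by (auto intro: mult_right_mono)
      moreover have "\<gamma> k * \<bar>cross k\<bar> \<le> KK * (\<gamma> k * ?S)"
      proof -
        have "\<bar>cross k\<bar> \<le> KK * ?S"
          using cross_le[of k] mult_right_mono[OF KK(12) S] unfolding cx_def by linarith
        then have "\<gamma> k * \<bar>cross k\<bar> \<le> \<gamma> k * (KK * ?S)" using \<gamma>(1)[of k] by (intro mult_left_mono) auto
        then show ?thesis by (simp only: mult.left_commute)
      qed
      ultimately show ?thesis by (simp add: distrib_left)
    qed
    show "dsq k \<le> KK * (\<Phi> k + ec k + tsq k + 1)"
    proof -
      have "dsq k \<le> 4 * (c1 * \<Phi> k + \<Lambda>m * ec k + noise_bound + tsq k)"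
        using dsq_le[of k] G unfolding \<Lambda>m_def by (simp add: algebra_simps)
      also have "\<dots> = (4 * c1) * \<Phi> k + (4 * \<Lambda>m) * ec k + 4 * tsq k + 4 * noise_bound" by (simp add: algebra_simps)
      also have "\<dots> \<le> KK * \<Phi> k + KK * ec k + KK * tsq k + KK"
        using KK \<Phi>_nonneg[of k] nn(3)[of k] nn(4)[of k] by (intro add_mono mult_right_mono) auto
      finally show ?thesis by (simp add: distrib_left)
    qed
    show "ez k \<le> KK * (et k + w k * gsq k + ec k)"
    proof -
      have "2 * et k + 4 * (w k * gsq k) + (4 * \<Lambda>m) * ec k \<le> KK * et k + KK * (w k * gsq k) + KK * ec k"
        using KK nn[of k] weight[of k] by (intro add_mono mult_right_mono) auto
      then show ?thesis using ez_le[of k] unfolding \<Lambda>m_def by (simp add: distrib_left)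
    qed
  next
    fix n
    have "c\<tau> * (\<Sum>k\<le>n. ec k + (\<gamma> k)\<^sup>2 * dsq k) \<le> KK * (\<Sum>k\<le>n. ec k + (\<gamma> k)\<^sup>2 * dsq k)"
      using KK(11) nn by (intro mult_right_mono sum_nonneg) auto
    then show "(\<Sum>k\<le>n. tsq k) \<le> KK + KK * (\<Sum>k\<le>n. ec k + (\<gamma> k)\<^sup>2 * dsq k)"
      using B(2)[of n] KK(10) unfolding c\<tau>_def by linarith
    show "(\<Sum>k\<le>n. ec k) \<le> KK + KK * (\<Sum>k\<le>n. (\<gamma> k)\<^sup>2 * (ez k + 1))"
      by (rule summed_error_weakened[OF C2(1) KK(15) _ hc]) (use KK(13) in \<open>simp add: cc_def\<close>)
    show "(\<Sum>k\<le>n. et k) \<le> KK + KK * (\<Sum>k\<le>n. (\<gamma> k)\<^sup>2 * (ez k + 1))"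
      by (rule summed_error_weakened[OF C2(2) KK(16) _ ht]) (use KK(14) in \<open>simp add: ct_def\<close>)
  qed (use \<gamma> sq rate_bounds KK(1) \<eta>(1) weight \<Phi>_nonneg nn in auto)
qed

end

section \<open>From the bounded weighted sum to the ergodic rate\<close>

theorem mainTheorem1:
  fixes M :: "'o measure" and P :: "'z measure"
    and N :: async_network
    and f :: "nat \<Rightarrow> real ^ 'n \<Rightarrow> 'z \<Rightarrow> real" and Li :: "nat \<Rightarrow> real" and L :: real
    and \<gamma> :: "nat \<Rightarrow> real" and \<sigma> :: real
    and \<zeta>_init :: "'o \<Rightarrow> 'z" and \<zeta> :: "nat \<Rightarrow> 'o \<Rightarrow> 'z"
    and R :: "'o \<Rightarrow> (real ^ 'n) trajectory"
    and \<xi> :: "int \<Rightarrow> aug_node \<Rightarrow> real" and \<psi> :: "nat \<Rightarrow> nat \<Rightarrow> real"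
    and C\<^sub>0 \<rho> \<eta> C1c C2c C1t C2t :: real
  defines "m \<equiv> agents N" and "G \<equiv> true_grad P f"
  assumes "prob_space M"
    and "valid_problem P m f Li"
    and "L-lipschitz_on UNIV (grad (total_cost P m f))"
    and "valid_network N"
    and "samples_of M P \<zeta>_init \<zeta>"
    and "\<forall>\<omega>\<in>space M. is_run N (sample_grad f) \<gamma> (\<zeta>_init \<omega>) (\<lambda>k. \<zeta> k \<omega>) (R \<omega>)"
    and "stochastic_gradients M P N f \<zeta>_init \<zeta> R \<sigma>"
    and "C\<^sub>0 > 0" and "\<rho> < 1"
    and "tracking_sequence N C\<^sub>0 \<rho> \<xi>"
    and "consensus_sequence N C\<^sub>0 \<rho> \<psi>"
    and "\<eta> > 0" and "\<forall>k. \<forall>i\<in>nodes N. \<psi> k i \<ge> \<eta>"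
    and "C2c \<ge> 0" and "C2t \<ge> 0"
    and "\<forall>k. (\<Sum>l\<le>k. \<integral>\<omega>. E_c N \<psi> (R \<omega>) l \<partial>M)
           \<le> C1c + C2c * (\<Sum>l\<le>k. (\<gamma> l)\<^sup>2 * ((\<integral>\<omega>. E_z N G (R \<omega>) l \<partial>M) + real m * \<sigma>\<^sup>2))"
    and "\<forall>k. (\<Sum>l\<le>k. \<integral>\<omega>. E_t N G \<xi> (R \<omega>) l \<partial>M)
           \<le> C1t + C2t * (\<Sum>l\<le>k. (\<gamma> l)\<^sup>2 * ((\<integral>\<omega>. E_z N G (R \<omega>) l \<partial>M) + real m * \<sigma>\<^sup>2))"
    and "\<forall>k. 0 < \<gamma> k \<and> \<gamma> k \<le> 1"
    and "filterlim (\<lambda>K. \<Sum>k=1..K. \<gamma> k) at_top sequentially"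
    and "summable (\<lambda>k. (\<gamma> (Suc k))\<^sup>2)"
    and "\<gamma> 0 \<le> min (1 / (1 + \<eta>)) (1 / (4 * (L + C2c + C2t)))"
  shows "(\<forall>l. integrable M (\<lambda>\<omega>. E_t N G \<xi> (R \<omega>) l + E_c N \<psi> (R \<omega>) l + E_z N G (R \<omega>) l)) \<and>
    (\<exists>C>0. \<forall>k. ergodic_average \<gamma> (merit M N G \<xi> \<psi> R) k \<le> C / (\<Sum>l\<le>k. \<gamma> l))"
proof -
  have m: "m = agents N" and G: "G = true_grad P f" by (simp_all add: m_def G_def)
  interpret M: prob_space M by fact
  interpret P: prob_space P using assms(4) by (simp add: valid_problem_def)
  interpret sgd: async_sgd N M P f Li \<zeta>_init \<zeta> R \<gamma> \<sigma>
    by unfold_locales (use assms(4-9) in \<open>auto simp: m\<close>)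
  obtain r K where r: "0 \<le> \<rho>" "0 < r" "r < 1" "1 \<le> K"
    and rate: "\<And>k t p q. t \<le> k \<Longrightarrow> p \<in> aug_nodes N \<Longrightarrow> q \<in> aug_nodes N \<Longrightarrow>
       \<bar>chain_to (aug_nodes N) (A_hat N) k t p q - \<xi> (int k - 1) p\<bar> \<le> K * r ^ (k - t)"
    using sgd.tracking_rate[OF \<open>tracking_sequence N C\<^sub>0 \<rho> \<xi>\<close> \<open>C\<^sub>0 > 0\<close> \<open>\<rho> < 1\<close>] by metis
  obtain b where b: "\<And>x. b \<le> total_cost P (agents N) f x" using sgd.problem.total_cost_bounded_below by blast
  \<comment> \<open>A common Lipschitz constant of the local gradients; the sum dominates each
    summand because all \<open>Li i\<close> are nonnegative.\<close>
  define \<Lambda> where "\<Lambda> = (\<Sum>i\<in>nodes N. Li i)"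
  have \<Lambda>: "\<Lambda>-lipschitz_on UNIV (true_grad P f i)" if i: "i \<in> nodes N" for i
  proof (rule lipschitz_on_le[OF sgd.true_grad_lipschitz[OF i]])
    show "Li i \<le> \<Lambda>" unfolding \<Lambda>_def
      by (rule member_le_sum[OF i]) (auto simp: sgd.nodes_eq intro: sgd.problem.lipschitz_constant_nonneg)
  qed
  interpret tracked_sgd N M P f Li \<zeta>_init \<zeta> R \<gamma> \<sigma> \<xi> \<psi> r K \<Lambda> "L" b C\<^sub>0 \<rho>
  proof unfold_locales
    show "stochastic_vector (aug_nodes N) (\<xi> (int k - 1))" for k
      using \<open>tracking_sequence N C\<^sub>0 \<rho> \<xi>\<close> by (auto simp: tracking_sequence_def)
  qed (use r rate \<Lambda> b assms in \<open>auto simp: m\<close>)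
  have merit: "merit M N G \<xi> \<psi> R l = et l + ec l + ez l" for l
    unfolding merit_def et_def ec_def ez_def G using integrable_E_t[of l] integrable_E_c[of l] integrable_E_z[of l] by simp
  have integrable: "integrable M (\<lambda>\<omega>. E_t N G \<xi> (R \<omega>) l + E_c N \<psi> (R \<omega>) l + E_z N G (R \<omega>) l)" for l
    unfolding G using integrable_E_t[of l] integrable_E_c[of l] integrable_E_z[of l] by simp
  \<comment> \<open>Summability is assumed from index 1 on, whereas all sums in the estimate start
    at 0.\<close>
  have sq: "summable (\<lambda>k. (\<gamma> k)\<^sup>2)"
    using \<open>summable (\<lambda>k. (\<gamma> (Suc k))\<^sup>2)\<close> by (rule summable_Suc_iff[of "\<lambda>k. (\<gamma> k)\<^sup>2", THEN iffD1])
  have "\<exists>B. \<forall>n. (\<Sum>k\<le>n. \<gamma> k * (et k + ec k + ez k)) \<le> B"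
  proof (rule weighted_merit_bounded[OF \<open>\<eta> > 0\<close> _ sq \<open>C2c \<ge> 0\<close> \<open>C2t \<ge> 0\<close>])
    show "\<eta> \<le> \<psi> k (active N k)" for k using assms(15) sgd.active_node by blast
    show "(\<Sum>l\<le>n. ec l) \<le> C1c + C2c * (\<Sum>l\<le>n. (\<gamma> l)\<^sup>2 * (ez l + real (agents N) * \<sigma>\<^sup>2))" for n
      using assms(18) by (simp add: ec_def ez_def m G)
    show "(\<Sum>l\<le>n. et l) \<le> C1t + C2t * (\<Sum>l\<le>n. (\<gamma> l)\<^sup>2 * (ez l + real (agents N) * \<sigma>\<^sup>2))" for n
      using assms(19) by (simp add: et_def ez_def m G)
  qed
  then obtain B where B: "\<And>n. (\<Sum>k\<le>n. \<gamma> k * (et k + ec k + ez k)) \<le> B" by blast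
  \<comment> \<open>The numerator of the average is the bounded sum; the absolute value and the
    added 1 make the constant positive.\<close>
  have "ergodic_average \<gamma> (merit M N G \<xi> \<psi> R) k \<le> (\<bar>B\<bar> + 1) / (\<Sum>l\<le>k. \<gamma> l)" for k
    unfolding ergodic_average_def merit
  proof (rule divide_right_mono)
    show "(\<Sum>l\<le>k. \<gamma> l * (et l + ec l + ez l)) \<le> \<bar>B\<bar> + 1" using B[of k] by linarith
    show "0 \<le> (\<Sum>l\<le>k. \<gamma> l)" using \<gamma>(1) by (intro sum_nonneg less_imp_le)
  qed
  then have "\<exists>C>0. \<forall>k. ergodic_average \<gamma> (merit M N G \<xi> \<psi> R) k \<le> C / (\<Sum>l\<le>k. \<gamma> l)"
    by (intro exI[of _ "\<bar>B\<bar> + 1"]) auto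
  with integrable show ?thesis by blast
qed

end
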